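(* Let the Jacobi group $G^J_1$ act on $\mathcal{D}^J_1=\mathbb{C}\times\mathcal{D}_1$ (with composition law and action as in the context). Then: (i) The manifold $\mathcal{D}^J_1$ has the Kähler potential (the logarithm of the reproducing kernel $K(z,w;\bar z,\bar w)$) $$f=\frac{2z\bar z+z^2\bar w+\bar z^2w}{2(1-w\bar w)}-2k\log(1-w\bar w)$$ and the $G^J_1$-invariant Kähler two-form $\omega=i\partial\bar\partial f$ given by $$-i\omega=\frac{2k}{(1-w\bar w)^2}dw\wedge d\bar w+\frac{A\wedge\bar A}{1-w\bar w},\qquad A=dz+\bar\alpha_0dw,\quad \alpha_0=\frac{z+\bar zw}{1-w\bar w}.$$ (ii) The holomorphic polynomials $f_{|n\rangle;e_{k',k'+m}}(z,w):=(e_{\bar z,\bar w},|n\rangle e_{k',k'+m})$, $n,m=0,1,2,\dots$, associated to the coherent state vectors are $$f_{|n\rangle;e_{k',k'+m}}(z,w)=\sqrt{\frac{\Gamma(m+2k')}{m!\,\Gamma(2k')}}\;w^m\,\frac{P_n(z,w)}{\sqrt{n!}},\qquad P_n(z,w)=n!\sum_{q=0}^{[n/2]}\Big(\frac w2\Big)^q\frac{z^{n-2q}}{q!\,(n-2q)!},$$ where $2k=2k'+\frac12$. (iii) The Hilbert space $\mathcal{F}_K$ of holomorphic functions on $\mathcal{D}^J_1$ associated to the holomorphic kernel $$K(z,w;\bar z',\bar w')=(1-w\bar w')^{-2k}\exp\frac{2\bar z'z+z^2\bar w'+\bar z'^2w}{2(1-w\bar w')}$$ is endowed with the scalar product $$(\phi,\psi)=\Lambda\int_{z\in\mathbb{C},\,|w|<1}\bar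 f_\phi(z,w)f_\psi(z,w)(1-w\bar w)^{2k}\exp\Big(-\frac{|z|^2}{1-w\bar w}\Big)\exp\Big(-\frac{z^2\bar w+\bar z^2w}{2(1-w\bar w)}\Big)d\nu,$$ where the normalization constant is $\Lambda=\dfrac{4k-3}{2\pi^2}$ and the $G^J_1$-invariant measure is $$d\nu=\frac{d\operatorname{Re}w\,d\operatorname{Im}w}{(1-w\bar w)^3}\,d\operatorname{Re}z\,d\operatorname{Im}z.$$
   Context: Notation: $\mathcal{D}_1=\{w\in\mathbb{C}:|w|<1\}$; points of $\mathcal{D}^J_1$ are $(z,w)$. Jacobi group: $G^J_1=H_1\rtimes\mathrm{SU}(1,1)$ consists of triples $(g,\alpha,t)$, $g=\begin{pmatrix}a&b\\ \bar b&\bar a\end{pmatrix}\in\mathrm{SU}(1,1)$ ($|a|^2-|b|^2=1$), $\alpha\in\mathbb{C}$, $t\in\mathbb{R}$, with composition law $(g_1,\alpha_1,t_1)\circ(g_2,\alpha_2,t_2)=(g_1g_2,\ g_2^{-1}\cdot\alpha_1+\alpha_2,\ t_1+t_2+\operatorname{Im}((g_2^{-1}\cdot\alpha_1)\bar\alpha_2))$, where $g\cdot\alpha:=a\alpha+b\bar\alpha$, $g^{-1}\cdot\alpha=\bar a\alpha-b\bar\alpha$. It acts on $\mathcal{D}^J_1$ by $(z,w)\mapsto\left(\frac{\alpha-\bar\alpha w+z}{\bar bw+\bar a},\frac{aw+b}{\bar bw+\bar a}\right)$. Jacobi algebra: $\mathfrak{g}^J_1=\mathfrak{h}_1\rtimes\mathfrak{su}(1,1)$,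 where $\mathfrak{h}_1=\{is1+xa^+-\bar xa\}_{s\in\mathbb{R},x\in\mathbb{C}}$ and $\mathfrak{su}(1,1)=\{2i\theta K_0+yK_+-\bar yK_-\}_{\theta\in\mathbb{R},y\in\mathbb{C}}$, with ($1$ central) $[a,a^+]=1$; $[K_0,K_\pm]=\pm K_\pm$; $[K_-,K_+]=2K_0$; $[a,K_+]=a^+$; $[K_-,a^+]=a$; $[K_+,a^+]=[K_-,a]=0$; $[K_0,a^+]=\frac12a^+$; $[K_0,a]=-\frac12a$. One is given a continuous unitary representation of $G^J_1$ on a separable complex Hilbert space $\mathcal{H}$ (scalar product antilinear in the first argument); the complexified derived representation gives operators $a,a^+,\boldsymbol{K}_0,\boldsymbol{K}_\pm$ on the smooth vectors, satisfying these relations with $1$ acting as identity, and with $(a^+)^+=a$, $\boldsymbol{K}_0^+=\boldsymbol{K}_0$, $\boldsymbol{K}_\pm^+=\boldsymbol{K}_\mp$. There is a cyclic smooth vector $e_0$, $(e_0,e_0)=1$, with $ae_0=0$, $\boldsymbol{K}_-e_0=0$, $\boldsymbol{K}_0e_0=ke_0$, $k>0$, $2k\in\{2,3,\dots\}$. Coherent state vectors: $e_{z,w}:=e^{za^++w\boldsymbol{K}_+}e_0$, $z\in\mathbb{C}$, $|w|<1$. One has $(e_{\bar z,\bar w},e_{\bar z',\bar w'})=K(z,w;\bar z',\bar w')$. Put $\boldsymbol{K}'_+:=\boldsymbol{K}_+-\frac12(a^+)^2$ (which commutes with $a$ and $a^+$), $k'=k-\frac14$, and $$|n\rangle e_{k',k'+m}:=\frac{1}{\sqrt{n!}}\sqrt{\frac{\Gamma(2k')}{m!\,\Gamma(m+2k')}}\,(a^+)^n(\boldsymbol{K}'_+)^me_0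 .$$ For $\psi\in\mathcal{H}$, $f_\psi(z,w):=(e_{\bar z,\bar w},\psi)$. $\mathcal{F}_K$ is the reproducing kernel Hilbert space of holomorphic functions on $\mathcal{D}^J_1$ with kernel $K$; it consists of the functions $f_\psi$, $\psi\in\mathcal{H}$, with $(f_\phi,f_\psi)_{\mathcal{F}_K}=(\phi,\psi)_{\mathcal{H}}$. *)

theory Defs
  imports "HOL-Analysis.Analysis"
begin

section \<open>Complex Hilbert spaces\<close>

text \<open>The inner product is antilinear in the first argument. Completeness and the norm topology
  come from the superclass.\<close>

class complex_hilbert = banach +
  fixes scaleC :: "complex \<Rightarrow> 'a \<Rightarrow> 'a" (infixr "*\<^sub>C" 75)
    and cinner :: "'a \<Rightarrow> 'a \<Rightarrow> complex"
  assumes scaleC_add_right: "c *\<^sub>C (x + y) = c *\<^sub>C x + c *\<^sub>C y"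
    and scaleC_add_left: "(c + d) *\<^sub>C x = c *\<^sub>C x + d *\<^sub>C x"
    and scaleC_scaleC: "c *\<^sub>C d *\<^sub>C x = (c * d) *\<^sub>C x"
    and scaleC_of_real: "complex_of_real r *\<^sub>C x = r *\<^sub>R x"
    and cinner_commute: "cinner x y = cnj (cinner y x)"
    and cinner_add_right: "cinner x (y + z) = cinner x y + cinner x z"
    and cinner_scaleC_right: "cinner x (c *\<^sub>C y) = c * cinner x y"
    and cinner_self: "cinner x x = complex_of_real ((norm x)\<^sup>2)"

definition unitary_op :: "('h::complex_hilbert \<Rightarrow> 'h) \<Rightarrow> bool" where
  "unitary_op T \<longleftrightarrow>
     (\<forall>x y. T (x + y) = T x + T y) \<and> (\<forall>c x. T (c *\<^sub>C x) = c *\<^sub>C T x) \<and>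
     (\<forall>x y. cinner (T x) (T y) = cinner x y) \<and> surj T"


section \<open>Smooth maps and differential forms\<close>

text \<open>\<open>Ck_on n S f\<close> is meant for open \<open>S\<close> in a finite-dimensional space, where the existence of
  continuous iterated directional derivatives is the usual notion of class \<open>C\<^sup>n\<close>.\<close>

primrec Ck_on ::
  "nat \<Rightarrow> 'a::real_normed_vector set \<Rightarrow> ('a \<Rightarrow> 'b::real_normed_vector) \<Rightarrow> bool" where
  "Ck_on 0 S f \<longleftrightarrow> continuous_on S f"
| "Ck_on (Suc n) S f \<longleftrightarrow>
     (\<forall>x\<in>S. f differentiable at x) \<and> (\<forall>v. Ck_on n S (\<lambda>x. frechet_derivative f (at x) v))"

definition smooth_on ::
  "'a::real_normed_vector set \<Rightarrow> ('a \<Rightarrow> 'b::real_normed_vector) \<Rightarrow> bool" where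
  "smooth_on S f \<longleftrightarrow> (\<forall>n. Ck_on n S f)"

text \<open>Points and tangent vectors of \<open>\<complex>\<^sup>2\<close> are pairs \<open>(z, w)\<close>. A complex-valued two-form is a map
  \<open>\<omega> p u v\<close> of a point and two tangent vectors.\<close>

type_synonym C2 = "complex \<times> complex"

definition scale2 :: "complex \<Rightarrow> C2 \<Rightarrow> C2" where
  "scale2 c u = (c * fst u, c * snd u)"

definition wedge :: "(C2 \<Rightarrow> complex) \<Rightarrow> (C2 \<Rightarrow> complex) \<Rightarrow> C2 \<Rightarrow> C2 \<Rightarrow> complex" where
  "wedge \<alpha> \<beta> u v = \<alpha> u * \<beta> v - \<alpha> v * \<beta> u"

text \<open>Wirtinger derivatives in the complex direction \<open>e\<close>: for \<open>e = (1, 0)\<close> these are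
  \<open>\<partial>/\<partial>z\<close>, \<open>\<partial>/\<partial>z\<^bsup>-\<^esup>\<close>, for \<open>e = (0, 1)\<close> they are \<open>\<partial>/\<partial>w\<close>, \<open>\<partial>/\<partial>w\<^bsup>-\<^esup>\<close>.\<close>

definition wirt :: "C2 \<Rightarrow> (C2 \<Rightarrow> complex) \<Rightarrow> C2 \<Rightarrow> complex" where
  "wirt e F p = (frechet_derivative F (at p) e
      - \<i> * frechet_derivative F (at p) (scale2 \<i> e)) / 2"

definition wirt_bar :: "C2 \<Rightarrow> (C2 \<Rightarrow> complex) \<Rightarrow> C2 \<Rightarrow> complex" where
  "wirt_bar e F p = (frechet_derivative F (at p) e
      + \<i> * frechet_derivative F (at p) (scale2 \<i> e)) / 2"

definition del_delbar :: "(C2 \<Rightarrow> complex) \<Rightarrow> C2 \<Rightarrow> C2 \<Rightarrow> C2 \<Rightarrow> complex" where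
  "del_delbar F p u v =
     wirt (1, 0) (wirt_bar (1, 0) F) p * wedge fst (\<lambda>x. cnj (fst x)) u v +
     wirt (1, 0) (wirt_bar (0, 1) F) p * wedge fst (\<lambda>x. cnj (snd x)) u v +
     wirt (0, 1) (wirt_bar (1, 0) F) p * wedge snd (\<lambda>x. cnj (fst x)) u v +
     wirt (0, 1) (wirt_bar (0, 1) F) p * wedge snd (\<lambda>x. cnj (snd x)) u v"

definition ext_deriv2 ::
  "(C2 \<Rightarrow> C2 \<Rightarrow> C2 \<Rightarrow> complex) \<Rightarrow> C2 \<Rightarrow> C2 \<Rightarrow> C2 \<Rightarrow> C2 \<Rightarrow> complex" where
  "ext_deriv2 \<omega> p u v x =
     frechet_derivative (\<lambda>q. \<omega> q v x) (at p) u
   - frechet_derivative (\<lambda>q. \<omega> q u x) (at p) v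
   + frechet_derivative (\<lambda>q. \<omega> q u v) (at p) x"

definition kahler_form_on :: "C2 set \<Rightarrow> (C2 \<Rightarrow> C2 \<Rightarrow> C2 \<Rightarrow> complex) \<Rightarrow> bool" where
  "kahler_form_on S \<omega> \<longleftrightarrow>
     (\<forall>u v. smooth_on S (\<lambda>p. \<omega> p u v)) \<and>
     (\<forall>p\<in>S. (\<forall>u. linear (\<omega> p u)) \<and> (\<forall>u v. \<omega> p u v = - \<omega> p v u) \<and>
             (\<forall>u v. \<omega> p u v \<in> \<real>) \<and>
             (\<forall>u v. \<omega> p (scale2 \<i> u) (scale2 \<i> v) = \<omega> p u v) \<and>
             (\<forall>u. u \<noteq> 0 \<longrightarrow> Re (\<omega> p u (scale2 \<i> u)) > 0) \<and>
             (\<forall>u v x. ext_deriv2 \<omega> p u v x = 0))"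

text \<open>For open \<open>S\<close>.\<close>

definition holomorphic2_on :: "(C2 \<Rightarrow> complex) \<Rightarrow> C2 set \<Rightarrow> bool" where
  "holomorphic2_on F S \<longleftrightarrow>
     (\<forall>p\<in>S. \<exists>A B. (F has_derivative (\<lambda>u. A * fst u + B * snd u)) (at p))"

text \<open>\<open>H\<close> with the scalar product \<open>ip\<close> is the reproducing kernel Hilbert space of holomorphic
  functions on \<open>S\<close> with kernel \<open>K\<close> (holomorphic in the first, antiholomorphic in the second
  argument). A function on \<open>S\<close> is encoded as a total function vanishing outside \<open>S\<close>.\<close>

definition holomorphic_rkhs ::
  "C2 set \<Rightarrow> (C2 \<Rightarrow> C2 \<Rightarrow> complex) \<Rightarrow> (C2 \<Rightarrow> complex) set \<Rightarrow>
   ((C2 \<Rightarrow> complex) \<Rightarrow> (C2 \<Rightarrow> complex) \<Rightarrow> complex) \<Rightarrow> bool" where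
  "holomorphic_rkhs S K H ip \<longleftrightarrow>
     (\<forall>F\<in>H. holomorphic2_on F S \<and> (\<forall>p. p \<notin> S \<longrightarrow> F p = 0)) \<and>
     (\<lambda>_. 0) \<in> H \<and>
     (\<forall>F\<in>H. \<forall>G\<in>H. (\<lambda>p. F p + G p) \<in> H) \<and>
     (\<forall>c. \<forall>F\<in>H. (\<lambda>p. c * F p) \<in> H) \<and>
     (\<forall>E\<in>H. \<forall>F\<in>H. \<forall>G\<in>H. ip E (\<lambda>p. F p + G p) = ip E F + ip E G) \<and>
     (\<forall>c. \<forall>F\<in>H. \<forall>G\<in>H. ip F (\<lambda>p. c * G p) = c * ip F G) \<and>
     (\<forall>F\<in>H. \<forall>G\<in>H. ip F G = cnj (ip G F)) \<and>
     (\<forall>F\<in>H. F \<noteq> (\<lambda>_. 0) \<longrightarrow> Re (ip F F) > 0) \<and>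
     (\<forall>X::nat \<Rightarrow> C2 \<Rightarrow> complex.
        (\<forall>n. X n \<in> H) \<and>
        (\<forall>\<epsilon>>0. \<exists>N. \<forall>m\<ge>N. \<forall>n\<ge>N. Re (ip (\<lambda>p. X m p - X n p) (\<lambda>p. X m p - X n p)) < \<epsilon>) \<longrightarrow>
        (\<exists>F\<in>H. (\<lambda>n. Re (ip (\<lambda>p. X n p - F p) (\<lambda>p. X n p - F p))) \<longlonglongrightarrow> 0)) \<and>
     (\<forall>q\<in>S. (\<lambda>p. if p \<in> S then K p q else 0) \<in> H \<and>
            (\<forall>F\<in>H. ip (\<lambda>p. if p \<in> S then K p q else 0) F = F q))"


section \<open>The Jacobi group and its action\<close>

definition su_mat :: "complex \<Rightarrow> complex \<Rightarrow> complex^2^2" where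
  "su_mat a b = vector [vector [a, b], vector [cnj b, cnj a]]"

definition SU11 :: "(complex^2^2) set" where
  "SU11 = {su_mat a b | a b. (cmod a)\<^sup>2 - (cmod b)\<^sup>2 = 1}"

type_synonym jacobi = "(complex^2^2) \<times> complex \<times> real"

definition jacobi_group :: "jacobi set" where
  "jacobi_group = SU11 \<times> UNIV \<times> UNIV"

definition jacobi_one :: jacobi where
  "jacobi_one = (mat 1, 0, 0)"

text \<open>\<open>su_inv_act g \<alpha>\<close> is \<open>g\<^sup>-\<^sup>1 \<cdot> \<alpha>\<close>.\<close>

definition su_inv_act :: "complex^2^2 \<Rightarrow> complex \<Rightarrow> complex" where
  "su_inv_act g \<alpha> = cnj (g $ 1 $ 1) * \<alpha> - g $ 1 $ 2 * cnj \<alpha>"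

fun jacobi_mult :: "jacobi \<Rightarrow> jacobi \<Rightarrow> jacobi" where
  "jacobi_mult (g1, \<alpha>1, t1) (g2, \<alpha>2, t2) =
     (g1 ** g2, su_inv_act g2 \<alpha>1 + \<alpha>2, t1 + t2 + Im (su_inv_act g2 \<alpha>1 * cnj \<alpha>2))"

definition DJ :: "C2 set" where
  "DJ = {(z, w). cmod w < 1}"

fun jacobi_act :: "jacobi \<Rightarrow> C2 \<Rightarrow> C2" where
  "jacobi_act (g, \<alpha>, t) (z, w) =
     ((\<alpha> - cnj \<alpha> * w + z) / (g $ 2 $ 1 * w + g $ 2 $ 2),
      (g $ 1 $ 1 * w + g $ 1 $ 2) / (g $ 2 $ 1 * w + g $ 2 $ 2))"

definition jacobi_measure :: "C2 measure" where
  "jacobi_measure =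
     density (restrict_space lborel DJ) (\<lambda>(z, w). ennreal (1 / (1 - (cmod w)\<^sup>2) ^ 3))"


section \<open>Unitary representations of the Jacobi group\<close>

definition continuous_unitary_rep :: "(jacobi \<Rightarrow> 'h \<Rightarrow> 'h::complex_hilbert) \<Rightarrow> bool" where
  "continuous_unitary_rep U \<longleftrightarrow>
     (\<forall>g\<in>jacobi_group. unitary_op (U g)) \<and>
     U jacobi_one = id \<and>
     (\<forall>g\<in>jacobi_group. \<forall>h\<in>jacobi_group. U (jacobi_mult g h) = U g \<circ> U h) \<and>
     (\<forall>v. continuous_on jacobi_group (\<lambda>g. U g v))"

definition cyclic_vector :: "(jacobi \<Rightarrow> 'h \<Rightarrow> 'h::complex_hilbert) \<Rightarrow> 'h \<Rightarrow> bool" where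
  "cyclic_vector U v \<longleftrightarrow> closure (module.span scaleC ((\<lambda>g. U g v) ` jacobi_group)) = UNIV"

text \<open>The map \<open>jacobi_chart\<close> is a smooth covering of the group by \<open>\<real>\<^sup>6\<close>, hence a local
  diffeomorphism onto the group, so a function on the group is smooth iff its pullback is.
  It sends \<open>0\<close> to the identity, and its differential at \<open>0\<close> identifies
  \<open>(\<theta>, y, x, s)\<close> with the element \<open>2i\<theta>K\<^sub>0 + yK\<^sub>+ - y\<^bsup>-\<^esup>K\<^sub>- + xa\<^sup>+ - x\<^bsup>-\<^esup>a + is1\<close> of the Jacobi algebra;
  here \<open>2i\<theta>K\<^sub>0 + yK\<^sub>+ - y\<^bsup>-\<^esup>K\<^sub>-\<close> is the matrix with rows \<open>(i\<theta>, y)\<close> and \<open>(y\<^bsup>-\<^esup>, -i\<theta>)\<close>, the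
  identification for which the semidirect product law yields \<open>[a, K\<^sub>+] = a\<^sup>+\<close>.\<close>

type_synonym jacobi_alg = "real \<times> complex \<times> complex \<times> real"

fun jacobi_chart :: "jacobi_alg \<Rightarrow> jacobi" where
  "jacobi_chart (\<theta>, b, \<alpha>, t) =
     (su_mat (complex_of_real (sqrt (1 + (cmod b)\<^sup>2)) * cis \<theta>) b, \<alpha>, t)"

definition smooth_vectors :: "(jacobi \<Rightarrow> 'h \<Rightarrow> 'h::complex_hilbert) \<Rightarrow> 'h set" where
  "smooth_vectors U = {v. smooth_on UNIV (\<lambda>p. U (jacobi_chart p) v)}"

text \<open>The derived representation: the differential at the identity of the orbit map of \<open>v\<close>.\<close>

definition derived_rep ::
  "(jacobi \<Rightarrow> 'h \<Rightarrow> 'h::complex_hilbert) \<Rightarrow> jacobi_alg \<Rightarrow> 'h \<Rightarrow> 'h" where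
  "derived_rep U X v = frechet_derivative (\<lambda>p. U (jacobi_chart p) v) (at 0) X"

text \<open>Its complexification, obtained by solving, e.g.,
  \<open>a\<^sup>+ - a = derived_rep U (0, 0, 1, 0)\<close> and \<open>i(a\<^sup>+ + a) = derived_rep U (0, 0, i, 0)\<close>.\<close>

definition op_ad :: "(jacobi \<Rightarrow> 'h \<Rightarrow> 'h::complex_hilbert) \<Rightarrow> 'h \<Rightarrow> 'h" where
  "op_ad U v = (1/2) *\<^sub>C (derived_rep U (0, 0, 1, 0) v - \<i> *\<^sub>C derived_rep U (0, 0, \<i>, 0) v)"

definition op_a :: "(jacobi \<Rightarrow> 'h \<Rightarrow> 'h::complex_hilbert) \<Rightarrow> 'h \<Rightarrow> 'h" where
  "op_a U v = (-1/2) *\<^sub>C (derived_rep U (0, 0, 1, 0) v + \<i> *\<^sub>C derived_rep U (0, 0, \<i>, 0) v)"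

definition op_K0 :: "(jacobi \<Rightarrow> 'h \<Rightarrow> 'h::complex_hilbert) \<Rightarrow> 'h \<Rightarrow> 'h" where
  "op_K0 U v = (-\<i>/2) *\<^sub>C derived_rep U (1, 0, 0, 0) v"

definition op_Kp :: "(jacobi \<Rightarrow> 'h \<Rightarrow> 'h::complex_hilbert) \<Rightarrow> 'h \<Rightarrow> 'h" where
  "op_Kp U v = (1/2) *\<^sub>C (derived_rep U (0, 1, 0, 0) v - \<i> *\<^sub>C derived_rep U (0, \<i>, 0, 0) v)"

definition op_Km :: "(jacobi \<Rightarrow> 'h \<Rightarrow> 'h::complex_hilbert) \<Rightarrow> 'h \<Rightarrow> 'h" where
  "op_Km U v = (-1/2) *\<^sub>C (derived_rep U (0, 1, 0, 0) v + \<i> *\<^sub>C derived_rep U (0, \<i>, 0, 0) v)"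

text \<open>The Lie algebra relations on smooth vectors, with the central element \<open>1\<close> acting as the
  identity, and the adjointness relations.\<close>

definition jacobi_relations :: "(jacobi \<Rightarrow> 'h \<Rightarrow> 'h::complex_hilbert) \<Rightarrow> bool" where
  "jacobi_relations U \<longleftrightarrow>
     (let a = op_a U; ad = op_ad U; K0 = op_K0 U; Kp = op_Kp U; Km = op_Km U in
      (\<forall>v\<in>smooth_vectors U.
         a v \<in> smooth_vectors U \<and> ad v \<in> smooth_vectors U \<and> K0 v \<in> smooth_vectors U \<and>
         Kp v \<in> smooth_vectors U \<and> Km v \<in> smooth_vectors U \<and>
         derived_rep U (0, 0, 0, 1) v = \<i> *\<^sub>C v \<and>
         a (ad v) - ad (a v) = v \<and>
         K0 (Kp v) - Kp (K0 v) = Kp v \<and>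
         K0 (Km v) - Km (K0 v) = - Km v \<and>
         Km (Kp v) - Kp (Km v) = 2 *\<^sub>C K0 v \<and>
         a (Kp v) - Kp (a v) = ad v \<and>
         Km (ad v) - ad (Km v) = a v \<and>
         Kp (ad v) - ad (Kp v) = 0 \<and>
         Km (a v) - a (Km v) = 0 \<and>
         K0 (ad v) - ad (K0 v) = (1/2) *\<^sub>C ad v \<and>
         K0 (a v) - a (K0 v) = (-1/2) *\<^sub>C a v) \<and>
      (\<forall>u\<in>smooth_vectors U. \<forall>v\<in>smooth_vectors U.
         cinner (ad u) v = cinner u (a v) \<and>
         cinner (K0 u) v = cinner u (K0 v) \<and>
         cinner (Kp u) v = cinner u (Km v)))"


section \<open>Coherent states\<close>

text \<open>\<open>e\<^sub>z\<^sub>,\<^sub>w = exp (z a\<^sup>+ + w K\<^sub>+) e\<^sub>0\<close>, the exponential being the norm limit of its power series.\<close>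

definition coherent :: "(jacobi \<Rightarrow> 'h \<Rightarrow> 'h::complex_hilbert) \<Rightarrow> 'h \<Rightarrow> C2 \<Rightarrow> 'h" where
  "coherent U e0 = (\<lambda>(z, w).
     (\<Sum>n. (1 / fact n) *\<^sub>C ((\<lambda>v. z *\<^sub>C op_ad U v + w *\<^sub>C op_Kp U v) ^^ n) e0))"

definition conj2 :: "C2 \<Rightarrow> C2" where
  "conj2 p = (cnj (fst p), cnj (snd p))"

text \<open>\<open>coh_kernel U e0 (z, w) (z', w')\<close> is \<open>K\<close> with its last two arguments the conjugates of
  \<open>z', w'\<close>.\<close>

definition coh_kernel ::
  "(jacobi \<Rightarrow> 'h \<Rightarrow> 'h::complex_hilbert) \<Rightarrow> 'h \<Rightarrow> C2 \<Rightarrow> C2 \<Rightarrow> complex" where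
  "coh_kernel U e0 p q = cinner (coherent U e0 (conj2 p)) (coherent U e0 (conj2 q))"

definition coh_fun ::
  "(jacobi \<Rightarrow> 'h \<Rightarrow> 'h::complex_hilbert) \<Rightarrow> 'h \<Rightarrow> 'h \<Rightarrow> C2 \<Rightarrow> complex" where
  "coh_fun U e0 \<psi> p = (if p \<in> DJ then cinner (coherent U e0 (conj2 p)) \<psi> else 0)"

text \<open>The diagonal of the kernel is a squared norm, so taking the real part loses nothing.\<close>

definition kahler_potential ::
  "(jacobi \<Rightarrow> 'h \<Rightarrow> 'h::complex_hilbert) \<Rightarrow> 'h \<Rightarrow> C2 \<Rightarrow> real" where
  "kahler_potential U e0 p = ln (Re (coh_kernel U e0 p p))"

definition op_Kp' :: "(jacobi \<Rightarrow> 'h \<Rightarrow> 'h::complex_hilbert) \<Rightarrow> 'h \<Rightarrow> 'h" where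
  "op_Kp' U v = op_Kp U v - (1/2) *\<^sub>C op_ad U (op_ad U v)"

text \<open>The vectors \<open>|n\<rangle> e\<^bsub>k',k'+m\<^esub>\<close> with \<open>k' = kp\<close>.\<close>

definition basis_vec ::
  "(jacobi \<Rightarrow> 'h \<Rightarrow> 'h::complex_hilbert) \<Rightarrow> 'h \<Rightarrow> real \<Rightarrow> nat \<Rightarrow> nat \<Rightarrow> 'h" where
  "basis_vec U e0 kp n m =
     complex_of_real (1 / sqrt (fact n) * sqrt (Gamma (2 * kp) / (fact m * Gamma (real m + 2 * kp))))
       *\<^sub>C (op_ad U ^^ n) ((op_Kp' U ^^ m) e0)"

definition P_poly :: "nat \<Rightarrow> complex \<Rightarrow> complex \<Rightarrow> complex" where
  "P_poly n z w =
     fact n * (\<Sum>q\<le>n div 2. (w / 2) ^ q * (z ^ (n - 2 * q) / (fact q * fact (n - 2 * q))))"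

end

(* The lowest weight relations alone determine all scalar products of the vectors
   (a^+)^i K_+^j e_0, so the exponential series of e_{z,w} converges for |w| < 1 and the kernel K,
   the Kaehler potential log K and the polynomials f_{|n>;e_{k',k'+m}} come out in closed form; the
   generating function of the P_n is exp(z t + w t^2 / 2).  Solving the differential equations of
   one-parameter subgroups shows that U g maps each line C e_{z,w} to the line over the translated
   point.  Hence f |-> |f|^2 / K(p, p) integrated against the invariant measure is a U-invariant
   form B.  Averaging over rotations, the mean value property evaluates B(e_0, -) at a value of f at
   the origin, so B agrees with the scalar product on the span of the orbit of e_0; Fatou's lemma
   and cyclicity carry the identity to the whole Hilbert space. *)
theory Submission
  imports Defs "HOL-Complex_Analysis.Complex_Analysis" "HOL-Probability.Distributions"
begin

subsection \<open>Complex Hilbert spaces\<close>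

text \<open>The vectors \<open>E p\<close> are norm limits of smooth vectors and are not known to be
  smooth, so \<open>op_a\<close> and \<open>op_Km\<close> are never applied to them. Operator
  identities for \<open>E p\<close> become statements about its series: convergence of the images of
  the terms, or the relation \<open>gen\<close>, the graph of the generator of a one-parameter
  subgroup, which survives limits. Convergence of the series is delicate as well, since a^+ and K_+
  are unbounded and |w| < 1 leaves no room. Norms are explicit only after K_+ is split into the
  commuting parts K'_+ and (a^+)^2/2, and the triangle inequality has to be organised so that the
  splitting does not shrink the disc. On the side of the integral, square integrability of f_\<psi>
  is a conclusion. It is known at the start for e_0 alone, whose function is constantly 1; there the
  integral is the total mass of 1/K(p, p), and its reciprocal is the constant \<Lambda>. Since
  f_\<psi> is evaluated at the conjugate point, U g moves its argument by the group element with
  conjugated entries.\<close>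

lemma scaleC_zero_right [simp]: "c *\<^sub>C (0::'a::complex_hilbert) = 0"
  using scaleC_add_right[of c 0 0] by simp

lemma scaleC_zero_left [simp]: "0 *\<^sub>C (x::'a::complex_hilbert) = 0"
  using scaleC_add_left[of 0 0 x] by simp

lemma scaleC_one [simp]: "1 *\<^sub>C (x::'a::complex_hilbert) = x"
  using scaleC_of_real[of 1 x] by simp

lemma scaleC_minus_right: "c *\<^sub>C (- x) = - (c *\<^sub>C (x::'a::complex_hilbert))"
  using scaleC_add_right[of c x "-x"] by (simp add: eq_neg_iff_add_eq_0 add.commute)

lemma scaleC_minus_left: "(- c) *\<^sub>C x = - (c *\<^sub>C (x::'a::complex_hilbert))"
  using scaleC_add_left[of c "-c" x] by (simp add: eq_neg_iff_add_eq_0 add.commute)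

lemma scaleC_diff_right: "c *\<^sub>C (x - y) = c *\<^sub>C x - c *\<^sub>C (y::'a::complex_hilbert)"
  using scaleC_add_right[of c x "-y"] by (simp add: scaleC_minus_right)

lemma scaleC_diff_left: "(c - d) *\<^sub>C x = c *\<^sub>C x - d *\<^sub>C (x::'a::complex_hilbert)"
  using scaleC_add_left[of c "-d" x] by (simp add: scaleC_minus_left)

lemma scaleR_scaleC: "r *\<^sub>R (c *\<^sub>C x) = c *\<^sub>C (r *\<^sub>R (x::'a::complex_hilbert))"
  by (metis mult.commute scaleC_of_real scaleC_scaleC)

lemma scaleC_sum_right: "c *\<^sub>C sum f A = (\<Sum>i\<in>A. c *\<^sub>C (f i :: 'a::complex_hilbert))"
  by (induction A rule: infinite_finite_induct) (auto simp: scaleC_add_right)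

lemma cinner_zero_right [simp]: "cinner x (0::'a::complex_hilbert) = 0"
  using cinner_add_right[of x 0 0] by simp

lemma cinner_zero_left [simp]: "cinner (0::'a::complex_hilbert) x = 0"
  using cinner_commute[of 0 x] by simp

lemma cinner_minus_right: "cinner x (- y) = - cinner x (y::'a::complex_hilbert)"
  using cinner_add_right[of x y "-y"] by (simp add: eq_neg_iff_add_eq_0 add.commute)

lemma cinner_diff_right: "cinner x (y - z) = cinner x y - cinner x (z::'a::complex_hilbert)"
  using cinner_add_right[of x y "-z"] by (simp add: cinner_minus_right)

lemma cinner_add_left: "cinner (x + y) z = cinner x z + cinner y (z::'a::complex_hilbert)"
  by (metis cinner_add_right cinner_commute complex_cnj_add)

lemma cinner_scaleC_left: "cinner (c *\<^sub>C x) y = cnj c * cinner x (y::'a::complex_hilbert)"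
  by (metis cinner_commute cinner_scaleC_right complex_cnj_mult)

lemma cinner_diff_left: "cinner (x - y) z = cinner x z - cinner y (z::'a::complex_hilbert)"
  by (metis cinner_diff_right cinner_commute complex_cnj_diff)

lemma cinner_sum_left: "cinner (sum f A) x = (\<Sum>i\<in>A. cinner (f i) (x :: 'a::complex_hilbert))"
  by (induction A rule: infinite_finite_induct) (auto simp: cinner_add_left)

lemma norm_scaleC: "norm (c *\<^sub>C x) = cmod c * norm (x::'a::complex_hilbert)"
proof -
  have "complex_of_real ((norm (c *\<^sub>C x))\<^sup>2) = complex_of_real ((cmod c * norm x)\<^sup>2)"
    unfolding cinner_self[symmetric] cinner_scaleC_left cinner_scaleC_right
    by (simp add: cinner_self power_mult_distrib complex_norm_square del: of_real_power)
  then have "(norm (c *\<^sub>C x))\<^sup>2 = (cmod c * norm x)\<^sup>2"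
    using of_real_eq_iff by blast
  then show ?thesis by (simp add: power2_eq_iff_nonneg)
qed

lemma cmod_cinner_le: "cmod (cinner x y) \<le> norm x * norm (y::'a::complex_hilbert)"
proof (cases "y = 0")
  case False
  \<comment> \<open>\<open>c\<close> is the coefficient of the orthogonal projection of
    \<open>x\<close> onto \<open>y\<close>; the inequality says that the remainder has nonnegative
    squared norm.\<close>
  define c where "c = cinner y x / (norm y)\<^sup>2"
  have ny: "norm y > 0" using False by simp
  have "complex_of_real ((norm (x - c *\<^sub>C y))\<^sup>2) = cinner (x - c *\<^sub>C y) (x - c *\<^sub>C y)"
    by (rule cinner_self[symmetric])
  also have "\<dots> = of_real ((norm x)\<^sup>2) - c * cnj (cinner y x) - cnj c * cinner y x
        + c * cnj c * of_real ((norm y)\<^sup>2)"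
    by (simp add: cinner_diff_left cinner_diff_right cinner_scaleC_left cinner_scaleC_right
        cinner_self[of x] cinner_self[of y] algebra_simps cinner_commute[of x y])
  also have "\<dots> = of_real ((norm x)\<^sup>2 - (cmod (cinner y x))\<^sup>2 / (norm y)\<^sup>2)"
    using ny unfolding c_def
    by (simp add: field_simps complex_norm_square del: of_real_power)
  finally have "(norm (x - c *\<^sub>C y))\<^sup>2 = (norm x)\<^sup>2 - (cmod (cinner y x))\<^sup>2 / (norm y)\<^sup>2"
    using of_real_eq_iff by blast
  then have "(cmod (cinner y x))\<^sup>2 / (norm y)\<^sup>2 \<le> (norm x)\<^sup>2"
    by (metis diff_ge_0_iff_ge zero_le_power2)
  then have "(cmod (cinner y x))\<^sup>2 \<le> (norm x * norm y)\<^sup>2"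
    using ny by (simp add: divide_le_eq power_mult_distrib)
  then have "cmod (cinner y x) \<le> norm x * norm y"
    by (rule power2_le_imp_le) auto
  then show ?thesis by (metis cinner_commute complex_mod_cnj)
qed simp

text \<open>Over the reals the antilinearity of the first argument disappears, so limits, series and
  product rules for \<open>cinner\<close> come from the general theory of bounded bilinear
  maps.\<close>

lemma bounded_bilinear_cinner:
  "bounded_bilinear (cinner :: 'a \<Rightarrow> 'a::complex_hilbert \<Rightarrow> complex)"
proof
  fix r :: real and a b :: 'a
  show "cinner (r *\<^sub>R a) b = r *\<^sub>R cinner a b" "cinner a (r *\<^sub>R b) = r *\<^sub>R cinner a b"
    by (simp_all flip: scaleC_of_real add: cinner_scaleC_left cinner_scaleC_right scaleR_conv_of_real)
  show "\<exists>K. \<forall>(a::'a) b. norm (cinner a b) \<le> norm a * norm b * K"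
    by (rule exI[of _ 1]) (simp add: cmod_cinner_le)
qed (simp_all add: cinner_add_left cinner_add_right)

lemma bounded_bilinear_scaleC:
  "bounded_bilinear (scaleC :: complex \<Rightarrow> 'a \<Rightarrow> 'a::complex_hilbert)"
proof
  fix r :: real and a b and x y :: 'a
  show "(r *\<^sub>R a) *\<^sub>C x = r *\<^sub>R a *\<^sub>C x"
    by (simp add: scaleR_conv_of_real flip: scaleC_of_real scaleC_scaleC)
  show "a *\<^sub>C r *\<^sub>R x = r *\<^sub>R a *\<^sub>C x"
    by (simp add: scaleR_scaleC)
  show "\<exists>K. \<forall>a (b::'a). norm (a *\<^sub>C b) \<le> norm a * norm b * K"
    by (rule exI[of _ 1]) (simp add: norm_scaleC)
qed (simp_all add: scaleC_add_left scaleC_add_right)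

lemmas bounded_linear_cinner_right = bounded_bilinear.bounded_linear_right[OF bounded_bilinear_cinner]
lemmas bounded_linear_cinner_left = bounded_bilinear.bounded_linear_left[OF bounded_bilinear_cinner]
lemmas bounded_linear_scaleC_right = bounded_bilinear.bounded_linear_right[OF bounded_bilinear_scaleC]
lemmas bounded_linear_scaleC_left = bounded_bilinear.bounded_linear_left[OF bounded_bilinear_scaleC]

lemma module_scaleC: "module (scaleC :: complex \<Rightarrow> 'a \<Rightarrow> 'a::complex_hilbert)"
  by standard (simp_all add: scaleC_add_left scaleC_add_right scaleC_scaleC)

text \<open>Polarization: apply the hypothesis to \<open>x + y\<close> and \<open>x + \<i> y\<close>.\<close>

lemma sesquilinear_eq_cinner:
  fixes B :: "'a::complex_hilbert \<Rightarrow> 'a \<Rightarrow> complex"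
  assumes addl: "\<And>x y z. B (x + y) z = B x z + B y z"
    and addr: "\<And>x y z. B x (y + z) = B x y + B x z"
    and scl: "\<And>c x y. B (c *\<^sub>C x) y = cnj c * B x y"
    and scr: "\<And>c x y. B x (c *\<^sub>C y) = c * B x y"
    and diag: "\<And>x. B x x = cinner x x"
  shows "B x y = cinner x y"
proof -
  have 1: "B x y + B y x = cinner x y + cinner y x"
    using diag[of "x + y"] diag[of x] diag[of y]
    by (simp add: addl addr cinner_add_left cinner_add_right add.commute)
  have 2: "\<i> * B x y - \<i> * B y x = \<i> * cinner x y - \<i> * cinner y x"
    using diag[of "x + \<i> *\<^sub>C y"] diag[of x] diag[of y]
    by (simp add: addl addr scl scr cinner_add_left cinner_add_right cinner_scaleC_left
        cinner_scaleC_right algebra_simps)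
  from 2 have "B x y - B y x = cinner x y - cinner y x"
    by (metis (no_types, lifting) complex_i_not_zero mult_cancel_left right_diff_distrib)
  with 1 have "(B x y + B y x) + (B x y - B y x) = 2 * cinner x y" by simp
  then show ?thesis by simp
qed

subsection \<open>Maps of class \<open>C\<^sup>n\<close>\<close>

text \<open>Openness makes derivatives at points of \<open>S\<close> depend on the values on
  \<open>S\<close> only. This is needed for functions such as \<open>kahler_potential\<close>, whose
  closed form holds on \<open>DJ\<close>.\<close>

lemma Ck_on_cong:
  assumes "open S" "\<And>x. x \<in> S \<Longrightarrow> f x = g x" "Ck_on n S f"
  shows "Ck_on n S g"
  using assms(2,3)
proof (induction n arbitrary: f g)
  case 0
  then show ?case by (auto cong: continuous_on_cong)
next
  case (Suc n)
  have der: "(g has_derivative frechet_derivative f (at x)) (at x)" if "x \<in> S" for x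
    using Suc.prems that \<open>open S\<close>
    by (auto intro: has_derivative_transform_within_open simp: frechet_derivative_works)
  then have eq: "frechet_derivative g (at x) = frechet_derivative f (at x)" if "x \<in> S" for x
    using frechet_derivative_at that by metis
  have "Ck_on n S (\<lambda>x. frechet_derivative g (at x) v)" for v
    by (rule Suc.IH[of "\<lambda>x. frechet_derivative f (at x) v"]) (use Suc.prems eq in auto)
  then show ?case using der by (auto simp: differentiable_def)
qed

text \<open>\<open>frechet_derivative\<close> is a choice operator; this rule trades it for any
  explicit derivative, and the closure properties below rest on it.\<close>

lemma Ck_on_SucI:
  assumes "open S" "\<And>x. x \<in> S \<Longrightarrow> (f has_derivative f' x) (at x)"
    and "\<And>v. Ck_on n S (\<lambda>x. f' x v)"
  shows "Ck_on (Suc n) S f"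
proof -
  have eq: "frechet_derivative f (at x) = f' x" if "x \<in> S" for x
    using assms(2)[OF that] frechet_derivative_at by metis
  have "Ck_on n S (\<lambda>x. frechet_derivative f (at x) v)" for v
    by (rule Ck_on_cong[OF assms(1) _ assms(3)[of v]]) (simp add: eq)
  then show ?thesis using assms(2) by (auto simp: differentiable_def)
qed

lemma Ck_on_SucD:
  assumes "Ck_on (Suc n) S f"
  shows "x \<in> S \<Longrightarrow> (f has_derivative frechet_derivative f (at x)) (at x)"
    and "Ck_on n S (\<lambda>x. frechet_derivative f (at x) v)"
  using assms by (auto simp: frechet_derivative_works)

lemma Ck_on_Suc_imp: "Ck_on (Suc n) S f \<Longrightarrow> Ck_on n S f"
proof (induction n arbitrary: f)
  case 0
  then show ?case
    by (auto intro!: continuous_at_imp_continuous_on differentiable_imp_continuous_within)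
qed auto

lemma Ck_on_const: "open S \<Longrightarrow> Ck_on n S (\<lambda>_. c)"
  by (induction n arbitrary: c) (auto intro!: Ck_on_SucI[of _ _ "\<lambda>_ _. 0"] simp del: Ck_on.simps(2))

lemma Ck_on_bounded_linear: "open S \<Longrightarrow> bounded_linear f \<Longrightarrow> Ck_on n S f"
  by (cases n)
    (auto intro!: Ck_on_SucI[of _ _ "\<lambda>_. f"] Ck_on_const bounded_linear_imp_has_derivative
      linear_continuous_on simp del: Ck_on.simps(2))

lemma Ck_on_linear_comp:
  assumes "open S" "bounded_linear L" "Ck_on n S f"
  shows "Ck_on n S (\<lambda>x. L (f x))"
  using assms(3)
proof (induction n arbitrary: f)
  case 0
  then show ?case using bounded_linear.continuous_on[OF assms(2)] by auto
next
  case (Suc n)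
  show ?case
    by (rule Ck_on_SucI[OF assms(1), where f' = "\<lambda>x v. L (frechet_derivative f (at x) v)"])
      (use Ck_on_SucD[OF Suc.prems] in
        \<open>auto intro: bounded_linear.has_derivative[OF assms(2)] Suc.IH\<close>)
qed

lemma Ck_on_add:
  assumes "open S" "Ck_on n S f" "Ck_on n S g"
  shows "Ck_on n S (\<lambda>x. f x + g x)"
  using assms(2,3)
proof (induction n arbitrary: f g)
  case (Suc n)
  show ?case
    by (rule Ck_on_SucI[OF assms(1), where
          f' = "\<lambda>x v. frechet_derivative f (at x) v + frechet_derivative g (at x) v"])
      (use Ck_on_SucD[OF Suc.prems(1)] Ck_on_SucD[OF Suc.prems(2)] in
        \<open>auto intro: has_derivative_add Suc.IH\<close>)
qed (auto intro: continuous_on_add)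

lemma Ck_on_bilinear:
  assumes "open S" "bounded_bilinear P" "Ck_on n S f" "Ck_on n S g"
  shows "Ck_on n S (\<lambda>x. P (f x) (g x))"
  using assms(3,4)
proof (induction n arbitrary: f g)
  case 0
  then show ?case using bounded_bilinear.continuous_on[OF assms(2)] by auto
next
  case (Suc n)
  note fg = Ck_on_Suc_imp[OF Suc.prems(1)] Ck_on_Suc_imp[OF Suc.prems(2)]
  show ?case
    by (rule Ck_on_SucI[OF assms(1), where f' = "\<lambda>x v. P (f x) (frechet_derivative g (at x) v)
            + P (frechet_derivative f (at x) v) (g x)"])
      (use Ck_on_SucD[OF Suc.prems(1)] Ck_on_SucD[OF Suc.prems(2)] fg in
        \<open>auto intro!: bounded_bilinear.FDERIV[OF assms(2)] Ck_on_add[OF assms(1)] Suc.IH\<close>)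
qed

text \<open>The derivative of 1/f contains 1/f again, so the induction feeds its own hypothesis back
  into the product rule.\<close>

lemma Ck_on_inverse:
  fixes f :: "'a::real_normed_vector \<Rightarrow> 'b::real_normed_field"
  assumes "open S" "Ck_on n S f" "\<And>x. x \<in> S \<Longrightarrow> f x \<noteq> 0"
  shows "Ck_on n S (\<lambda>x. inverse (f x))"
  using assms(2)
proof (induction n)
  case 0
  then show ?case using assms(3) by (auto intro: continuous_on_inverse)
next
  case (Suc n)
  have inv: "Ck_on n S (\<lambda>x. inverse (f x))"
    using Suc Ck_on_Suc_imp by blast
  show ?case
  proof (rule Ck_on_SucI[OF assms(1)])
    show "((\<lambda>x. inverse (f x)) has_derivative
        (\<lambda>v. - (inverse (f x) * frechet_derivative f (at x) v * inverse (f x)))) (at x)"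
      if "x \<in> S" for x
      using Deriv.has_derivative_inverse[OF assms(3)[OF that] Ck_on_SucD(1)[OF Suc.prems that]] .
    show "Ck_on n S (\<lambda>x. - (inverse (f x) * frechet_derivative f (at x) v * inverse (f x)))" for v
      by (intro Ck_on_linear_comp[OF assms(1) bounded_linear_minus[OF bounded_linear_ident]]
          Ck_on_bilinear[OF assms(1) bounded_bilinear_mult] inv Ck_on_SucD(2)[OF Suc.prems])
  qed
qed

text \<open>One differentiation replaces an induction: f'/f is already covered by products and
  inverses.\<close>

lemma Ck_on_ln:
  fixes f :: "'a::real_normed_vector \<Rightarrow> real"
  assumes "open S" "Ck_on n S f" "\<And>x. x \<in> S \<Longrightarrow> f x > 0"
  shows "Ck_on n S (\<lambda>x. ln (f x))"
  using assms(2)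
proof (cases n)
  case 0
  then show ?thesis using assms by (force intro: continuous_on_ln)
next
  case (Suc m)
  note fm = assms(2)[unfolded Suc]
  show ?thesis unfolding Suc
  proof (rule Ck_on_SucI[OF assms(1)])
    show "((\<lambda>x. ln (f x)) has_derivative (\<lambda>v. frechet_derivative f (at x) v * inverse (f x))) (at x)"
      if "x \<in> S" for x
      using has_derivative_ln[OF assms(3)[OF that] Ck_on_SucD(1)[OF fm that]] .
    have "f x \<noteq> 0" if "x \<in> S" for x using assms(3)[OF that] by simp
    then show "Ck_on m S (\<lambda>x. frechet_derivative f (at x) v * inverse (f x))" for v
      by (intro Ck_on_bilinear[OF assms(1) bounded_bilinear_mult] Ck_on_inverse
          Ck_on_SucD(2)[OF fm] Ck_on_Suc_imp[OF fm] assms(1))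
  qed
qed

lemma smooth_on_cong:
  "open S \<Longrightarrow> (\<And>x. x \<in> S \<Longrightarrow> f x = g x) \<Longrightarrow> smooth_on S f \<Longrightarrow> smooth_on S g"
  by (auto simp: smooth_on_def intro: Ck_on_cong)

lemma smooth_on_const: "open S \<Longrightarrow> smooth_on S (\<lambda>_. c)"
  by (simp add: smooth_on_def Ck_on_const)

lemma smooth_on_bounded_linear: "open S \<Longrightarrow> bounded_linear f \<Longrightarrow> smooth_on S f"
  by (simp add: smooth_on_def Ck_on_bounded_linear)

lemma smooth_on_linear_comp:
  "open S \<Longrightarrow> bounded_linear L \<Longrightarrow> smooth_on S f \<Longrightarrow> smooth_on S (\<lambda>x. L (f x))"
  by (simp add: smooth_on_def Ck_on_linear_comp)

lemma smooth_on_add: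
  "open S \<Longrightarrow> smooth_on S f \<Longrightarrow> smooth_on S g \<Longrightarrow> smooth_on S (\<lambda>x. f x + g x)"
  by (simp add: smooth_on_def Ck_on_add)

lemma smooth_on_diff:
  "open S \<Longrightarrow> smooth_on S f \<Longrightarrow> smooth_on S g \<Longrightarrow> smooth_on S (\<lambda>x. f x - g x)"
  using smooth_on_add[of S f "\<lambda>x. - g x"]
    smooth_on_linear_comp[OF _ bounded_linear_minus[OF bounded_linear_ident], of S g] by simp

lemma smooth_on_mult:
  fixes f g :: "'a::real_normed_vector \<Rightarrow> 'b::real_normed_algebra"
  shows "open S \<Longrightarrow> smooth_on S f \<Longrightarrow> smooth_on S g \<Longrightarrow> smooth_on S (\<lambda>x. f x * g x)"
  by (simp add: smooth_on_def Ck_on_bilinear[OF _ bounded_bilinear_mult])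

lemma smooth_on_divide:
  fixes f g :: "'a::real_normed_vector \<Rightarrow> 'b::real_normed_field"
  shows "open S \<Longrightarrow> smooth_on S f \<Longrightarrow> smooth_on S g \<Longrightarrow> (\<And>x. x \<in> S \<Longrightarrow> g x \<noteq> 0)
    \<Longrightarrow> smooth_on S (\<lambda>x. f x / g x)"
  unfolding divide_inverse
  by (intro smooth_on_mult) (simp_all add: smooth_on_def Ck_on_inverse)

lemma smooth_on_ln:
  fixes f :: "'a::real_normed_vector \<Rightarrow> real"
  shows "open S \<Longrightarrow> smooth_on S f \<Longrightarrow> (\<And>x. x \<in> S \<Longrightarrow> f x > 0) \<Longrightarrow> smooth_on S (\<lambda>x. ln (f x))"
  by (simp add: smooth_on_def Ck_on_ln)

lemma smooth_on_power:
  fixes f :: "'a::real_normed_vector \<Rightarrow> 'b::real_normed_algebra_1"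
  shows "open S \<Longrightarrow> smooth_on S f \<Longrightarrow> smooth_on S (\<lambda>x. f x ^ n)"
  by (induction n) (auto intro: smooth_on_const smooth_on_mult)

subsection \<open>The invariant two-form\<close>

lemma open_DJ: "open DJ"
proof -
  have "DJ = {p. cmod (snd p) < 1}" by (auto simp: DJ_def)
  moreover have "open {p::C2. cmod (snd p) < 1}"
    by (intro open_Collect_less continuous_intros)
  ultimately show ?thesis by simp
qed

text \<open>Complex-valued although real, so that the calculus of forms is polynomial algebra in z,
  w and their conjugates; \<open>jD_of_real\<close> recovers the real number.\<close>

definition jD :: "C2 \<Rightarrow> complex" where
  "jD p = 1 - snd p * cnj (snd p)"

definition alpha0 :: "C2 \<Rightarrow> complex" where
  "alpha0 p = (fst p + cnj (fst p) * snd p) / jD p"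

definition A_form :: "C2 \<Rightarrow> C2 \<Rightarrow> complex" where
  "A_form p u = fst u + cnj (alpha0 p) * snd u"

definition omega :: "real \<Rightarrow> C2 \<Rightarrow> C2 \<Rightarrow> C2 \<Rightarrow> complex" where
  "omega k p u v = \<i> * (2 * complex_of_real k / (jD p)\<^sup>2 * wedge snd (\<lambda>x. cnj (snd x)) u v
     + wedge (A_form p) (\<lambda>x. cnj (A_form p x)) u v / jD p)"

lemma jD_of_real: "jD p = of_real (1 - (cmod (snd p))\<^sup>2)"
  by (simp add: jD_def complex_norm_square[symmetric] flip: of_real_power)

lemma cnj_jD [simp]: "cnj (jD p) = jD p"
  by (simp add: jD_of_real)

lemma Re_jD_pos: "p \<in> DJ \<Longrightarrow> 1 - (cmod (snd p))\<^sup>2 > 0"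
  by (auto simp: DJ_def abs_square_less_1)

lemma jD_nonzero: "p \<in> DJ \<Longrightarrow> jD p \<noteq> 0"
  using Re_jD_pos[of p] by (simp add: jD_of_real del: of_real_diff of_real_power)

lemma bounded_linear_cnj_fst: "bounded_linear (\<lambda>u::C2. cnj (fst u))"
  by (rule bounded_linear_compose[OF bounded_linear_cnj bounded_linear_fst])

lemma bounded_linear_cnj_snd: "bounded_linear (\<lambda>u::C2. cnj (snd u))"
  by (rule bounded_linear_compose[OF bounded_linear_cnj bounded_linear_snd])

lemmas coord_derivs [derivative_intros] =
  bounded_linear_imp_has_derivative[OF bounded_linear_cnj_fst]
  bounded_linear_imp_has_derivative[OF bounded_linear_cnj_snd]
  bounded_linear_imp_has_derivative[OF bounded_linear_fst]
  bounded_linear_imp_has_derivative[OF bounded_linear_snd]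

lemma has_derivative_jD:
  "(jD has_derivative (\<lambda>u. - (snd u * cnj (snd p) + snd p * cnj (snd u)))) (at p)"
  unfolding jD_def[abs_def]
  by (rule has_derivative_eq_rhs, (rule derivative_intros)+) auto

text \<open>This is where A enters: the differential of \<alpha>0 is (A + w conj A) / (1 - |w|^2).
  Further derivatives of the potential and of the form therefore close up in terms of
  \<open>alpha0\<close>, \<open>A_form\<close> and \<open>jD\<close>.\<close>

lemma has_derivative_alpha0:
  assumes "p \<in> DJ"
  shows "(alpha0 has_derivative (\<lambda>u. (A_form p u + snd p * cnj (A_form p u)) / jD p)) (at p)"
proof -
  have D: "jD p \<noteq> 0" by (rule jD_nonzero[OF assms])
  show ?thesis
    unfolding alpha0_def[abs_def]
  proof (rule has_derivative_eq_rhs, rule has_derivative_divide'[OF _ has_derivative_jD D],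
      (rule derivative_intros)+, rule ext, goal_cases)
    case (1 u)
    \<comment> \<open>Conjugates become independent letters here; the identity lies in the ideal
      generated by the defining equations of \<open>jD\<close>, of \<open>alpha0\<close> and of its
      conjugate.\<close>
    have alg: "((u1 + (zc * u2 + u1c * w)) * D - (z + zc * w) * - (u2 * wc + w * u2c)) / (D * D) =
        (u1 + alc * u2 + w * (u1c + al * u2c)) / D"
      if "D \<noteq> 0" "D = 1 - w * wc" "al * D = z + zc * w" "alc * D = zc + z * wc"
      for u1 u1c u2 u2c w wc z zc al alc D :: complex
    proof -
      have "(u1 + (zc * u2 + u1c * w)) * D - (z + zc * w) * - (u2 * wc + w * u2c)
          = (u1 + alc * u2 + w * (u1c + al * u2c)) * D"
        using that(2-4) by algebra
      then show ?thesis using that(1) by (simp add: field_simps)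
    qed
    show ?case
      unfolding A_form_def complex_cnj_add complex_cnj_mult complex_cnj_cnj
    proof (rule alg[OF D])
      show "alpha0 p * jD p = fst p + cnj (fst p) * snd p" using D by (simp add: alpha0_def)
      show "cnj (alpha0 p) * jD p = cnj (fst p) + fst p * cnj (snd p)"
        using D by (simp add: alpha0_def)
    qed (simp add: jD_def)
  qed
qed

section \<open>First and second derivatives of the potential\<close>

lemma has_derivative_cnj_comp:
  "(f has_derivative f') F \<Longrightarrow> ((\<lambda>x. cnj (f x)) has_derivative (\<lambda>u. cnj (f' u))) F"
  by (rule bounded_linear.has_derivative[OF bounded_linear_cnj])

text \<open>log K(p, p) in real terms and without reference to a representation, so that all
  differentiation can be done before the kernel is known.\<close>

definition kpot :: "real \<Rightarrow> C2 \<Rightarrow> real" where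
  "kpot k p = ((cmod (fst p))\<^sup>2 + Re ((fst p)\<^sup>2 * cnj (snd p))) / (1 - (cmod (snd p))\<^sup>2)
     - 2 * k * ln (1 - (cmod (snd p))\<^sup>2)"

lemma kpot_eq:
  "complex_of_real (kpot k p) =
     (2 * fst p * cnj (fst p) + (fst p)\<^sup>2 * cnj (snd p) + (cnj (fst p))\<^sup>2 * snd p) / (2 * jD p)
     - 2 * of_real k * of_real (ln (1 - (cmod (snd p))\<^sup>2))"
proof -
  have "2 * complex_of_real (Re ((fst p)\<^sup>2 * cnj (snd p)))
      = (fst p)\<^sup>2 * cnj (snd p) + (cnj (fst p))\<^sup>2 * snd p"
    using complex_add_cnj[of "(fst p)\<^sup>2 * cnj (snd p)"] by simp
  then have N: "2 * complex_of_real ((cmod (fst p))\<^sup>2 + Re ((fst p)\<^sup>2 * cnj (snd p)))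
      = 2 * fst p * cnj (fst p) + (fst p)\<^sup>2 * cnj (snd p) + (cnj (fst p))\<^sup>2 * snd p"
    by (simp only: of_real_add complex_norm_square distrib_left mult.assoc add.assoc)
  have "complex_of_real (x / y - 2 * k * l) = 2 * of_real x / (2 * of_real y) - 2 * of_real k * of_real l"
    for x y l :: real by simp
  then show ?thesis unfolding kpot_def jD_of_real N[symmetric] .
qed

text \<open>The derivative of the potential along conj w. Along conj z the derivative is
  \<open>alpha0\<close> itself, which is the origin of \<alpha>0.\<close>

definition kpot_wbar :: "real \<Rightarrow> C2 \<Rightarrow> complex" where
  "kpot_wbar k p = (alpha0 p)\<^sup>2 / 2 + 2 * of_real k * snd p / jD p"

lemma has_derivative_kpot:
  assumes "p \<in> DJ"
  shows "((\<lambda>p. complex_of_real (kpot k p)) has_derivative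
    (\<lambda>u. alpha0 p * cnj (fst u) + cnj (alpha0 p) * fst u
       + kpot_wbar k p * cnj (snd u) + cnj (kpot_wbar k p) * snd u)) (at p)"
proof -
  have D: "jD p \<noteq> 0" by (rule jD_nonzero[OF assms])
  have D2: "2 * jD p \<noteq> 0" using D by simp
  have ReD: "1 - (cmod (snd q))\<^sup>2 = Re (jD q)" for q by (simp add: jD_of_real)
  have pos: "Re (jD p) > 0" using Re_jD_pos[OF assms] by (simp add: ReD)
  have Dre: "complex_of_real (Re (jD p)) = jD p" by (simp add: jD_of_real)
  have 1: "((\<lambda>p. complex_of_real (ln (1 - (cmod (snd p))\<^sup>2))) has_derivative
      (\<lambda>u. - (snd u * cnj (snd p) + snd p * cnj (snd u)) / jD p)) (at p)"
  proof -
    have "((\<lambda>p. complex_of_real (ln (Re (jD p)))) has_derivative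
      (\<lambda>u. of_real (Re (- (snd u * cnj (snd p) + snd p * cnj (snd u))) * inverse (Re (jD p))))) (at p)"
      by (intro bounded_linear.has_derivative[OF bounded_linear_of_real] has_derivative_ln pos
          bounded_linear.has_derivative[OF bounded_linear_Re] has_derivative_jD)
    moreover have "complex_of_real (Re (- (snd u * cnj (snd p) + snd p * cnj (snd u))) * inverse (Re (jD p)))
        = - (snd u * cnj (snd p) + snd p * cnj (snd u)) / jD p" for u
    proof -
      have "complex_of_real (Re (snd u * cnj (snd p) + snd p * cnj (snd u)))
        = snd u * cnj (snd p) + snd p * cnj (snd u)"
        by (simp add: complex_eq_iff)
      then show ?thesis
        unfolding of_real_mult of_real_inverse Dre
        by (simp only: uminus_complex.sel of_real_minus divide_inverse)
    qed
    ultimately show ?thesis unfolding ReD by (rule has_derivative_eq_rhs[OF _ ext])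
  qed
  have fstD: "fst p = alpha0 p - cnj (alpha0 p) * snd p"
  proof -
    have "(alpha0 p - cnj (alpha0 p) * snd p) * jD p = fst p * jD p"
      using D unfolding left_diff_distrib
      by (simp add: alpha0_def) (simp add: jD_def algebra_simps)
    then show ?thesis using D by simp
  qed
  show ?thesis
    unfolding kpot_eq[abs_def]
  proof (rule has_derivative_eq_rhs, (rule derivative_intros 1 has_derivative_jD D2)+,
      rule ext, goal_cases)
    case (1 u)
    have alg: "- N * (inverse (2 * D) * (2 * - (u2 * wc + w * u2c)) * inverse (2 * D)) + M / (2 * D)
          - 2 * c * (- (u2 * wc + w * u2c) / D)
        = al * u1c + alc * u1 + (al\<^sup>2 / 2 + 2 * c * w / D) * u2c
          + (alc\<^sup>2 / 2 + 2 * c * wc / D) * u2"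
      if D: "D \<noteq> 0" and al: "al * D = z + zc * w" "alc * D = zc + z * wc" "D = 1 - w * wc"
        and N: "N = 2 * z * zc + z\<^sup>2 * wc + zc\<^sup>2 * w"
        and M: "M = 2 * z * u1c + 2 * u1 * zc + (z\<^sup>2 * u2c + 2 * u1 * z * wc)
          + (zc\<^sup>2 * u2 + 2 * u1c * zc * w)"
      for u1 u1c u2 u2c w wc z zc al alc c D M N :: complex
    proof -
      define s where "s = u2 * wc + w * u2c"
      have N': "N = D * (z * alc + zc * al)" using al N by algebra
      have M': "M = 2 * D * (al * u1c + alc * u1) + z\<^sup>2 * u2c + zc\<^sup>2 * u2" using al M by algebra
      \<comment> \<open>The defining relations of \<open>alpha0\<close> can be solved for z, giving
        z = \<alpha>0 - w conj \<alpha>0. This is what turns the quadratic expressions in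
        \<open>K\<close> below into multiples of \<alpha>0^2 and its conjugate.\<close>
      have zal: "z = al - alc * w" "zc = alc - al * wc"
      proof -
        have "z * D = (al - alc * w) * D" "zc * D = (alc - al * wc) * D" using al by algebra+
        then show "z = al - alc * w" "zc = alc - al * wc" using D by simp_all
      qed
      have K: "w * (z * alc + zc * al) + z\<^sup>2 = al\<^sup>2 * D" "wc * (z * alc + zc * al) + zc\<^sup>2 = alc\<^sup>2 * D"
        using zal al by algebra+
      have "- N * (inverse (2 * D) * (2 * - s) * inverse (2 * D)) + M / (2 * D) - 2 * c * (- s / D)
        = (z * alc + zc * al) * s / (2 * D) + (z\<^sup>2 * u2c + zc\<^sup>2 * u2) / (2 * D)
          + (al * u1c + alc * u1) + 2 * c * s / D"
        using D unfolding N' M' by (simp add: field_simps)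
      also have "\<dots> = ((w * (z * alc + zc * al) + z\<^sup>2) * u2c + (wc * (z * alc + zc * al) + zc\<^sup>2) * u2)
          / (2 * D) + (al * u1c + alc * u1) + 2 * c * s / D"
        unfolding s_def by (simp add: add_divide_distrib algebra_simps)
      also have "\<dots> = al * u1c + alc * u1 + (al\<^sup>2 / 2 + 2 * c * w / D) * u2c
          + (alc\<^sup>2 / 2 + 2 * c * wc / D) * u2"
        unfolding K s_def using D by (simp add: field_simps)
      finally show ?thesis unfolding s_def .
    qed
    have "cnj (kpot_wbar k p) = (cnj (alpha0 p))\<^sup>2 / 2 + 2 * of_real k * cnj (snd p) / jD p"
      by (simp add: kpot_wbar_def)
    then show ?case
      unfolding kpot_wbar_def
      apply (simp only:)
      apply (rule alg[OF D])
      using D apply (simp_all add: alpha0_def)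
      apply (simp add: jD_def)
      done
  qed
qed

lemma wirt_eqs:
  assumes "(F has_derivative F') (at p)"
  shows "wirt e F p = (F' e - \<i> * F' (scale2 \<i> e)) / 2"
    and "wirt_bar e F p = (F' e + \<i> * F' (scale2 \<i> e)) / 2"
  using frechet_derivative_at[OF assms] by (simp_all add: wirt_def wirt_bar_def)

lemma wirt_transform:
  assumes "open S" "p \<in> S" "\<And>q. q \<in> S \<Longrightarrow> F q = G q" "(G has_derivative G') (at p)"
  shows "wirt e F p = (G' e - \<i> * G' (scale2 \<i> e)) / 2"
  by (rule wirt_eqs(1)[OF has_derivative_transform_within_open[OF assms(4,1,2)]])
    (simp add: assms(3))

lemma has_derivative_kpot_wbar:
  assumes "p \<in> DJ"
  shows "(kpot_wbar k has_derivative
    (\<lambda>u. alpha0 p * ((A_form p u + snd p * cnj (A_form p u)) / jD p)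
       + 2 * of_real k * (snd u + (snd p)\<^sup>2 * cnj (snd u)) / (jD p * jD p))) (at p)"
proof -
  have D: "jD p \<noteq> 0" by (rule jD_nonzero[OF assms])
  have num: "snd u * jD p + snd p * (snd u * cnj (snd p) + snd p * cnj (snd u))
      = snd u + (snd p)\<^sup>2 * cnj (snd u)" for u
    by (simp add: jD_def algebra_simps power2_eq_square)
  have "(kpot_wbar k has_derivative
    (\<lambda>u. alpha0 p * ((A_form p u + snd p * cnj (A_form p u)) / jD p)
       + 2 * of_real k * (snd u * jD p + snd p * (snd u * cnj (snd p) + snd p * cnj (snd u)))
           / (jD p * jD p))) (at p)"
    unfolding kpot_wbar_def[abs_def]
    by (rule has_derivative_eq_rhs, (rule derivative_intros has_derivative_alpha0[OF assms]
          has_derivative_jD D has_derivative_divide' | simp)+) (use D in \<open>auto simp: field_simps\<close>)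
  then show ?thesis unfolding num .
qed

text \<open>With D = 1 - |w|^2 the mixed second derivatives are 1/D, conj \<alpha>0 / D, \<alpha>0 /
  D and |\<alpha>0|^2 / D + 2k / D^2: a rank one part, which is A times its conjugate, plus a term
  in dw alone. \<open>F\<close> is prescribed on the open set \<open>DJ\<close>, where all
  derivatives are taken.\<close>

lemma del_delbar_kpot:
  assumes "p \<in> DJ" and F: "\<And>q. q \<in> DJ \<Longrightarrow> F q = complex_of_real (kpot k q)"
  shows "\<i> * del_delbar F p u v = omega k p u v"
proof -
  have D: "jD p \<noteq> 0" by (rule jD_nonzero[OF assms(1)])
  have derF: "(F has_derivative (\<lambda>u. alpha0 q * cnj (fst u) + cnj (alpha0 q) * fst u
       + kpot_wbar k q * cnj (snd u) + cnj (kpot_wbar k q) * snd u)) (at q)" if "q \<in> DJ" for q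
    by (rule has_derivative_transform_within_open[OF has_derivative_kpot[OF that] open_DJ that])
      (simp add: F)
  have wb: "wirt_bar (1, 0) F q = alpha0 q" "wirt_bar (0, 1) F q = kpot_wbar k q" if "q \<in> DJ" for q
    by (simp_all add: wirt_eqs(2)[OF derF[OF that]] scale2_def algebra_simps)
  have c: "wirt e (wirt_bar (1, 0) F) p = (A_form p e - \<i> * A_form p (scale2 \<i> e)
      + snd p * cnj (A_form p e) - \<i> * snd p * cnj (A_form p (scale2 \<i> e))) / (2 * jD p)" for e
    by (subst wirt_transform[OF open_DJ assms(1) wb(1) has_derivative_alpha0[OF assms(1)]])
      (use D in \<open>auto simp: field_simps\<close>)
  have w1: "wirt (1, 0) (wirt_bar (1, 0) F) p = 1 / jD p"
    "wirt (0, 1) (wirt_bar (1, 0) F) p = cnj (alpha0 p) / jD p"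
    using D by (simp_all add: c A_form_def scale2_def field_simps)
  have w2: "wirt (1, 0) (wirt_bar (0, 1) F) p = alpha0 p / jD p"
    using D by (subst wirt_transform[OF open_DJ assms(1) wb(2) has_derivative_kpot_wbar[OF assms(1)]])
      (auto simp: A_form_def scale2_def field_simps)
  have w3: "wirt (0, 1) (wirt_bar (0, 1) F) p
      = alpha0 p * cnj (alpha0 p) / jD p + 2 * of_real k / (jD p)\<^sup>2"
    using D by (subst wirt_transform[OF open_DJ assms(1) wb(2) has_derivative_kpot_wbar[OF assms(1)]])
      (auto simp: A_form_def scale2_def field_simps power2_eq_square)
  show ?thesis
    unfolding del_delbar_def w1 w2 w3 omega_def wedge_def A_form_def
    by (simp add: algebra_simps add_divide_distrib diff_divide_distrib)
qed

section \<open>The form is Kaehler: smooth, closed, real and positive\<close>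

lemma smooth_on_omega: "smooth_on DJ (\<lambda>p. omega k p u v)"
proof -
  note [intro] = open_DJ
  have w: "smooth_on DJ (\<lambda>p. snd p)" "smooth_on DJ (\<lambda>p. cnj (snd p))"
    "smooth_on DJ (\<lambda>p. fst p)" "smooth_on DJ (\<lambda>p. cnj (fst p))"
    by (auto intro!: smooth_on_bounded_linear bounded_linear_fst bounded_linear_snd
        bounded_linear_cnj_fst bounded_linear_cnj_snd)
  have D: "smooth_on DJ jD"
    unfolding jD_def[abs_def]
    by (intro smooth_on_diff smooth_on_mult smooth_on_const w open_DJ)
  have al: "smooth_on DJ alpha0" 
    unfolding alpha0_def[abs_def]
    by (intro smooth_on_divide smooth_on_add smooth_on_mult w D open_DJ jD_nonzero)
  note cal = smooth_on_linear_comp[OF open_DJ bounded_linear_cnj al]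
  show ?thesis
    unfolding omega_def wedge_def A_form_def complex_cnj_add complex_cnj_mult complex_cnj_cnj
    by (intro smooth_on_divide smooth_on_add smooth_on_diff smooth_on_mult smooth_on_power
        smooth_on_const w D al cal open_DJ jD_nonzero) (simp add: jD_nonzero)
qed

lemma has_derivative_inverse_jD:
  assumes "p \<in> DJ"
  shows "((\<lambda>q. inverse (jD q)) has_derivative
    (\<lambda>u. (snd u * cnj (snd p) + snd p * cnj (snd u)) * (inverse (jD p))\<^sup>2)) (at p)"
proof -
  have "((\<lambda>q. inverse (jD q)) has_derivative (\<lambda>u. - (inverse (jD p)
      * - (snd u * cnj (snd p) + snd p * cnj (snd u)) * inverse (jD p)))) (at p)"
    by (rule Deriv.has_derivative_inverse[OF jD_nonzero[OF assms] has_derivative_jD])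
  moreover have "- (r * - s * r) = s * r\<^sup>2" for r s :: complex
    by (simp add: power2_eq_square)
  ultimately show ?thesis by (simp only:)
qed

lemma has_derivative_A_form:
  assumes "p \<in> DJ"
  shows "((\<lambda>q. A_form q v) has_derivative
      (\<lambda>u. (cnj (A_form p u) + cnj (snd p) * A_form p u) * inverse (jD p) * snd v)) (at p)"
    and "((\<lambda>q. cnj (A_form q v)) has_derivative
      (\<lambda>u. (A_form p u + snd p * cnj (A_form p u)) * inverse (jD p) * cnj (snd v))) (at p)"
proof -
  have "((\<lambda>q. A_form q v) has_derivative
      (\<lambda>u. cnj ((A_form p u + snd p * cnj (A_form p u)) / jD p) * snd v)) (at p)"
    unfolding A_form_def[of _ v]
    by (rule has_derivative_eq_rhs, (rule derivative_intros has_derivative_cnj_comp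
          has_derivative_alpha0[OF assms])+) simp
  moreover have eq: "cnj ((A_form p u + snd p * cnj (A_form p u)) / jD p) * snd v
    = (cnj (A_form p u) + cnj (snd p) * A_form p u) * inverse (jD p) * snd v" for u
    by (simp add: divide_inverse)
  ultimately show 1: "((\<lambda>q. A_form q v) has_derivative
      (\<lambda>u. (cnj (A_form p u) + cnj (snd p) * A_form p u) * inverse (jD p) * snd v)) (at p)"
    by simp
  show "((\<lambda>q. cnj (A_form q v)) has_derivative
      (\<lambda>u. (A_form p u + snd p * cnj (A_form p u)) * inverse (jD p) * cnj (snd v))) (at p)"
    by (rule has_derivative_eq_rhs[OF has_derivative_cnj_comp[OF 1]]) simp
qed

text \<open>With the derivatives of A and of 1 / (1 - |w|^2) expressed through A, dw and their
  conjugates, the alternating sum cancels as a polynomial identity.\<close>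

lemma ext_deriv2_omega:
  assumes "p \<in> DJ"
  shows "ext_deriv2 (omega k) p u v x = 0"
proof -
  \<comment> \<open>The reciprocal stays an opaque letter, so that the final cancellation takes
    place in a commutative ring.\<close>
  define r where "r = (\<lambda>q. inverse (jD q))"
  have om: "omega k q v x = \<i> * (2 * of_real k * (snd v * cnj (snd x) - snd x * cnj (snd v)) * (r q)\<^sup>2
      + (A_form q v * cnj (A_form q x) - A_form q x * cnj (A_form q v)) * r q)" for q v x
    by (simp add: omega_def wedge_def r_def divide_inverse power_inverse algebra_simps)
  have der: "((\<lambda>q. omega k q v x) has_derivative (\<lambda>u. \<i> * (
      2 * of_real k * (snd v * cnj (snd x) - snd x * cnj (snd v))
        * (2 * (r p) ^ 3 * (snd u * cnj (snd p) + snd p * cnj (snd u)))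
      + ((cnj (A_form p u) + cnj (snd p) * A_form p u) * snd v * cnj (A_form p x)
        + A_form p v * (A_form p u + snd p * cnj (A_form p u)) * cnj (snd x)
        - (cnj (A_form p u) + cnj (snd p) * A_form p u) * snd x * cnj (A_form p v)
        - A_form p x * (A_form p u + snd p * cnj (A_form p u)) * cnj (snd v)) * (r p)\<^sup>2
      + (A_form p v * cnj (A_form p x) - A_form p x * cnj (A_form p v))
        * (snd u * cnj (snd p) + snd p * cnj (snd u)) * (r p)\<^sup>2))) (at p)" for v x
    unfolding om unfolding r_def
    by (rule has_derivative_eq_rhs, (rule derivative_intros has_derivative_A_form[OF assms]
          has_derivative_inverse_jD[OF assms])+, rule ext)
      (simp add: algebra_simps power2_eq_square power3_eq_cube)
  note fd = frechet_derivative_at[OF der, symmetric]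
  show ?thesis
    unfolding ext_deriv2_def fd by (simp add: algebra_simps)
qed

text \<open>Carries the result from \<open>omega\<close> to the form built from
  \<open>kahler_potential\<close>. Smoothness and the exterior derivative are the clauses that look
  beyond a single point; for these \<open>S\<close> has to be open.\<close>

lemma kahler_form_on_cong:
  assumes "open S" and eq: "\<And>p u v. p \<in> S \<Longrightarrow> \<omega>' p u v = \<omega> p u v" and "kahler_form_on S \<omega>"
  shows "kahler_form_on S \<omega>'"
proof -
  have sm: "smooth_on S (\<lambda>p. \<omega> p u v)" for u v using assms(3) unfolding kahler_form_on_def by blast
  have fd: "frechet_derivative (\<lambda>q. \<omega>' q u v) (at p) = frechet_derivative (\<lambda>q. \<omega> q u v) (at p)"
    if "p \<in> S" for p u v
  proof -
    have "Ck_on (Suc 0) S (\<lambda>p. \<omega> p u v)" using sm[of u v] unfolding smooth_on_def by blast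
    then have "(\<lambda>q. \<omega> q u v) differentiable at p" using that by simp
    from has_derivative_transform_within_open[OF this[unfolded frechet_derivative_works] assms(1) that,
        of "\<lambda>q. \<omega>' q u v"] eq
    show ?thesis using frechet_derivative_at by metis
  qed
  have "smooth_on S (\<lambda>p. \<omega>' p u v)" for u v
    by (rule smooth_on_cong[OF assms(1) _ sm]) (simp add: eq)
  moreover have ext: "ext_deriv2 \<omega>' p = ext_deriv2 \<omega> p" if "p \<in> S" for p
    by (intro ext) (simp add: ext_deriv2_def fd[OF that])
  moreover have om: "\<omega>' p = \<omega> p" if "p \<in> S" for p using eq[OF that] by blast
  \<comment> \<open>All clauses at a fixed point are transported at once, as one predicate of the
    form and its exterior derivative there.\<close>
  have "(\<forall>p\<in>S. P (\<omega>' p) (ext_deriv2 \<omega>' p)) \<longleftrightarrow> (\<forall>p\<in>S. P (\<omega> p) (ext_deriv2 \<omega> p))" for P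
    using ext om by auto
  note pw = this[of "\<lambda>w e. (\<forall>u. linear (w u)) \<and> (\<forall>u v. w u v = - w v u) \<and> (\<forall>u v. w u v \<in> \<real>) \<and>
      (\<forall>u v. w (scale2 \<i> u) (scale2 \<i> v) = w u v) \<and> (\<forall>u. u \<noteq> 0 \<longrightarrow> Re (w u (scale2 \<i> u)) > 0) \<and>
      (\<forall>u v x. e u v x = 0)"]
  ultimately show ?thesis
    using assms(3) pw unfolding kahler_form_on_def by blast
qed

lemma kahler_form_omega:
  assumes "k > 0"
  shows "kahler_form_on DJ (omega k)"
  unfolding kahler_form_on_def
proof (intro conjI ballI allI impI)
  fix p u v x assume p: "p \<in> DJ"
  define d where "d = 1 - (cmod (snd p))\<^sup>2"
  have d: "d > 0" "jD p = of_real d" using Re_jD_pos[OF p] by (simp_all add: d_def jD_of_real)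
  show "linear (omega k p u)"
    by (rule linearI) (simp_all add: omega_def wedge_def A_form_def algebra_simps add_divide_distrib
        diff_divide_distrib scaleR_conv_of_real)
  show "omega k p u v = - omega k p v u"
    by (simp add: omega_def wedge_def algebra_simps add_divide_distrib diff_divide_distrib)
  have "cnj (omega k p u v) = omega k p u v"
    by (simp add: omega_def wedge_def algebra_simps add_divide_distrib diff_divide_distrib)
  then show "omega k p u v \<in> \<real>" by (simp add: complex_is_Real_iff complex_eq_iff)
  have A: "A_form p (scale2 \<i> u) = \<i> * A_form p u" for u
    by (simp add: A_form_def scale2_def algebra_simps)
  have snd2: "snd (scale2 \<i> u) = \<i> * snd u" for u by (simp add: scale2_def)
  show "omega k p (scale2 \<i> u) (scale2 \<i> v) = omega k p u v"
    by (simp add: omega_def wedge_def A snd2 algebra_simps add_divide_distrib diff_divide_distrib)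
  show "Re (omega k p u (scale2 \<i> u)) > 0" if "u \<noteq> 0"
  proof -
    have "omega k p u (scale2 \<i> u) = 4 * of_real k / (jD p)\<^sup>2 * (snd u * cnj (snd u))
        + 2 * (A_form p u * cnj (A_form p u)) / jD p"
      by (simp add: omega_def wedge_def A snd2 algebra_simps add_divide_distrib diff_divide_distrib)
    also have "\<dots> = of_real (4 * k / d\<^sup>2 * (cmod (snd u))\<^sup>2 + 2 * (cmod (A_form p u))\<^sup>2 / d)"
      by (simp add: d(2) flip: complex_norm_square)
    finally have "Re (omega k p u (scale2 \<i> u))
        = 4 * k / d\<^sup>2 * (cmod (snd u))\<^sup>2 + 2 * (cmod (A_form p u))\<^sup>2 / d" by simp
    \<comment> \<open>If dw(u) = 0 then A(u) = dz(u), so the two squares vanish together only for u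
      = 0.\<close>
    moreover have "snd u \<noteq> 0 \<or> A_form p u \<noteq> 0"
      using that by (auto simp: A_form_def prod_eq_iff)
    then have "4 * k / d\<^sup>2 * (cmod (snd u))\<^sup>2 + 2 * (cmod (A_form p u))\<^sup>2 / d > 0"
      using d(1) assms by (auto intro: add_pos_nonneg add_nonneg_pos)
    ultimately show ?thesis by simp
  qed
  show "ext_deriv2 (omega k) p u v x = 0" by (rule ext_deriv2_omega[OF p])
qed (rule smooth_on_omega)

lemma smooth_on_kpot: "smooth_on DJ (kpot k)"
proof -
  have 1: "(cmod x)\<^sup>2 = Re x * Re x + Im x * Im x" for x :: complex
    by (simp add: cmod_power2 flip: power2_eq_square)
  have bl: "bounded_linear (\<lambda>p::C2. Re (fst p))" "bounded_linear (\<lambda>p::C2. Im (fst p))"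
    "bounded_linear (\<lambda>p::C2. Re (snd p))" "bounded_linear (\<lambda>p::C2. Im (snd p))"
    by (auto intro: bounded_linear_compose[OF bounded_linear_Re] bounded_linear_compose[OF bounded_linear_Im]
        bounded_linear_fst bounded_linear_snd)
  note sm = bl[THEN smooth_on_bounded_linear[OF open_DJ]]
  have D: "smooth_on DJ (\<lambda>p. 1 - (cmod (snd p))\<^sup>2)"
    unfolding 1 by (intro smooth_on_diff smooth_on_add smooth_on_mult smooth_on_const sm open_DJ)
  have N: "smooth_on DJ (\<lambda>p. (cmod (fst p))\<^sup>2 + Re ((fst p)\<^sup>2 * cnj (snd p)))"
    unfolding 1 unfolding power2_eq_square times_complex.sel cnj.sel
    by (rule smooth_on_add smooth_on_diff smooth_on_mult sm open_DJ
        smooth_on_linear_comp[OF open_DJ bounded_linear_minus[OF bounded_linear_ident]])+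
  show ?thesis
    unfolding kpot_def[abs_def]
  proof (rule smooth_on_diff[OF open_DJ smooth_on_divide[OF open_DJ N D]
      smooth_on_mult[OF open_DJ smooth_on_const[OF open_DJ] smooth_on_ln[OF open_DJ D]]])
    fix p assume "p \<in> DJ"
    then show "1 - (cmod (snd p))\<^sup>2 > 0" by (rule Re_jD_pos)
    then show "1 - (cmod (snd p))\<^sup>2 \<noteq> 0" by (rule less_imp_neq[THEN not_sym])
  qed
qed

subsection \<open>The action of the Jacobi group\<close>

lemma su_mat_entries [simp]:
  "su_mat a b $ 1 $ 1 = a" "su_mat a b $ 1 $ 2 = b"
  "su_mat a b $ 2 $ 1 = cnj b" "su_mat a b $ 2 $ 2 = cnj a"
  by (simp_all add: su_mat_def)

lemma su_mat_mult:
  "su_mat a b ** su_mat c d = su_mat (a * c + b * cnj d) (a * d + b * cnj c)"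
  by (simp add: vec_eq_iff forall_2 matrix_matrix_mult_def sum_2 add.commute)

lemma su_mat_one: "su_mat 1 0 = mat 1"
  by (simp add: vec_eq_iff forall_2 mat_def)

lemma SU11_norm:
  assumes "(cmod a)\<^sup>2 - (cmod b)\<^sup>2 = 1"
  shows "a * cnj a - b * cnj b = 1"
  using arg_cong[OF assms, of complex_of_real]
  by (simp only: of_real_diff complex_norm_square of_real_1)

lemma SU11_normI:
  assumes "a * cnj a - b * cnj b = 1"
  shows "(cmod a)\<^sup>2 - (cmod b)\<^sup>2 = 1"
proof -
  have "complex_of_real ((cmod a)\<^sup>2 - (cmod b)\<^sup>2) = complex_of_real 1"
    using assms by (simp only: of_real_diff complex_norm_square of_real_1)
  then show ?thesis using of_real_eq_iff by blast
qed

lemma jacobi_groupI: "(cmod a)\<^sup>2 - (cmod b)\<^sup>2 = 1 \<Longrightarrow> (su_mat a b, \<alpha>, t) \<in> jacobi_group"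
  by (auto simp: jacobi_group_def SU11_def)

lemma jacobi_groupE:
  assumes "g \<in> jacobi_group"
  obtains a b \<alpha> t where "g = (su_mat a b, \<alpha>, t)" "(cmod a)\<^sup>2 - (cmod b)\<^sup>2 = 1"
  using assms by (auto simp: jacobi_group_def SU11_def)

lemma jacobi_mult_su_mat:
  "jacobi_mult (su_mat a b, \<alpha>, s) (su_mat c d, \<beta>, t) =
    (su_mat (a * c + b * cnj d) (a * d + b * cnj c), cnj c * \<alpha> - d * cnj \<alpha> + \<beta>,
     s + t + Im ((cnj c * \<alpha> - d * cnj \<alpha>) * cnj \<beta>))"
  by (simp add: su_inv_act_def su_mat_mult)

lemma jacobi_mult_closed:
  assumes "g \<in> jacobi_group" "h \<in> jacobi_group"
  shows "jacobi_mult g h \<in> jacobi_group"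
proof -
  obtain a b \<alpha> s where g: "g = (su_mat a b, \<alpha>, s)" "(cmod a)\<^sup>2 - (cmod b)\<^sup>2 = 1"
    by (rule jacobi_groupE[OF assms(1)])
  obtain c d \<beta> t where h: "h = (su_mat c d, \<beta>, t)" "(cmod c)\<^sup>2 - (cmod d)\<^sup>2 = 1"
    by (rule jacobi_groupE[OF assms(2)])
  have "(a * c + b * cnj d) * cnj (a * c + b * cnj d) - (a * d + b * cnj c) * cnj (a * d + b * cnj c)
    = (a * cnj a - b * cnj b) * (c * cnj c - d * cnj d)"
    by (simp add: algebra_simps)
  also have "\<dots> = 1" using SU11_norm[OF g(2)] SU11_norm[OF h(2)] by simp
  finally show ?thesis
    unfolding g h jacobi_mult_su_mat by (intro jacobi_groupI SU11_normI)
qed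

lemma jacobi_act_su_mat:
  "jacobi_act (su_mat a b, \<alpha>, t) p =
    ((\<alpha> - cnj \<alpha> * snd p + fst p) / (cnj b * snd p + cnj a),
     (a * snd p + b) / (cnj b * snd p + cnj a))"
  by (cases p) simp

text \<open>The expression is the denominator j of the action; |a| > |b| keeps it away from 0 on the
  disc.\<close>

lemma automorphy_nonzero:
  assumes "(cmod a)\<^sup>2 - (cmod b)\<^sup>2 = 1" "cmod w < 1"
  shows "cnj b * w + cnj a \<noteq> 0"
proof
  assume "cnj b * w + cnj a = 0"
  then have "cmod a = cmod (cnj b * w)"
    by (metis add.commute complex_mod_cnj eq_neg_iff_add_eq_0 norm_minus_cancel)
  also have "\<dots> \<le> cmod b" using assms(2) by (simp add: norm_mult mult_left_le)
  finally have "(cmod a)\<^sup>2 \<le> (cmod b)\<^sup>2" by (simp add: power_mono)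
  with assms(1) show False by simp
qed

text \<open>Preservation of the disc, invariance of the two-form and invariance of the measure all
  come down to this law: 1 - |w|^2 is divided by |j|^2.\<close>

lemma jD_act:
  assumes "(cmod a)\<^sup>2 - (cmod b)\<^sup>2 = 1" "p \<in> DJ"
  shows "jD (jacobi_act (su_mat a b, \<alpha>, t) p)
    = jD p / ((cnj b * snd p + cnj a) * cnj (cnj b * snd p + cnj a))"
proof -
  define j where "j = cnj b * snd p + cnj a"
  have j: "j \<noteq> 0"
    unfolding j_def using assms by (intro automorphy_nonzero) (auto simp: DJ_def)
  have "j * cnj j - (a * snd p + b) * cnj (a * snd p + b)
    = (a * cnj a - b * cnj b) * jD p"
    by (simp add: j_def jD_def algebra_simps)
  then have "j * cnj j - (a * snd p + b) * cnj (a * snd p + b) = jD p"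
    using SU11_norm[OF assms(1)] by simp
  moreover have "jD (y, x / j) = (j * cnj j - x * cnj x) / (j * cnj j)" for x y
    using j by (simp add: jD_def diff_divide_distrib)
  ultimately show ?thesis
    unfolding jacobi_act_su_mat j_def[symmetric] by simp
qed

lemma jacobi_act_DJ:
  assumes "g \<in> jacobi_group" "p \<in> DJ"
  shows "jacobi_act g p \<in> DJ"
proof -
  obtain a b \<alpha> t where g: "g = (su_mat a b, \<alpha>, t)" "(cmod a)\<^sup>2 - (cmod b)\<^sup>2 = 1"
    by (rule jacobi_groupE[OF assms(1)])
  define j where "j = cnj b * snd p + cnj a"
  have j: "j \<noteq> 0"
    unfolding j_def using assms g by (intro automorphy_nonzero) (auto simp: DJ_def)
  have "complex_of_real (1 - (cmod (snd (jacobi_act g p)))\<^sup>2)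
    = of_real ((1 - (cmod (snd p))\<^sup>2) / (cmod j)\<^sup>2)"
    using jD_act[OF g(2) assms(2), of \<alpha> t]
    unfolding g j_def[symmetric] complex_norm_square[symmetric] jD_of_real by simp
  then have "1 - (cmod (snd (jacobi_act g p)))\<^sup>2 = (1 - (cmod (snd p))\<^sup>2) / (cmod j)\<^sup>2"
    using of_real_eq_iff by blast
  also have "\<dots> > 0" using Re_jD_pos[OF assms(2)] j by simp
  finally have "(cmod (snd (jacobi_act g p)))\<^sup>2 < 1" by simp
  then show ?thesis by (auto simp: DJ_def abs_square_less_1 split: prod.splits)
qed

text \<open>The denominators form a cocycle, j(gh, p) = j(g, hp) j(h, p), which is \<open>J\<close>
  below. The translation parts match because the composition law applies the inverse of h to
  \<alpha>.\<close>

lemma jacobi_act_mult: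
  assumes "g \<in> jacobi_group" "h \<in> jacobi_group" "p \<in> DJ"
  shows "jacobi_act (jacobi_mult g h) p = jacobi_act g (jacobi_act h p)"
proof -
  obtain a b \<alpha> s where g: "g = (su_mat a b, \<alpha>, s)" "(cmod a)\<^sup>2 - (cmod b)\<^sup>2 = 1"
    by (rule jacobi_groupE[OF assms(1)])
  obtain c d \<beta> t where h: "h = (su_mat c d, \<beta>, t)" "(cmod c)\<^sup>2 - (cmod d)\<^sup>2 = 1"
    by (rule jacobi_groupE[OF assms(2)])
  define w where "w = snd p"
  define j where "j = cnj d * w + cnj c"
  have j: "j \<noteq> 0"
    unfolding j_def w_def using assms h by (intro automorphy_nonzero) (auto simp: DJ_def)
  define w' where "w' = (c * w + d) / j"
  have "jacobi_act h p \<in> DJ" by (rule jacobi_act_DJ[OF assms(2,3)])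
  then have "cmod w' < 1"
    by (simp add: h jacobi_act_su_mat DJ_def w'_def j_def w_def)
  then have J': "cnj b * w' + cnj a \<noteq> 0" by (intro automorphy_nonzero g)
  have w'j: "w' * j = c * w + d" using j by (simp add: w'_def)
  define J where "J = (cnj b * w' + cnj a) * j"
  have J: "J \<noteq> 0" using J' j by (simp add: J_def)
  have JJ: "cnj (a * d + b * cnj c) * w + cnj (a * c + b * cnj d) = J"
    unfolding J_def distrib_right using w'j by (simp add: j_def) algebra
  have 2: "((a * c + b * cnj d) * w + (a * d + b * cnj c)) / J = (a * w' + b) / (cnj b * w' + cnj a)"
  proof -
    have "(a * c + b * cnj d) * w + (a * d + b * cnj c) = (a * w' + b) * j"
      using w'j by (simp add: j_def) algebra
    then show ?thesis using j J' by (simp add: J_def)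
  qed
  have 1: "(\<gamma> - cnj \<gamma> * w + z) / J
      = (\<alpha> - cnj \<alpha> * w' + (\<beta> - cnj \<beta> * w + z) / j) / (cnj b * w' + cnj a)"
    if "\<gamma> = cnj c * \<alpha> - d * cnj \<alpha> + \<beta>" for \<gamma> z
  proof -
    have "c * cnj c - d * cnj d = 1" by (rule SU11_norm[OF h(2)])
    have "\<gamma> - cnj \<gamma> * w + z = \<alpha> * j - cnj \<alpha> * (w' * j) + (\<beta> - cnj \<beta> * w + z)"
      unfolding that w'j by (simp add: j_def algebra_simps)
    also have "\<dots> = (\<alpha> - cnj \<alpha> * w' + (\<beta> - cnj \<beta> * w + z) / j) * j"
      using j by (simp add: field_simps)
    finally show ?thesis using j J' by (simp add: J_def)
  qed
  show ?thesis
    unfolding g h jacobi_mult_su_mat jacobi_act_su_mat w_def[symmetric] fst_conv snd_conv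
      j_def[symmetric] w'_def[symmetric] JJ
    using 1[OF refl] 2 by simp
qed

lemma jacobi_act_transitive:
  assumes "p \<in> DJ"
  shows "\<exists>g\<in>jacobi_group. jacobi_act g (0, 0) = p"
proof -
  \<comment> \<open>The origin is sent to (\<alpha> / conj a, b / conj a). With a = r, b = w r and
    \<alpha> = z r this is (z, w), and \<open>r\<close> is fixed by |a|^2 - |b|^2 = 1.\<close>
  define r where "r = 1 / sqrt (1 - (cmod (snd p))\<^sup>2)"
  have pos: "1 - (cmod (snd p))\<^sup>2 > 0" by (rule Re_jD_pos[OF assms])
  have r: "r > 0" using pos by (simp add: r_def)
  have "(cmod (complex_of_real r))\<^sup>2 - (cmod (snd p * r))\<^sup>2 = r\<^sup>2 * (1 - (cmod (snd p))\<^sup>2)"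
    by (simp add: norm_mult power_mult_distrib algebra_simps)
  also have "\<dots> = 1" using pos by (simp add: r_def power_divide)
  finally have "(su_mat (of_real r) (snd p * r), fst p * r, 0) \<in> jacobi_group"
    by (rule jacobi_groupI)
  moreover have "jacobi_act (su_mat (of_real r) (snd p * r), fst p * r, 0) (0, 0) = p"
    using r by (simp add: prod_eq_iff)
  ultimately show ?thesis by blast
qed

lemma has_derivative_jacobi_act:
  assumes "(cmod a)\<^sup>2 - (cmod b)\<^sup>2 = 1" "p \<in> DJ"
  defines "j \<equiv> cnj b * snd p + cnj a"
  shows "(jacobi_act (su_mat a b, \<alpha>, t) has_derivative (\<lambda>u.
    (((fst u - cnj \<alpha> * snd u) * j - (\<alpha> - cnj \<alpha> * snd p + fst p) * (cnj b * snd u)) / j\<^sup>2,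
     snd u / j\<^sup>2))) (at p)"
proof -
  have j: "j \<noteq> 0"
    unfolding j_def using assms by (intro automorphy_nonzero) (auto simp: DJ_def)
  have num: "a * j - (a * snd p + b) * cnj b = 1"
    using SU11_norm[OF assms(1)] by (simp add: j_def algebra_simps)
  have 1: "((\<lambda>p. (\<alpha> - cnj \<alpha> * snd p + fst p) / (cnj b * snd p + cnj a)) has_derivative
      (\<lambda>u. ((fst u - cnj \<alpha> * snd u) * j - (\<alpha> - cnj \<alpha> * snd p + fst p) * (cnj b * snd u)) / j\<^sup>2)) (at p)"
    by (rule has_derivative_eq_rhs, rule has_derivative_divide', (rule derivative_intros j[unfolded j_def])+)
      (simp add: j_def power2_eq_square algebra_simps)
  have "((\<lambda>p. (a * snd p + b) / (cnj b * snd p + cnj a)) has_derivative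
      (\<lambda>u. (a * j - (a * snd p + b) * cnj b) * snd u / j\<^sup>2)) (at p)"
    by (rule has_derivative_eq_rhs, rule has_derivative_divide', (rule derivative_intros j[unfolded j_def])+)
      (simp add: j_def power2_eq_square algebra_simps)
  then have 2: "((\<lambda>p. (a * snd p + b) / (cnj b * snd p + cnj a)) has_derivative
      (\<lambda>u. snd u / j\<^sup>2)) (at p)" unfolding num by simp
  show ?thesis
    unfolding jacobi_act_su_mat[abs_def] by (rule has_derivative_Pair[OF 1 2])
qed

text \<open>The one-form \<open>A\<close> is multiplied by the inverse of the automorphy factor.\<close>

lemma omega_invariant:
  assumes "g \<in> jacobi_group" "p \<in> DJ"
  shows "omega k (jacobi_act g p) (frechet_derivative (jacobi_act g) (at p) u)
    (frechet_derivative (jacobi_act g) (at p) v) = omega k p u v"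
proof -
  obtain a b \<alpha> t where g: "g = (su_mat a b, \<alpha>, t)" "(cmod a)\<^sup>2 - (cmod b)\<^sup>2 = 1"
    by (rule jacobi_groupE[OF assms(1)])
  define j where "j = cnj b * snd p + cnj a"
  have "j \<noteq> 0"
    unfolding j_def using assms(2) by (intro automorphy_nonzero g(2)) (auto simp: DJ_def)
  then have j: "j \<noteq> 0" "cnj j \<noteq> 0" by simp_all
  define n where "n = \<alpha> - cnj \<alpha> * snd p + fst p"
  note jD' = jD_act[OF g(2) assms(2), of \<alpha> t, folded g(1) j_def]
  have D: "jD p \<noteq> 0" by (rule jD_nonzero[OF assms(2)])
  have fd: "frechet_derivative (jacobi_act g) (at p) =
      (\<lambda>u. (((fst u - cnj \<alpha> * snd u) * j - n * (cnj b * snd u)) / j\<^sup>2, snd u / j\<^sup>2))"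
    unfolding g n_def j_def
    by (rule frechet_derivative_at[symmetric, OF has_derivative_jacobi_act[OF g(2) assms(2)]])
  have act: "jacobi_act g p = (n / j, (a * snd p + b) / j)"
    by (simp add: g jacobi_act_su_mat n_def j_def)
  \<comment> \<open>The inhomogeneous part of this law for conj \<alpha>0 cancels the off-diagonal
    entry of the differential of the action.\<close>
  have al: "cnj (alpha0 (jacobi_act g p)) = j * cnj (alpha0 p) + cnj \<alpha> * j + cnj b * n"
  proof -
    have "cnj (alpha0 (jacobi_act g p)) * jD (jacobi_act g p)
        = cnj n / cnj j + n / j * cnj ((a * snd p + b) / j)"
      using jD_nonzero[OF jacobi_act_DJ[OF assms]] by (simp add: alpha0_def act)
    then have "cnj (alpha0 (jacobi_act g p)) * jD p = (cnj n / cnj j + n / j * cnj ((a * snd p + b) / j)) * (j * cnj j)"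
      unfolding jD' using j by (simp add: field_simps)
    also have "\<dots> = cnj n * j + n * (cnj a * cnj (snd p) + cnj b)"
      using j by (simp add: field_simps)
    also have "\<dots> = j * (cnj (fst p) + fst p * cnj (snd p)) + (cnj \<alpha> * j + cnj b * n) * jD p"
      by (simp add: n_def j_def jD_def algebra_simps)
    also have "\<dots> = (j * cnj (alpha0 p) + cnj \<alpha> * j + cnj b * n) * jD p"
      using D by (simp add: alpha0_def field_simps)
    finally show ?thesis using D by simp
  qed
  have A: "A_form (jacobi_act g p) (frechet_derivative (jacobi_act g) (at p) u) = A_form p u / j" for u
    unfolding A_form_def al fd using j by (simp add: field_simps power2_eq_square)
  show ?thesis
    unfolding omega_def wedge_def A jD' unfolding fd
    using j D by (simp add: field_simps power2_eq_square)
qed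

subsection \<open>Holomorphic change of variables\<close>

text \<open>The change of variables theorem speaks of real^n and of the determinant of the
  differential; this is the passage between the complex plane and real^2.\<close>

definition vec_of_complex :: "complex \<Rightarrow> real^2" where
  "vec_of_complex z = vector [Re z, Im z]"

definition complex_of_vec :: "real^2 \<Rightarrow> complex" where
  "complex_of_vec v = Complex (v $ 1) (v $ 2)"

lemma vec_of_complex_nth [simp]: "vec_of_complex z $ 1 = Re z" "vec_of_complex z $ 2 = Im z"
  by (simp_all add: vec_of_complex_def)

lemma complex_of_vec_sel [simp]: "Re (complex_of_vec v) = v $ 1" "Im (complex_of_vec v) = v $ 2"
  by (simp_all add: complex_of_vec_def)

lemma complex_of_vec_inverse [simp]: "vec_of_complex (complex_of_vec v) = v"
  by (simp add: vec_eq_iff forall_2)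

lemma vec_of_complex_inverse [simp]: "complex_of_vec (vec_of_complex z) = z"
  by (simp add: complex_eq_iff)

lemma vec_of_complex_eq_iff [simp]: "vec_of_complex x = vec_of_complex y \<longleftrightarrow> x = y"
  by (metis vec_of_complex_inverse)

lemma bounded_linear_vec_of_complex: "bounded_linear vec_of_complex"
  by (intro linear_conv_bounded_linear[THEN iffD1] linearI) (simp_all add: vec_eq_iff forall_2)

lemma bounded_linear_complex_of_vec: "bounded_linear complex_of_vec"
  by (intro linear_conv_bounded_linear[THEN iffD1] linearI) (simp_all add: complex_eq_iff)

lemma complex_of_vec_measurable [measurable]: "complex_of_vec \<in> borel_measurable borel"
  by (intro borel_measurable_continuous_onI linear_continuous_on bounded_linear_complex_of_vec)

lemma vec_of_complex_measurable [measurable]: "vec_of_complex \<in> borel_measurable borel"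
  by (intro borel_measurable_continuous_onI linear_continuous_on bounded_linear_vec_of_complex)

text \<open>Lebesgue measure is determined by its values on boxes, and the identification with
  real^2 takes boxes to boxes of the same side lengths.\<close>

lemma lborel_complex_vec: "(lborel :: complex measure) = distr lborel borel complex_of_vec"
proof (rule lborel_eqI)
  fix l u :: complex assume le: "\<And>b. b \<in> Basis \<Longrightarrow> l \<bullet> b \<le> u \<bullet> b"
  have le': "Re l \<le> Re u" "Im l \<le> Im u"
    using le[of 1] le[of \<i>] by (simp_all add: Basis_complex_def)
  have "complex_of_vec -` box l u = box (vec_of_complex l) (vec_of_complex u)"
    by (auto simp: mem_box_cart mem_box forall_2 Basis_complex_def)
  then have "emeasure (distr lborel borel complex_of_vec) (box l u)
      = emeasure lborel (box (vec_of_complex l) (vec_of_complex u))"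
    by (subst emeasure_distr) simp_all
  also have "\<dots> = (\<Prod>b\<in>Basis. (vec_of_complex u - vec_of_complex l) \<bullet> b)"
    using le' by (intro emeasure_lborel_box) (auto simp: Basis_vec_def UNIV_2 inner_axis)
  also have "(Basis :: (real^2) set) = {axis 1 1, axis 2 1}"
    by (auto simp: Basis_vec_def UNIV_2)
  also have "(\<Prod>b\<in>{axis 1 1, axis 2 1}. (vec_of_complex u - vec_of_complex l) \<bullet> b) = (\<Prod>b\<in>Basis. (u - l) \<bullet> b)"
    by (simp add: Basis_complex_def axis_eq_axis inner_axis)
  finally show "emeasure (distr lborel borel complex_of_vec) (box l u) = (\<Prod>b\<in>Basis. (u - l) \<bullet> b)" .
qed simp

lemma lborel_complex_prod:
  "(lborel :: complex measure) = distr (lborel \<Otimes>\<^sub>M lborel) borel (\<lambda>(x, y). Complex x y)"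
  unfolding lborel_prod
proof (rule lborel_eqI)
  fix l u :: complex assume le: "\<And>b. b \<in> Basis \<Longrightarrow> l \<bullet> b \<le> u \<bullet> b"
  have le': "Re l \<le> Re u" "Im l \<le> Im u"
    using le[of 1] le[of \<i>] by (simp_all add: Basis_complex_def)
  have meas: "(\<lambda>(x, y). Complex x y) \<in> borel_measurable (borel :: (real \<times> real) measure)"
    unfolding case_prod_beta Complex_eq
    by (intro borel_measurable_continuous_onI continuous_intros)
  have "(\<lambda>(x, y). Complex x y) -` box l u = box (Re l, Im l) (Re u, Im u)"
    by (auto simp: mem_box Basis_prod_def Basis_complex_def)
  then have "emeasure (distr lborel borel (\<lambda>(x, y). Complex x y)) (box l u)
      = emeasure lborel (box (Re l, Im l) (Re u, Im u))"
    using meas by (subst emeasure_distr) simp_all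
  also have "\<dots> = (\<Prod>b\<in>Basis. ((Re u, Im u) - (Re l, Im l)) \<bullet> b)"
    using le' by (intro emeasure_lborel_box) (auto simp: Basis_prod_def)
  also have "\<dots> = (\<Prod>b\<in>Basis. (u - l) \<bullet> b)"
    by (simp add: Basis_prod_def Basis_complex_def mult.commute)
  finally show "emeasure (distr lborel borel (\<lambda>(x, y). Complex x y)) (box l u) = (\<Prod>b\<in>Basis. (u - l) \<bullet> b)" .
qed simp

text \<open>Multiplication by c = x + iy has the matrix with rows (x, -y) and (y, x).\<close>

lemma det_complex_mult: "\<bar>det (matrix (\<lambda>v. vec_of_complex (c * complex_of_vec v)))\<bar> = (cmod c)\<^sup>2"
proof -
  have "det (matrix (\<lambda>v. vec_of_complex (c * complex_of_vec v))) = (cmod c)\<^sup>2"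
    unfolding cmod_power2 by (simp add: det_2 matrix_def axis_def power2_eq_square)
  then show ?thesis by simp
qed

section \<open>Substitution along injective holomorphic maps\<close>

lemma nn_integral_lborel_complex:
  assumes [measurable]: "F \<in> borel_measurable borel"
  shows "(\<integral>\<^sup>+z. F z \<partial>lborel) = (\<integral>\<^sup>+v. F (complex_of_vec v) \<partial>lborel)"
  by (subst lborel_complex_vec, subst nn_integral_distr) simp_all

text \<open>The change of variables theorem applied to the constant one on the image; the finite
  measure of the image makes this constant integrable.\<close>

lemma emeasure_conformal_image:
  fixes f f' :: "complex \<Rightarrow> complex"
  assumes der: "\<And>z. z \<in> B \<Longrightarrow> (f has_field_derivative f' z) (at z)"
    and inj: "inj_on f B" and B: "B \<in> sets borel" and fB: "f ` B \<in> sets borel"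
    and fin: "emeasure lborel (f ` B) < \<infinity>"
    and meas: "(\<lambda>z. indicator B z * (cmod (f' z))\<^sup>2) \<in> borel_measurable borel"
  shows "(\<integral>\<^sup>+z. ennreal (indicator B z * (cmod (f' z))\<^sup>2) \<partial>lborel) = emeasure lborel (f ` B)"
proof -
  define S where "S = vec_of_complex ` B"
  define g where "g = (\<lambda>v. vec_of_complex (f (complex_of_vec v)))"
  have S_eq: "S = complex_of_vec -` B" unfolding S_def
    by (auto simp: image_iff) (metis complex_of_vec_inverse)
  have S: "S \<in> sets borel"
    unfolding S_eq using measurable_sets[OF complex_of_vec_measurable B] by simp
  have gS_eq: "g ` S = complex_of_vec -` (f ` B)"
    unfolding S_def g_def image_image
    by (auto simp: image_iff) (metis complex_of_vec_inverse)
  have gS: "g ` S \<in> sets borel"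
    unfolding gS_eq using measurable_sets[OF complex_of_vec_measurable fB] by simp
  have em: "emeasure lborel (g ` S) = emeasure lborel (f ` B)"
    unfolding gS_eq by (subst lborel_complex_vec, subst emeasure_distr) (use fB in simp_all)
  have inj': "inj_on g S"
    using inj unfolding S_def g_def inj_on_def by auto
  define g' where "g' = (\<lambda>x v. vec_of_complex (f' (complex_of_vec x) * complex_of_vec v))"
  have der': "(g has_derivative g' x) (at x within S)" if "x \<in> S" for x
  proof -
    have "complex_of_vec x \<in> B" using that by (simp add: S_eq)
    then have 1: "(f has_derivative (*) (f' (complex_of_vec x))) (at (complex_of_vec x))"
      using der by (simp add: has_field_derivative_def)
    show ?thesis
      unfolding g_def g'_def
      by (intro bounded_linear.has_derivative[OF bounded_linear_vec_of_complex]
          has_derivative_compose[OF bounded_linear_imp_has_derivative[OF bounded_linear_complex_of_vec] 1])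
  qed
  define c where "c = measure lborel (f ` B)"
  have det: "\<bar>det (matrix (g' x))\<bar> = (cmod (f' (complex_of_vec x)))\<^sup>2" for x
    unfolding g'_def by (rule det_complex_mult)
  have lm: "g ` S \<in> lmeasurable"
    using gS em fin by (auto intro!: fmeasurableI)
  \<comment> \<open>The constant one is taken with values in real^1, the format of the theorem for
    vector-valued functions; its single component is extracted at the end.\<close>
  have one: "(\<lambda>_. vec 1 :: real^1) absolutely_integrable_on (g ` S)"
    using lm by (simp add: absolutely_integrable_on_const)
  have "integral (g ` S) (\<lambda>_. vec 1 :: real^1) = vec c"
  proof -
    have "((\<lambda>_. 1::real) has_integral c) (g ` S)"
    proof -
      have "((\<lambda>_. 1::real) has_integral measure lebesgue (g ` S)) (g ` S)"
        using lm by (simp add: lmeasure_integral has_integral_iff integrable_on_const)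
      moreover have "measure lebesgue (g ` S) = c"
        using gS em by (simp add: c_def measure_completion measure_def)
      ultimately show ?thesis by simp
    qed
    then have "((\<lambda>_. vec 1 :: real^1) has_integral vec c) (g ` S)"
      using has_integral_linear[of "\<lambda>_. 1::real" c "g ` S" "vec :: real \<Rightarrow> real^1"]
        linear_conv_bounded_linear[THEN iffD1, of "vec :: real \<Rightarrow> real^1"]
      by (simp add: linear_iff vec_eq_iff o_def)
    then show ?thesis by (rule integral_unique)
  qed
  with one has_absolute_integral_change_of_variables[of S g g' "\<lambda>_. vec 1 :: real^1" "vec c"] der' inj' S
  have "(\<lambda>x. \<bar>det (matrix (g' x))\<bar> *\<^sub>R (vec 1 :: real^1)) absolutely_integrable_on S"
    and "integral S (\<lambda>x. \<bar>det (matrix (g' x))\<bar> *\<^sub>R (vec 1 :: real^1)) = vec c"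
    by simp_all
  then have "((\<lambda>x. \<bar>det (matrix (g' x))\<bar> *\<^sub>R (vec 1 :: real^1)) has_integral vec c) S"
    using absolutely_integrable_on_def has_integral_iff by blast
  from has_integral_linear[OF this bounded_linear_vec_nth[of 1]]
  have hi: "((\<lambda>x. (cmod (f' (complex_of_vec x)))\<^sup>2) has_integral c) S"
    by (simp add: o_def det)
  have meas': "(\<lambda>v. indicator S v * (cmod (f' (complex_of_vec v)))\<^sup>2) \<in> borel_measurable borel"
    using measurable_compose[OF complex_of_vec_measurable meas]
    by (simp add: S_eq indicator_vimage o_def)
  have "(\<integral>\<^sup>+z. ennreal (indicator B z * (cmod (f' z))\<^sup>2) \<partial>lborel)
      = (\<integral>\<^sup>+v. ennreal (indicator S v * (cmod (f' (complex_of_vec v)))\<^sup>2) \<partial>lborel)"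
    using meas by (subst nn_integral_lborel_complex) (simp_all add: S_eq indicator_vimage)
  also have "\<dots> = ennreal c"
  proof (rule nn_integral_has_integral_lborel[OF meas'])
    show "((\<lambda>v. indicator S v * (cmod (f' (complex_of_vec v)))\<^sup>2) has_integral c) UNIV"
    proof -
      have "(\<lambda>v. indicator S v * (cmod (f' (complex_of_vec v)))\<^sup>2)
        = (\<lambda>v. if v \<in> S then (cmod (f' (complex_of_vec v)))\<^sup>2 else 0)" by auto
      then show ?thesis using hi by (simp only: has_integral_restrict_UNIV)
    qed
  qed auto
  also have "\<dots> = emeasure lborel (f ` B)"
    using fin by (simp add: c_def emeasure_eq_ennreal_measure less_top)
  finally show ?thesis .
qed

text \<open>The image under f of the measure with density |f'|^2 and Lebesgue measure on f(S) are
  two Borel measures. Bounded Borel sets form an intersection-stable generator on which the area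
  formula applies and both values are finite, so the measures agree, and with them all
  integrals.\<close>

lemma nn_integral_conformal_substitution:
  fixes f f' :: "complex \<Rightarrow> complex" and G :: "complex \<Rightarrow> ennreal"
  assumes S: "open S" and der: "\<And>z. z \<in> S \<Longrightarrow> (f has_field_derivative f' z) (at z)"
    and inj: "inj_on f S" and cont: "continuous_on S f'" and fS: "open (f ` S)"
    and G [measurable]: "G \<in> borel_measurable borel"
  shows "(\<integral>\<^sup>+z. indicator S z * (ennreal ((cmod (f' z))\<^sup>2) * G (f z)) \<partial>lborel)
    = (\<integral>\<^sup>+w. indicator (f ` S) w * G w \<partial>lborel)"
proof -
  \<comment> \<open>f is continued by a dummy value to a Borel map on the whole plane; the density
    \<open>h\<close> vanishes where the dummy value is taken.\<close>
  define f0 where "f0 = (\<lambda>z. if z \<in> S then f z else 0)"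
  define h where "h = (\<lambda>z. indicator S z * (cmod (f' z))\<^sup>2)"
  have [measurable]: "S \<in> sets borel" "f ` S \<in> sets borel" using S fS by auto
  have contf: "continuous_on S f"
    using der by (meson DERIV_continuous continuous_at_imp_continuous_on)
  have f0 [measurable]: "f0 \<in> borel_measurable borel"
    unfolding f0_def by (intro borel_measurable_continuous_on_if contf continuous_on_const) simp
  have "(\<lambda>z. indicator S z *\<^sub>R (cmod (f' z))\<^sup>2) \<in> borel_measurable borel"
    by (intro borel_measurable_continuous_on_indicator continuous_intros cont) simp
  then have h [measurable]: "h \<in> borel_measurable borel" by (simp add: h_def)
  let ?M1 = "distr (density lborel (\<lambda>z. ennreal (h z))) borel f0"
  let ?M2 = "density lborel (indicator (f ` S) :: complex \<Rightarrow> ennreal)"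
  have em: "emeasure ?M1 C = emeasure ?M2 C \<and> emeasure ?M1 C \<noteq> \<infinity>"
    if C [measurable]: "C \<in> sets borel" and bd: "bounded C" for C
  proof -
    define B where "B = S \<inter> f0 -` C"
    have B: "B \<in> sets borel"
      unfolding B_def using measurable_sets[OF f0 C] by (intro sets.Int) simp_all
    have fB: "f ` B = f ` S \<inter> C" by (auto simp: B_def f0_def)
    have e2: "emeasure ?M2 C = emeasure lborel (f ` B)"
      unfolding fB by (subst emeasure_density) (simp_all flip: indicator_inter_arith)
    have "bounded (f ` B)" unfolding fB using bd by (rule bounded_subset) auto
    then have fin: "emeasure lborel (f ` B) < \<infinity>" by (rule emeasure_bounded_finite)
    have hB: "indicator B z * (cmod (f' z))\<^sup>2 = h z * indicator C (f0 z)" for z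
      by (auto simp: B_def h_def split: split_indicator)
    have "emeasure ?M1 C = (\<integral>\<^sup>+z. ennreal (h z) * indicator (f0 -` C) z \<partial>lborel)"
      using measurable_sets[OF f0 C] by (subst emeasure_distr) (simp_all add: emeasure_density)
    also have "\<dots> = (\<integral>\<^sup>+z. ennreal (indicator B z * (cmod (f' z))\<^sup>2) \<partial>lborel)"
      unfolding hB by (intro nn_integral_cong) (simp split: split_indicator)
    also have "\<dots> = emeasure lborel (f ` B)"
    proof (rule emeasure_conformal_image[OF _ _ B _ fin])
      show "(f has_field_derivative f' z) (at z)" if "z \<in> B" for z using that der by (auto simp: B_def)
      show "inj_on f B" using inj by (rule inj_on_subset) (auto simp: B_def)
      show "f ` B \<in> sets borel" unfolding fB by simp
      show "(\<lambda>z. indicator B z * (cmod (f' z))\<^sup>2) \<in> borel_measurable borel" unfolding hB by simp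
    qed
    finally show ?thesis using e2 fin by simp
  qed
  have "?M1 = ?M2"
  proof (rule measure_eqI_generator_eq[where \<Omega> = UNIV and E = "{C \<in> sets borel. bounded C}"
        and A = "\<lambda>n. ball 0 (real n)"])
    show "Int_stable {C :: complex set \<in> sets borel. bounded C}"
      by (auto simp: Int_stable_def intro: bounded_Int)
    have "sets borel = sigma_sets UNIV {C :: complex set \<in> sets borel. bounded C}"
    proof
      have "sigma_sets UNIV (range (\<lambda>(a, b). box a b :: complex set))
        \<subseteq> sigma_sets UNIV {C :: complex set \<in> sets borel. bounded C}"
        by (intro sigma_sets_mono') (auto simp: bounded_box)
      then show "sets borel \<subseteq> sigma_sets UNIV {C :: complex set \<in> sets borel. bounded C}"
        by (simp add: borel_eq_box)
      show "sigma_sets UNIV {C :: complex set \<in> sets borel. bounded C} \<subseteq> sets borel"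
        using sets.sigma_sets_subset[of _ "borel :: complex measure"] by auto
    qed
    then show "sets ?M1 = sigma_sets UNIV {C \<in> sets borel. bounded C}"
      "sets ?M2 = sigma_sets UNIV {C \<in> sets borel. bounded C}" by simp_all
    show "(\<Union>i. ball 0 (real i)) = (UNIV :: complex set)"
      using reals_Archimedean2 by (auto simp: dist_norm)
    show "emeasure ?M1 (ball 0 (real i)) \<noteq> \<infinity>" for i
      using em[of "ball 0 (real i)"] by (metis borel_open open_ball bounded_ball)
  qed (use em in auto)
  then have "(\<integral>\<^sup>+w. G w \<partial>?M1) = (\<integral>\<^sup>+w. G w \<partial>?M2)" by simp
  moreover have "(\<integral>\<^sup>+w. G w \<partial>?M2) = (\<integral>\<^sup>+w. indicator (f ` S) w * G w \<partial>lborel)"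
    by (subst nn_integral_density) simp_all
  moreover have "(\<integral>\<^sup>+w. G w \<partial>?M1) = (\<integral>\<^sup>+z. ennreal (h z) * G (f0 z) \<partial>lborel)"
    by (subst nn_integral_distr) (simp_all add: nn_integral_density)
  moreover have "\<dots> = (\<integral>\<^sup>+z. indicator S z * (ennreal ((cmod (f' z))\<^sup>2) * G (f z)) \<partial>lborel)"
    by (intro nn_integral_cong) (simp add: h_def f0_def split: split_indicator)
  ultimately show ?thesis by simp
qed

lemma nn_integral_complex_affine:
  fixes G :: "complex \<Rightarrow> ennreal"
  assumes "c \<noteq> 0" "G \<in> borel_measurable borel"
  shows "(\<integral>\<^sup>+z. ennreal ((cmod c)\<^sup>2) * G (c * z + d) \<partial>lborel) = (\<integral>\<^sup>+w. G w \<partial>lborel)"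
proof -
  have surj: "range (\<lambda>z. c * z + d) = UNIV"
  proof (rule surjI)
    show "c * ((w - d) / c) + d = w" for w using assms(1) by simp
  qed
  have "(\<integral>\<^sup>+z. indicator UNIV z * (ennreal ((cmod c)\<^sup>2) * G (c * z + d)) \<partial>lborel)
    = (\<integral>\<^sup>+w. indicator (range (\<lambda>z. c * z + d)) w * G w \<partial>lborel)"
  proof (rule nn_integral_conformal_substitution)
    show "((\<lambda>z. c * z + d) has_field_derivative c) (at z)" for z
      by (auto intro!: derivative_eq_intros)
  qed (use assms surj in \<open>auto simp: inj_on_def\<close>)
  then show ?thesis by (simp add: surj)
qed

subsection \<open>The invariant measure\<close>

lemma jacobi_act_measurable:
  assumes "g \<in> jacobi_group"
  shows "jacobi_act g \<in> borel_measurable borel"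
proof -
  obtain a b \<alpha> t where g: "g = (su_mat a b, \<alpha>, t)" "(cmod a)\<^sup>2 - (cmod b)\<^sup>2 = 1"
    by (rule jacobi_groupE[OF assms(1)])
  have [measurable]: "fst \<in> borel_measurable (borel :: C2 measure)" "snd \<in> borel_measurable (borel :: C2 measure)"
    by (simp_all add: borel_prod[symmetric])
  show ?thesis
    unfolding g jacobi_act_su_mat[abs_def] by measurable
qed

lemma space_jacobi_measure: "space jacobi_measure = DJ"
  by (simp add: jacobi_measure_def space_restrict_space)

lemma sets_jacobi_measure: "sets jacobi_measure = sets (restrict_space borel DJ)"
  by (simp add: jacobi_measure_def sets_restrict_space)

lemma DJ_borel [measurable]: "DJ \<in> sets borel"
  using open_DJ by simp

lemma measurable_jacobi_measureI:
  "f \<in> borel_measurable borel \<Longrightarrow> f \<in> borel_measurable jacobi_measure"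
  unfolding measurable_cong_sets[OF sets_jacobi_measure refl] by (rule measurable_restrict_space1)

text \<open>z is the inner variable because, for fixed w, the group acts on z by an affine
  map.\<close>

lemma nn_integral_jacobi_measure:
  assumes [measurable]: "F \<in> borel_measurable borel"
  shows "(\<integral>\<^sup>+p. F p \<partial>jacobi_measure)
    = (\<integral>\<^sup>+w. indicator (ball 0 1) w * (ennreal (1 / (1 - (cmod w)\<^sup>2) ^ 3) * (\<integral>\<^sup>+z. F (z, w) \<partial>lborel)) \<partial>lborel)"
proof -
  have [measurable]: "snd \<in> borel_measurable (borel :: C2 measure)"
    by (simp add: borel_prod[symmetric])
  define H where "H = (\<lambda>w. ennreal (1 / (1 - (cmod w)\<^sup>2) ^ 3))"
  have [measurable]: "H \<in> borel_measurable borel" unfolding H_def by measurable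
  have Hm: "(\<lambda>p. H (snd p)) \<in> borel_measurable (borel :: C2 measure)" by measurable
  have F': "F \<in> borel_measurable (lborel \<Otimes>\<^sub>M lborel)" unfolding lborel_prod by simp
  have jm: "jacobi_measure = density (restrict_space lborel DJ) (\<lambda>p. H (snd p))"
    by (simp add: jacobi_measure_def H_def case_prod_unfold)
  have "(\<integral>\<^sup>+p. F p \<partial>jacobi_measure) = (\<integral>\<^sup>+p. H (snd p) * F p \<partial>restrict_space lborel DJ)"
    unfolding jm by (intro nn_integral_density measurable_restrict_space1) (use Hm in simp_all)
  also have "\<dots> = (\<integral>\<^sup>+p. H (snd p) * F p * indicator DJ p \<partial>lborel)"
    by (rule nn_integral_restrict_space) simp
  also have "\<dots> = (\<integral>\<^sup>+p. H (snd p) * F p * indicator (ball 0 1) (snd p) \<partial>(lborel \<Otimes>\<^sub>M lborel))"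
    unfolding lborel_prod by (intro nn_integral_cong) (auto simp: DJ_def indicator_def)
  also have "\<dots> = (\<integral>\<^sup>+w. \<integral>\<^sup>+z. H (snd (z, w)) * F (z, w) * indicator (ball 0 1) (snd (z, w)) \<partial>lborel \<partial>lborel)"
  proof (rule lborel_pair.nn_integral_snd[symmetric])
    have "(\<lambda>p. indicator (ball 0 1) (snd p) :: ennreal) \<in> borel_measurable (borel :: C2 measure)"
      by (rule measurable_compose[of snd borel borel]) (simp_all add: borel_measurable_indicator)
    then have "(\<lambda>p. H (snd p) * F p * indicator (ball 0 1) (snd p)) \<in> borel_measurable borel"
      using Hm assms by (intro borel_measurable_times_ennreal)
    then show "(\<lambda>p. H (snd p) * F p * indicator (ball 0 1) (snd p))
        \<in> borel_measurable (lborel \<Otimes>\<^sub>M lborel)"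
      unfolding lborel_prod by simp
  qed
  also have "\<dots> = (\<integral>\<^sup>+w. indicator (ball 0 1) w * (H w * (\<integral>\<^sup>+z. F (z, w) \<partial>lborel)) \<partial>lborel)"
  proof (rule nn_integral_cong)
    fix w
    have [measurable]: "(\<lambda>z. F (z, w)) \<in> borel_measurable borel"
      using measurable_compose[OF _ assms, of "\<lambda>z. (z, w)" borel] by (simp add: borel_prod[symmetric])
    have "(\<integral>\<^sup>+z. H (snd (z, w)) * F (z, w) * indicator (ball 0 1) (snd (z, w)) \<partial>lborel)
        = (\<integral>\<^sup>+z. (indicator (ball 0 1) w * H w) * F (z, w) \<partial>lborel)"
      by (intro nn_integral_cong) (simp add: mult_ac)
    also have "\<dots> = indicator (ball 0 1) w * H w * (\<integral>\<^sup>+z. F (z, w) \<partial>lborel)"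
      by (rule nn_integral_cmult) simp
    finally show "(\<integral>\<^sup>+z. H (snd (z, w)) * F (z, w) * indicator (ball 0 1) (snd (z, w)) \<partial>lborel)
        = indicator (ball 0 1) w * (H w * (\<integral>\<^sup>+z. F (z, w) \<partial>lborel))" by (simp add: mult.assoc)
  qed
  finally show ?thesis unfolding H_def .
qed

lemma jacobi_act_one: "jacobi_act jacobi_one p = p"
  unfolding jacobi_one_def su_mat_one[symmetric] jacobi_act_su_mat by simp

text \<open>The inverse is (g^-1, -g.\<alpha>, -t); no cocycle correction appears in t because
  \<alpha> conj \<alpha> is real.\<close>

fun jacobi_inv :: "jacobi \<Rightarrow> jacobi" where
  "jacobi_inv (g, \<alpha>, t) = (su_mat (cnj (g $ 1 $ 1)) (- g $ 1 $ 2), - (g $ 1 $ 1 * \<alpha> + g $ 1 $ 2 * cnj \<alpha>), - t)"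

lemma jacobi_inv:
  assumes "g \<in> jacobi_group"
  shows "jacobi_inv g \<in> jacobi_group" "jacobi_mult (jacobi_inv g) g = jacobi_one"
    "jacobi_mult g (jacobi_inv g) = jacobi_one"
proof -
  obtain a b \<alpha> t where g: "g = (su_mat a b, \<alpha>, t)" "(cmod a)\<^sup>2 - (cmod b)\<^sup>2 = 1"
    by (rule jacobi_groupE[OF assms(1)])
  note n = SU11_norm[OF g(2)]
  have gi: "jacobi_inv g = (su_mat (cnj a) (- b), - (a * \<alpha> + b * cnj \<alpha>), - t)"
    by (simp add: g)
  show "jacobi_inv g \<in> jacobi_group"
    unfolding gi by (rule jacobi_groupI) (use g in simp)
  have "cnj a * (a * \<alpha> + b * cnj \<alpha>) - b * (cnj a * cnj \<alpha> + cnj b * \<alpha>) = (a * cnj a - b * cnj b) * \<alpha>"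
    by (simp add: algebra_simps)
  then have 1: "cnj a * (a * \<alpha> + b * cnj \<alpha>) - b * (cnj a * cnj \<alpha> + cnj b * \<alpha>) = \<alpha>" using n by simp
  have 2: "cnj a * - (a * \<alpha> + b * cnj \<alpha>) - b * cnj (- (a * \<alpha> + b * cnj \<alpha>)) = - \<alpha>"
    using arg_cong[OF 1, of uminus] by (simp add: algebra_simps)
  show "jacobi_mult (jacobi_inv g) g = jacobi_one"
    unfolding gi unfolding g jacobi_mult_su_mat 2 using n
    by (simp add: jacobi_one_def algebra_simps flip: su_mat_one)
  have 3: "cnj (cnj a) * \<alpha> - - b * cnj \<alpha> = a * \<alpha> + b * cnj \<alpha>" by simp
  have 4: "Im (x * cnj (- x)) = 0" for x by simp
  have 5: "a * cnj a + b * cnj (- b) = 1" using n by simp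
  show "jacobi_mult g (jacobi_inv g) = jacobi_one"
    unfolding gi unfolding g jacobi_mult_su_mat 3 4 5
    by (simp add: jacobi_one_def flip: su_mat_one)
qed

lemma jacobi_act_inv:
  assumes "g \<in> jacobi_group" "p \<in> DJ"
  shows "jacobi_act (jacobi_inv g) (jacobi_act g p) = p" "jacobi_act g (jacobi_act (jacobi_inv g) p) = p"
  using jacobi_act_mult[OF jacobi_inv(1)[OF assms(1)] assms]
    jacobi_act_mult[OF assms(1) jacobi_inv(1)[OF assms(1)] assms(2)]
  by (simp_all only: jacobi_inv(2,3)[OF assms(1)] jacobi_act_one)

text \<open>The derivative of the Moebius map is 1 / j^2, whence the factor |j|^-4. That the map is
  a bijection of the disc is read off from the group action on the points (0, w).\<close>

lemma nn_integral_disc_moebius: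
  fixes G :: "complex \<Rightarrow> ennreal"
  assumes ab: "(cmod a)\<^sup>2 - (cmod b)\<^sup>2 = 1" and G: "G \<in> borel_measurable borel"
  shows "(\<integral>\<^sup>+w. indicator (ball 0 1) w * (ennreal (1 / cmod (cnj b * w + cnj a) ^ 4)
      * G ((a * w + b) / (cnj b * w + cnj a))) \<partial>lborel)
    = (\<integral>\<^sup>+w. indicator (ball 0 1) w * G w \<partial>lborel)"
proof -
  define f where "f = (\<lambda>w. (a * w + b) / (cnj b * w + cnj a))"
  define f' where "f' = (\<lambda>w. 1 / (cnj b * w + cnj a)\<^sup>2)"
  let ?g = "(su_mat a b, 0, 0) :: jacobi"
  have g: "?g \<in> jacobi_group" by (rule jacobi_groupI[OF ab])
  have f_eq: "jacobi_act ?g (0, w) = (0, f w)" for w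
    by (simp add: f_def)
  have gi_eq: "fst (jacobi_act (jacobi_inv ?g) (0, w)) = 0" for w by simp
  have nz: "cnj b * w + cnj a \<noteq> 0" if "w \<in> ball 0 1" for w
    using automorphy_nonzero[OF ab] that by simp
  have DJ0: "(0, w) \<in> DJ \<longleftrightarrow> w \<in> ball 0 1" for w by (simp add: DJ_def)
  have inj: "inj_on f (ball 0 1)"
  proof (rule inj_onI)
    fix x y assume xy: "x \<in> ball 0 1" "y \<in> ball 0 1" "f x = f y"
    then have "jacobi_act ?g (0, x) = jacobi_act ?g (0, y)" unfolding f_eq by simp
    then have "(0 :: complex, x) = (0, y)"
      using jacobi_act_inv(1)[OF g] DJ0 xy(1,2) by metis
    then show "x = y" by simp
  qed
  have img: "f ` ball 0 1 = ball 0 1"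
  proof
    show "f ` ball 0 1 \<subseteq> ball 0 1"
      using jacobi_act_DJ[OF g] DJ0 f_eq by (metis image_subsetI)
    show "ball 0 1 \<subseteq> f ` ball 0 1"
    proof
      fix w :: complex assume w: "w \<in> ball 0 1"
      obtain v where v: "jacobi_act (jacobi_inv ?g) (0, w) = (0, v)" using gi_eq by (metis prod.collapse)
      have "(0, v) \<in> DJ" using jacobi_act_DJ[OF jacobi_inv(1)[OF g] iffD2[OF DJ0 w]] unfolding v .
      moreover have "(0 :: complex, w) = (0, f v)"
        using jacobi_act_inv(2)[OF g iffD2[OF DJ0 w]] unfolding v f_eq by (rule sym)
      ultimately show "w \<in> f ` ball 0 1" using DJ0 by auto
    qed
  qed
  have der: "(f has_field_derivative f' z) (at z)" if "z \<in> ball 0 1" for z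
  proof -
    have num: "a * (cnj b * z + cnj a) - (a * z + b) * cnj b = 1"
      using SU11_norm[OF ab] by (simp add: algebra_simps)
    have 1: "((\<lambda>w. a * w + b) has_field_derivative a) (at z)"
      "((\<lambda>w. cnj b * w + cnj a) has_field_derivative cnj b) (at z)"
      by (auto intro!: derivative_eq_intros)
    show ?thesis
      using DERIV_divide[OF 1 nz[OF that]] unfolding f_def f'_def power2_eq_square num .
  qed
  have "continuous_on (ball 0 1) f'"
    unfolding f'_def using nz by (intro continuous_intros) auto
  from nn_integral_conformal_substitution[OF open_ball der inj this _ G]
  have "(\<integral>\<^sup>+z. indicator (ball 0 1) z * (ennreal ((cmod (f' z))\<^sup>2) * G (f z)) \<partial>lborel)
    = (\<integral>\<^sup>+w. indicator (ball 0 1) w * G w \<partial>lborel)" by (simp add: img)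
  moreover have "(cmod (f' w))\<^sup>2 = 1 / cmod (cnj b * w + cnj a) ^ 4" for w
    by (simp add: f'_def norm_divide norm_power power_divide norm_mult power4_eq_xxxx power2_eq_square)
  ultimately show ?thesis by (simp add: f_def)
qed

text \<open>The Jacobian is |j|^-2 in the fibre and |j|^-4 in the base, together |j|^-6, while the
  density (1 - |w|^2)^-3 picks up |j|^6. This balance explains the exponent 3 in the
  measure.\<close>

lemma nn_integral_jacobi_act:
  assumes g: "g \<in> jacobi_group" and F [measurable]: "F \<in> borel_measurable borel"
  shows "(\<integral>\<^sup>+p. F (jacobi_act g p) \<partial>jacobi_measure) = (\<integral>\<^sup>+p. F p \<partial>jacobi_measure)"
proof -
  obtain a b \<alpha> t where g_eq: "g = (su_mat a b, \<alpha>, t)" and ab: "(cmod a)\<^sup>2 - (cmod b)\<^sup>2 = 1"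
    by (rule jacobi_groupE[OF g])
  define j where "j = (\<lambda>w. cnj b * w + cnj a)"
  define \<phi> where "\<phi> = (\<lambda>w. (a * w + b) / j w)"
  define H where "H = (\<lambda>w. ennreal (1 / (1 - (cmod w)\<^sup>2) ^ 3))"
  define K where "K = (\<lambda>w. \<integral>\<^sup>+z. F (z, w) \<partial>lborel)"
  have [measurable]: "H \<in> borel_measurable borel" unfolding H_def by measurable
  have F': "F \<in> borel_measurable (lborel \<Otimes>\<^sub>M lborel)" unfolding lborel_prod by simp
  have [measurable]: "K \<in> borel_measurable borel"
    using lborel.borel_measurable_nn_integral_fst[OF measurable_pair_swap[OF F']] unfolding K_def by simp
  have Fw [measurable]: "(\<lambda>z. F (z, w)) \<in> borel_measurable borel" for w
    using measurable_compose[OF _ F, of "\<lambda>z. (z, w)" borel] by (simp add: borel_prod[symmetric])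
  have inner: "(\<integral>\<^sup>+z. F (jacobi_act g (z, w)) \<partial>lborel) = ennreal ((cmod (j w))\<^sup>2) * K (\<phi> w)"
    if "w \<in> ball 0 1" for w
  proof -
    have j: "j w \<noteq> 0" unfolding j_def using automorphy_nonzero[OF ab] that by simp
    have act: "jacobi_act g (z, w) = (1 / j w * z + (\<alpha> - cnj \<alpha> * w) / j w, \<phi> w)" for z
      by (simp add: g_eq jacobi_act_su_mat \<phi>_def j_def add_divide_distrib)
    have "(\<integral>\<^sup>+z. F (jacobi_act g (z, w)) \<partial>lborel)
      = (\<integral>\<^sup>+z. ennreal ((cmod (j w))\<^sup>2) * (ennreal ((cmod (1 / j w))\<^sup>2)
          * F (1 / j w * z + (\<alpha> - cnj \<alpha> * w) / j w, \<phi> w)) \<partial>lborel)"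
      unfolding act mult.assoc[symmetric] using j
      by (intro nn_integral_cong) (simp add: norm_divide power_divide flip: ennreal_mult)
    also have "\<dots> = ennreal ((cmod (j w))\<^sup>2) * (\<integral>\<^sup>+z. ennreal ((cmod (1 / j w))\<^sup>2)
          * F (1 / j w * z + (\<alpha> - cnj \<alpha> * w) / j w, \<phi> w) \<partial>lborel)"
      by (rule nn_integral_cmult) measurable
    also have "\<dots> = ennreal ((cmod (j w))\<^sup>2) * K (\<phi> w)"
      unfolding K_def using j
      by (subst nn_integral_complex_affine[where G = "\<lambda>z. F (z, \<phi> w)"]) simp_all
    finally show ?thesis .
  qed
  have dens: "H w * ennreal ((cmod (j w))\<^sup>2) = ennreal (1 / cmod (j w) ^ 4) * H (\<phi> w)"
    if "w \<in> ball 0 1" for w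
  proof -
    have j: "cmod (j w) > 0" unfolding j_def using automorphy_nonzero[OF ab] that by simp
    have w: "(0, w) \<in> DJ" using that by (simp add: DJ_def)
    have "jD (jacobi_act (su_mat a b, \<alpha>, t) (0, w)) = jD (0, w) / (j w * cnj (j w))"
      using jD_act[OF ab w] by (simp only: j_def snd_conv)
    moreover have "snd (jacobi_act (su_mat a b, \<alpha>, t) (0, w)) = \<phi> w"
      by (simp only: jacobi_act_su_mat \<phi>_def j_def snd_conv)
    ultimately have "complex_of_real (1 - (cmod (\<phi> w))\<^sup>2) = of_real ((1 - (cmod w)\<^sup>2) / (cmod (j w))\<^sup>2)"
      unfolding jD_of_real complex_norm_square[symmetric] snd_conv by (simp only: of_real_divide)
    then have e: "1 - (cmod (\<phi> w))\<^sup>2 = (1 - (cmod w)\<^sup>2) / (cmod (j w))\<^sup>2" using of_real_eq_iff by blast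
    have pos: "1 - (cmod w)\<^sup>2 > 0" using Re_jD_pos[OF w] by simp
    have "1 / (1 - (cmod w)\<^sup>2) ^ 3 * (cmod (j w))\<^sup>2 = 1 / cmod (j w) ^ 4 * (1 / (1 - (cmod (\<phi> w))\<^sup>2) ^ 3)"
    proof -
      have "1 / d ^ 3 * J\<^sup>2 = 1 / J ^ 4 * (1 / (d / J\<^sup>2) ^ 3)" if "J > 0" for d J :: real
        using that by (simp add: power_divide field_simps eval_nat_numeral)
      then show ?thesis unfolding e using j .
    qed
    then show ?thesis
      unfolding H_def using pos j e by (simp flip: ennreal_mult add: divide_nonneg_pos)
  qed
  have Fact: "(\<lambda>p. F (jacobi_act g p)) \<in> borel_measurable borel"
    by (rule measurable_compose[OF jacobi_act_measurable[OF g] F])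
  have "(\<integral>\<^sup>+p. F (jacobi_act g p) \<partial>jacobi_measure)
    = (\<integral>\<^sup>+w. indicator (ball 0 1) w * (H w * (\<integral>\<^sup>+z. F (jacobi_act g (z, w)) \<partial>lborel)) \<partial>lborel)"
    unfolding H_def by (rule nn_integral_jacobi_measure[OF Fact])
  also have "\<dots> = (\<integral>\<^sup>+w. indicator (ball 0 1) w * (ennreal (1 / cmod (j w) ^ 4) * (H (\<phi> w) * K (\<phi> w))) \<partial>lborel)"
  proof (rule nn_integral_cong)
    fix w :: complex
    show "indicator (ball 0 1) w * (H w * (\<integral>\<^sup>+z. F (jacobi_act g (z, w)) \<partial>lborel))
      = indicator (ball 0 1) w * (ennreal (1 / cmod (j w) ^ 4) * (H (\<phi> w) * K (\<phi> w)))"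
    proof (cases "w \<in> ball 0 1")
      case True
      show ?thesis unfolding inner[OF True] mult.assoc[symmetric]
        by (simp only: mult.assoc[of "indicator _ _"] dens[OF True])
    qed simp
  qed
  also have "\<dots> = (\<integral>\<^sup>+w. indicator (ball 0 1) w * (H w * K w) \<partial>lborel)"
    unfolding \<phi>_def j_def by (rule nn_integral_disc_moebius[OF ab]) measurable
  also have "\<dots> = (\<integral>\<^sup>+p. F p \<partial>jacobi_measure)"
    unfolding H_def K_def by (rule nn_integral_jacobi_measure[OF F, symmetric])
  finally show ?thesis .
qed

lemma jacobi_act_measurable_jacobi:
  assumes "g \<in> jacobi_group"
  shows "jacobi_act g \<in> measurable jacobi_measure jacobi_measure"
proof -
  have "jacobi_act g \<in> measurable (restrict_space borel DJ) (restrict_space borel DJ)"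
    using jacobi_act_DJ[OF assms] jacobi_act_measurable[OF assms]
    by (intro measurable_restrict_space2 measurable_restrict_space1) (auto simp: space_restrict_space)
  then show ?thesis
    unfolding measurable_cong_sets[OF sets_jacobi_measure sets_jacobi_measure] .
qed

lemma distr_jacobi_measure:
  assumes g: "g \<in> jacobi_group"
  shows "distr jacobi_measure jacobi_measure (jacobi_act g) = jacobi_measure"
proof (rule measure_eqI)
  fix B assume "B \<in> sets (distr jacobi_measure jacobi_measure (jacobi_act g))"
  then have B: "B \<in> sets jacobi_measure" by simp
  then have B': "B \<in> sets borel"
    unfolding sets_jacobi_measure by (auto simp: sets_restrict_space)
  note act = jacobi_act_measurable_jacobi[OF g]
  have "emeasure (distr jacobi_measure jacobi_measure (jacobi_act g)) B
      = (\<integral>\<^sup>+p. indicator B p \<partial>distr jacobi_measure jacobi_measure (jacobi_act g))"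
    using B by simp
  also have "\<dots> = (\<integral>\<^sup>+p. indicator B (jacobi_act g p) \<partial>jacobi_measure)"
    by (rule nn_integral_distr[OF act]) (use B in simp)
  also have "\<dots> = (\<integral>\<^sup>+p. indicator B p \<partial>jacobi_measure)"
    by (rule nn_integral_jacobi_act[OF g]) (use B' in simp)
  also have "\<dots> = emeasure jacobi_measure B" using B by simp
  finally show "emeasure (distr jacobi_measure jacobi_measure (jacobi_act g)) B = emeasure jacobi_measure B" .
qed simp

subsection \<open>The total mass of the weight\<close>

lemma nn_integral_gaussian:
  fixes s :: real
  assumes "s > 0"
  shows "(\<integral>\<^sup>+x. ennreal (exp (- x\<^sup>2 / s)) \<partial>lborel) = ennreal (sqrt (pi * s))"
proof -
  define \<sigma> where "\<sigma> = sqrt (s / 2)"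
  have \<sigma>: "\<sigma> > 0" "2 * \<sigma>\<^sup>2 = s" using assms by (simp_all add: \<sigma>_def)
  have nd: "exp (- x\<^sup>2 / s) = sqrt (pi * s) * normal_density 0 \<sigma> x" for x
    using assms \<sigma>(2) by (simp add: normal_density_def mult.assoc mult.left_commute)
  have "(\<integral>\<^sup>+x. ennreal (exp (- x\<^sup>2 / s)) \<partial>lborel)
      = (\<integral>\<^sup>+x. ennreal (sqrt (pi * s)) * ennreal (normal_density 0 \<sigma> x) \<partial>lborel)"
    unfolding nd using assms by (simp add: ennreal_mult)
  also have "\<dots> = ennreal (sqrt (pi * s)) * (\<integral>\<^sup>+x. ennreal (normal_density 0 \<sigma> x) \<partial>lborel)"
    by (rule nn_integral_cmult) simp
  also have "(\<integral>\<^sup>+x. ennreal (normal_density 0 \<sigma> x) \<partial>lborel) = ennreal (\<integral>x. normal_density 0 \<sigma> x \<partial>lborel)"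
    using \<sigma>(1) by (intro nn_integral_eq_integral integrable_normal_density) auto
  also have "(\<integral>x. normal_density 0 \<sigma> x \<partial>lborel) = 1"
    by (rule integral_normal_density[OF \<sigma>(1)])
  finally show ?thesis by simp
qed

text \<open>Rotating z by half the argument of w replaces w by r = |w|. The exponent then is -x^2 /
  (1 - r) - y^2 / (1 + r), a product of two one-dimensional Gaussians.\<close>

lemma nn_integral_quadratic_gaussian:
  fixes w :: complex
  assumes w: "cmod w < 1"
  shows "(\<integral>\<^sup>+z. ennreal (exp (- ((cmod z)\<^sup>2 + Re (z\<^sup>2 * cnj w)) / (1 - (cmod w)\<^sup>2))) \<partial>lborel)
    = ennreal (pi * sqrt (1 - (cmod w)\<^sup>2))"
proof -
  define r where "r = cmod w"
  define c where "c = cis (Arg w / 2)"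
  have c: "c \<noteq> 0" "cmod c = 1" by (simp_all add: c_def)
  have r: "0 \<le> r" "r < 1" using w by (simp_all add: r_def)
  have cw: "c\<^sup>2 * cnj w = of_real r"
  proof -
    have "w = of_real r * c\<^sup>2"
      by (simp add: r_def c_def Complex.DeMoivre flip: rcis_def rcis_cmod_Arg)
    then have "c\<^sup>2 * cnj w = of_real r * (c * cnj c)\<^sup>2" by (simp add: power_mult_distrib)
    then show ?thesis using c(2) by (simp flip: complex_norm_square)
  qed
  define G where "G = (\<lambda>z. ennreal (exp (- ((cmod z)\<^sup>2 + Re (z\<^sup>2 * cnj w)) / (1 - (cmod w)\<^sup>2))))"
  have [measurable]: "G \<in> borel_measurable borel"
    unfolding G_def by measurable
  have split: "G (c * Complex x y) = ennreal (exp (- x\<^sup>2 / (1 - r))) * ennreal (exp (- y\<^sup>2 / (1 + r)))" for x y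
  proof -
    have "(c * Complex x y)\<^sup>2 * cnj w = of_real r * (Complex x y)\<^sup>2"
      unfolding power_mult_distrib using cw by (simp add: mult_ac)
    then have "Re ((c * Complex x y)\<^sup>2 * cnj w) = r * (x\<^sup>2 - y\<^sup>2)"
      by (simp only:) (simp add: power2_eq_square)
    moreover have "(cmod (c * Complex x y))\<^sup>2 = x\<^sup>2 + y\<^sup>2"
      using c(2) by (simp add: norm_mult cmod_power2)
    ultimately have "(cmod (c * Complex x y))\<^sup>2 + Re ((c * Complex x y)\<^sup>2 * cnj w) = (1 + r) * x\<^sup>2 + (1 - r) * y\<^sup>2"
      by (simp add: algebra_simps)
    moreover have "1 - (cmod w)\<^sup>2 = (1 + r) * (1 - r)" by (simp add: r_def power2_eq_square algebra_simps)
    moreover have "- ((1 + r) * x\<^sup>2 + (1 - r) * y\<^sup>2) / ((1 + r) * (1 - r)) = - x\<^sup>2 / (1 - r) + - y\<^sup>2 / (1 + r)"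
      using r by (simp add: field_simps)
    ultimately show ?thesis
      unfolding G_def by (simp only: exp_add ennreal_mult[OF exp_ge_zero exp_ge_zero])
  qed
  have "(\<integral>\<^sup>+z. G z \<partial>lborel) = (\<integral>\<^sup>+z. G (c * z) \<partial>lborel)"
    using nn_integral_complex_affine[OF c(1), of G 0] c(2) by simp
  also have "\<dots> = (\<integral>\<^sup>+p. G (c * (case p of (x, y) \<Rightarrow> Complex x y)) \<partial>(lborel \<Otimes>\<^sub>M lborel))"
  proof (subst lborel_complex_prod, rule nn_integral_distr)
    show "(\<lambda>(x, y). Complex x y) \<in> measurable (lborel \<Otimes>\<^sub>M lborel) borel"
      unfolding case_prod_beta Complex_eq lborel_prod
      by (simp, intro borel_measurable_continuous_onI continuous_intros)
  qed measurable
  also have "\<dots> = (\<integral>\<^sup>+p. ennreal (exp (- (fst p)\<^sup>2 / (1 - r))) * ennreal (exp (- (snd p)\<^sup>2 / (1 + r)))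
      \<partial>(lborel \<Otimes>\<^sub>M lborel))"
    by (intro nn_integral_cong) (simp add: case_prod_beta split)
  also have "\<dots> = (\<integral>\<^sup>+x. \<integral>\<^sup>+y. ennreal (exp (- x\<^sup>2 / (1 - r))) * ennreal (exp (- y\<^sup>2 / (1 + r)))
      \<partial>lborel \<partial>lborel)"
    by (subst lborel.nn_integral_fst[symmetric]) simp_all
  also have "\<dots> = ennreal (sqrt (pi * (1 - r))) * ennreal (sqrt (pi * (1 + r)))"
    using r by (simp add: nn_integral_cmult nn_integral_multc nn_integral_gaussian[simplified])
  also have "\<dots> = ennreal (pi * sqrt (1 - (cmod w)\<^sup>2))"
  proof -
    have "sqrt (pi * (1 - r)) * sqrt (pi * (1 + r)) = sqrt (pi\<^sup>2 * (1 - r\<^sup>2))"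
      by (simp add: power2_eq_square algebra_simps flip: real_sqrt_mult)
    also have "\<dots> = pi * sqrt (1 - r\<^sup>2)" by (simp add: real_sqrt_mult)
    finally show ?thesis using r by (simp add: r_def flip: ennreal_mult)
  qed
  finally show ?thesis unfolding G_def .
qed

lemma emeasure_disc: "r \<ge> 0 \<Longrightarrow> emeasure lborel (ball (0::complex) r) = ennreal (pi * r\<^sup>2)"
  by (simp add: emeasure_ball unit_ball_vol_2)

text \<open>On the disc, t = 1 - |w|^2 is distributed as \<pi> times the uniform measure on [0, 1]:
  for 0 \<le> x \<le> 1 the set t > x is a disc of area \<pi> (1 - x). Comparing half-lines is
  enough.\<close>

lemma nn_integral_disc_radial:
  fixes G :: "real \<Rightarrow> ennreal"
  assumes [measurable]: "G \<in> borel_measurable borel"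
  shows "(\<integral>\<^sup>+w. indicator (ball (0::complex) 1) w * G (1 - (cmod w)\<^sup>2) \<partial>lborel)
    = (\<integral>\<^sup>+t. ennreal pi * indicator {0..1} t * G t \<partial>lborel)"
proof -
  let ?T = "\<lambda>w::complex. 1 - (cmod w)\<^sup>2"
  have ball [measurable]: "ball (0::complex) 1 \<in> sets borel" by simp
  let ?M = "distr (density lborel (indicator (ball 0 1))) borel ?T"
  let ?N = "density lborel (\<lambda>t. ennreal pi * indicator {0..1} t) :: real measure"
  have M: "emeasure ?M {x<..} = ennreal (pi * min 1 (max 0 (1 - x)))" for x
  proof -
    define r where "r = sqrt (min 1 (max 0 (1 - x)))"
    have "ball 0 1 \<inter> ?T -` {x<..} = ball 0 r"
    proof (rule set_eqI)
      fix w
      have "(cmod w < 1 \<and> (cmod w)\<^sup>2 < 1 - x) \<longleftrightarrow> (cmod w)\<^sup>2 < min 1 (max 0 (1 - x))"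
      proof (cases "x < 1")
        case False
        then have "\<not> (cmod w)\<^sup>2 < 1 - x" using zero_le_power2[of "cmod w"] by linarith
        then show ?thesis using False by simp
      qed (use abs_square_less_1[of "cmod w"] in auto)
      also have "\<dots> \<longleftrightarrow> sqrt ((cmod w)\<^sup>2) < r"
        unfolding r_def by (simp only: real_sqrt_less_iff)
      also have "sqrt ((cmod w)\<^sup>2) = cmod w" by simp
      finally show "w \<in> ball 0 1 \<inter> ?T -` {x<..} \<longleftrightarrow> w \<in> ball 0 r" by auto
    qed
    moreover have "emeasure ?M {x<..} = emeasure lborel (ball 0 1 \<inter> ?T -` {x<..})"
    proof -
      have T: "?T \<in> borel_measurable borel" by measurable
      show ?thesis
        using measurable_sets[OF T, of "{x<..}"]
        by (subst emeasure_distr) (simp_all add: emeasure_density flip: indicator_inter_arith)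
    qed
    moreover have "r \<ge> 0" "r\<^sup>2 = min 1 (max 0 (1 - x))" by (simp_all add: r_def)
    ultimately show ?thesis by (simp add: emeasure_disc)
  qed
  have N: "emeasure ?N {x<..} = ennreal (pi * min 1 (max 0 (1 - x)))" for x
  proof -
    have "emeasure ?N {x<..} = (\<integral>\<^sup>+t. ennreal pi * indicator ({0..1} \<inter> {x<..}) t \<partial>lborel)"
      by (subst emeasure_density) (simp_all add: indicator_inter_arith mult.assoc)
    also have "\<dots> = ennreal pi * emeasure lborel ({0..1} \<inter> {x<..})"
      by (rule nn_integral_cmult_indicator) simp
    also have "emeasure lborel ({0..1} \<inter> {x<..}) = ennreal (min 1 (max 0 (1 - x)))"
    proof (cases "x < 0")
      case True
      then have "{0..1} \<inter> {x<..} = {0..1}" by auto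
      then show ?thesis using True by simp
    next
      case False
      then have "{0..1} \<inter> {x<..} = {x<..1}" by auto
      then show ?thesis using False by (cases "x \<le> 1") (simp_all add: max_def min_def)
    qed
    finally show ?thesis by (simp add: ennreal_mult)
  qed
  have "?M = ?N"
    by (rule measure_eqI_lessThan) (simp_all only: M N sets_distr sets_density sets_lborel ennreal_less_top infinity_ennreal_def)
  then have "(\<integral>\<^sup>+t. G t \<partial>?M) = (\<integral>\<^sup>+t. G t \<partial>?N)" by simp
  then show ?thesis
    by (simp add: nn_integral_distr nn_integral_density)
qed

text \<open>The weight of the scalar product, which is the reciprocal of K(p, p); see
  \<open>rho_norm\<close>.\<close>

definition rho :: "real \<Rightarrow> C2 \<Rightarrow> real" where
  "rho k p = (1 - (cmod (snd p))\<^sup>2) powr (2 * k)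
    * exp (- ((cmod (fst p))\<^sup>2 + Re ((fst p)\<^sup>2 * cnj (snd p))) / (1 - (cmod (snd p))\<^sup>2))"

lemma rho_measurable [measurable]: "rho k \<in> borel_measurable borel"
proof -
  have [measurable]: "cnj \<in> borel_measurable borel"
    by (intro borel_measurable_continuous_onI continuous_intros)
  have "rho k \<in> borel_measurable (borel \<Otimes>\<^sub>M borel)" unfolding rho_def[abs_def] by measurable
  then show ?thesis by (simp add: borel_prod)
qed

lemma nn_integral_rho:
  assumes k: "k > 3 / 4"
  shows "(\<integral>\<^sup>+p. ennreal (rho k p) \<partial>jacobi_measure) = ennreal (2 * pi\<^sup>2 / (4 * k - 3))"
proof -
  \<comment> \<open>The exponent collects 2k from the weight, -3 from the measure and 1/2 from the
    fibre Gaussian. It exceeds -1 exactly for k > 3/4, and 1 / (s + 1) = 2 / (4k - 3). One factor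
    \<pi> comes from the fibre, the other from the disc.\<close>
  define s where "s = 2 * k - 5 / 2"
  have s: "s > -1" using k by (simp add: s_def)
  define G where "G = (\<lambda>t. ennreal (pi * t powr s))"
  have [measurable]: "G \<in> borel_measurable borel" unfolding G_def by measurable
  have "(\<integral>\<^sup>+p. ennreal (rho k p) \<partial>jacobi_measure)
    = (\<integral>\<^sup>+w. indicator (ball 0 1) w * (ennreal (1 / (1 - (cmod w)\<^sup>2) ^ 3) * (\<integral>\<^sup>+z. ennreal (rho k (z, w)) \<partial>lborel)) \<partial>lborel)"
    by (rule nn_integral_jacobi_measure) measurable
  also have "\<dots> = (\<integral>\<^sup>+w. indicator (ball 0 1) w * G (1 - (cmod w)\<^sup>2) \<partial>lborel)"
  proof (rule nn_integral_cong)
    fix w :: complex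
    show "indicator (ball 0 1) w * (ennreal (1 / (1 - (cmod w)\<^sup>2) ^ 3) * (\<integral>\<^sup>+z. ennreal (rho k (z, w)) \<partial>lborel))
        = indicator (ball 0 1) w * G (1 - (cmod w)\<^sup>2)"
    proof (cases "cmod w < 1")
      case True
      define d where "d = 1 - (cmod w)\<^sup>2"
      have d: "d > 0" using True by (simp add: d_def abs_square_less_1)
      have inner: "(\<integral>\<^sup>+z. ennreal (rho k (z, w)) \<partial>lborel) = ennreal (d powr (2 * k)) * ennreal (pi * sqrt d)"
        unfolding rho_def fst_conv snd_conv d_def nn_integral_quadratic_gaussian[OF True, symmetric]
          ennreal_mult[OF powr_ge_zero exp_ge_zero]
        by (rule nn_integral_cmult) measurable
      have "ennreal (1 / d ^ 3) * (\<integral>\<^sup>+z. ennreal (rho k (z, w)) \<partial>lborel) = ennreal (1 / d ^ 3 * (d powr (2 * k) * (pi * sqrt d)))"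
      proof -
        have "ennreal a * (ennreal b * ennreal c) = ennreal (a * (b * c))"
          if "0 \<le> a" "0 \<le> b" "0 \<le> c" for a b c
          using that by (simp only: ennreal_mult mult_nonneg_nonneg)
        from this[of "1 / d ^ 3" "d powr (2 * k)" "pi * sqrt d"] show ?thesis
          unfolding inner using d by simp
      qed
      also have "1 / d ^ 3 * (d powr (2 * k) * (pi * sqrt d)) = pi * d powr s"
      proof -
        have "2 * k = s + 5 / 2" by (simp add: s_def)
        then have "d powr (2 * k) * sqrt d = d powr s * (d powr (5 / 2) * d powr (1 / 2))"
          using d by (simp add: powr_add powr_half_sqrt)
        also have "d powr (5 / 2) * d powr (1 / 2) = d ^ 3"
          using d by (simp flip: powr_add)
        finally have X: "d powr (2 * k) * sqrt d = d powr s * d ^ 3" .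
        have "1 / d ^ 3 * (d powr (2 * k) * (pi * sqrt d)) = pi * (d powr (2 * k) * sqrt d) / d ^ 3"
          by (simp only: times_divide_eq_left times_divide_eq_right mult_1 mult.left_commute)
        then show ?thesis unfolding X using d by simp
      qed
      finally have "ennreal (1 / d ^ 3) * (\<integral>\<^sup>+z. ennreal (rho k (z, w)) \<partial>lborel) = G d"
        unfolding G_def .
      then show ?thesis by (simp only: d_def)
    qed (simp add: indicator_def)
  qed
  also have "\<dots> = (\<integral>\<^sup>+t. ennreal pi * indicator {0..1} t * G t \<partial>lborel)"
    by (rule nn_integral_disc_radial) measurable
  also have "\<dots> = (\<integral>\<^sup>+t. ennreal (indicator {0..1} t * (pi\<^sup>2 * t powr s)) \<partial>lborel)"
  proof (rule nn_integral_cong)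
    fix t :: real
    have "ennreal pi * ennreal (pi * t powr s) = ennreal (pi * (pi * t powr s))"
      by (rule ennreal_mult[symmetric]) simp_all
    then show "ennreal pi * indicator {0..1} t * G t = ennreal (indicator {0..1} t * (pi\<^sup>2 * t powr s))"
      by (cases "t \<in> {0..1}") (simp_all add: G_def power2_eq_square mult.assoc)
  qed
  also have "\<dots> = ennreal (pi\<^sup>2 * (1 / (s + 1)))"
  proof (rule nn_integral_has_integral_lborel)
    have "((\<lambda>t. t powr s) has_integral (1 powr (s + 1) / (s + 1))) {0..1}"
      by (rule has_integral_powr_from_0) (use s in auto)
    then have "((\<lambda>t. pi\<^sup>2 * t powr s) has_integral (pi\<^sup>2 * (1 / (s + 1)))) {0..1}"
      using has_integral_mult_right[of _ _ _ "pi\<^sup>2"] by (metis powr_one_eq_one)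
    moreover have "(\<lambda>t. indicator {0..1} t * (pi\<^sup>2 * t powr s))
        = (\<lambda>t. if t \<in> {0..1} then pi\<^sup>2 * t powr s else 0)" by auto
    ultimately show "((\<lambda>t. indicator {0..1} t * (pi\<^sup>2 * t powr s)) has_integral pi\<^sup>2 * (1 / (s + 1))) UNIV"
      by (simp only: has_integral_restrict_UNIV)
  qed auto
  also have "pi\<^sup>2 * (1 / (s + 1)) = 2 * pi\<^sup>2 / (4 * k - 3)"
    using k by (simp add: s_def field_simps)
  finally show ?thesis .
qed

subsection \<open>The derived representation\<close>

lemma scaleC_of_nat_Suc: "of_nat (Suc n) *\<^sub>C (x::'a::complex_hilbert) = of_nat n *\<^sub>C x + x"
  by (simp add: scaleC_add_left)

locale jacobi_rep =
  fixes U :: "jacobi \<Rightarrow> 'h::complex_hilbert \<Rightarrow> 'h" and e0 :: 'h and k k' :: real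
  assumes rep: "continuous_unitary_rep U"
    and relations: "jacobi_relations U"
    and e0_cyclic: "cyclic_vector U e0"
    and e0_smooth: "e0 \<in> smooth_vectors U"
    and e0_unit: "cinner e0 e0 = 1"
    and e0_lowest: "op_a U e0 = 0" "op_Km U e0 = 0" "op_K0 U e0 = complex_of_real k *\<^sub>C e0"
    and k_ge: "k \<ge> 1"
    and k': "2 * k = 2 * k' + 1 / 2"
begin

abbreviation "SV \<equiv> smooth_vectors U"
abbreviation "oA \<equiv> op_ad U"
abbreviation "oa \<equiv> op_a U"
abbreviation "oK0 \<equiv> op_K0 U"
abbreviation "oKp \<equiv> op_Kp U"
abbreviation "oKm \<equiv> op_Km U"
abbreviation "oB \<equiv> op_Kp' U"

lemma chart_group: "jacobi_chart p \<in> jacobi_group"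
proof -
  obtain \<theta> b \<alpha> t where p: "p = (\<theta>, b, \<alpha>, t)" by (cases p)
  have "(cmod (complex_of_real (sqrt (1 + (cmod b)\<^sup>2)) * cis \<theta>))\<^sup>2 - (cmod b)\<^sup>2 = 1"
    by (simp add: norm_mult)
  then show ?thesis unfolding p by (simp add: jacobi_groupI)
qed

lemma U_unitary:
  assumes "g \<in> jacobi_group"
  shows U_add: "U g (x + y) = U g x + U g y" and U_scaleC: "U g (c *\<^sub>C x) = c *\<^sub>C U g x"
    and cinner_U: "cinner (U g x) (U g y) = cinner x y"
  using rep assms by (auto simp: continuous_unitary_rep_def unitary_op_def)

lemma U_one: "U jacobi_one x = x"
  using rep by (simp add: continuous_unitary_rep_def)

lemma U_mult: "g \<in> jacobi_group \<Longrightarrow> h \<in> jacobi_group \<Longrightarrow> U (jacobi_mult g h) x = U g (U h x)"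
  using rep by (simp add: continuous_unitary_rep_def)

lemma norm_U: "g \<in> jacobi_group \<Longrightarrow> norm (U g x) = norm x"
  using cinner_U[of g x x] by (simp add: cinner_self flip: of_real_power)

lemma bounded_linear_U:
  assumes "g \<in> jacobi_group"
  shows "bounded_linear (U g)"
proof (rule bounded_linear_intro[where K = 1])
  show "U g (r *\<^sub>R x) = r *\<^sub>R U g x" for r x
    using U_scaleC[OF assms, of "of_real r" x] by (simp add: scaleC_of_real)
qed (simp_all add: U_add[OF assms] norm_U[OF assms])

lemma SV_add [intro]: "x \<in> SV \<Longrightarrow> y \<in> SV \<Longrightarrow> x + y \<in> SV"
  by (simp add: smooth_vectors_def U_add[OF chart_group] smooth_on_add)

lemma SV_scaleC [intro]: "x \<in> SV \<Longrightarrow> c *\<^sub>C x \<in> SV"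
  by (simp add: smooth_vectors_def U_scaleC[OF chart_group]
      smooth_on_linear_comp[OF open_UNIV bounded_linear_scaleC_right])

lemma SV_diff [intro]: "x \<in> SV \<Longrightarrow> y \<in> SV \<Longrightarrow> x - y \<in> SV"
  using SV_add[of x "(- 1) *\<^sub>C y"] SV_scaleC[of y "- 1"] by (simp add: scaleC_minus_left)

lemma SV_zero [simp]: "0 \<in> SV"
  using SV_scaleC[OF e0_smooth, of 0] by simp

lemma SV_sum [intro]: "(\<And>i. i \<in> I \<Longrightarrow> f i \<in> SV) \<Longrightarrow> sum f I \<in> SV"
  by (induction I rule: infinite_finite_induct) auto

lemma has_derivative_orbit:
  assumes "v \<in> SV"
  shows "((\<lambda>p. U (jacobi_chart p) v) has_derivative (\<lambda>X. derived_rep U X v)) (at 0)"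
proof -
  have "Ck_on (Suc 0) UNIV (\<lambda>p. U (jacobi_chart p) v)"
    using assms unfolding smooth_vectors_def smooth_on_def by blast
  from Ck_on_SucD(1)[OF this, of 0] show ?thesis unfolding derived_rep_def by simp
qed

lemma derived_rep_add:
  assumes "x \<in> SV" "y \<in> SV"
  shows "derived_rep U X (x + y) = derived_rep U X x + derived_rep U X y"
proof -
  have "((\<lambda>p. U (jacobi_chart p) (x + y)) has_derivative (\<lambda>X. derived_rep U X x + derived_rep U X y)) (at 0)"
    unfolding U_add[OF chart_group]
    by (intro has_derivative_add has_derivative_orbit assms)
  from has_derivative_unique[OF this has_derivative_orbit[OF SV_add[OF assms]]] show ?thesis
    by metis
qed

lemma derived_rep_scaleC:
  assumes "x \<in> SV"
  shows "derived_rep U X (c *\<^sub>C x) = c *\<^sub>C derived_rep U X x"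
proof -
  have "((\<lambda>p. U (jacobi_chart p) (c *\<^sub>C x)) has_derivative (\<lambda>X. c *\<^sub>C derived_rep U X x)) (at 0)"
    unfolding U_scaleC[OF chart_group]
    by (intro bounded_linear.has_derivative[OF bounded_linear_scaleC_right] has_derivative_orbit assms)
  from has_derivative_unique[OF this has_derivative_orbit[OF SV_scaleC[OF assms]]] show ?thesis
    by metis
qed

lemma derived_rep_linear:
  assumes "x \<in> SV"
  shows "derived_rep U (X + Y) x = derived_rep U X x + derived_rep U Y x"
    and "derived_rep U (r *\<^sub>R X) x = r *\<^sub>R derived_rep U X x"
  by (rule linear_add[OF has_derivative_linear[OF has_derivative_orbit[OF assms]]],
      rule linear_scale[OF has_derivative_linear[OF has_derivative_orbit[OF assms]]])

lemma op_add:
  assumes "x \<in> SV" "y \<in> SV"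
  shows "oA (x + y) = oA x + oA y" "oa (x + y) = oa x + oa y" "oK0 (x + y) = oK0 x + oK0 y"
    "oKp (x + y) = oKp x + oKp y" "oKm (x + y) = oKm x + oKm y"
  by (simp_all add: op_ad_def op_a_def op_K0_def op_Kp_def op_Km_def derived_rep_add[OF assms]
      scaleC_add_right scaleC_diff_right)

lemma op_scaleC:
  assumes "x \<in> SV"
  shows "oA (c *\<^sub>C x) = c *\<^sub>C oA x" "oa (c *\<^sub>C x) = c *\<^sub>C oa x" "oK0 (c *\<^sub>C x) = c *\<^sub>C oK0 x"
    "oKp (c *\<^sub>C x) = c *\<^sub>C oKp x" "oKm (c *\<^sub>C x) = c *\<^sub>C oKm x"
  by (simp_all add: op_ad_def op_a_def op_K0_def op_Kp_def op_Km_def derived_rep_scaleC[OF assms]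
      scaleC_add_right scaleC_diff_right scaleC_scaleC mult_ac)

text \<open>\<beta> enters real-linearly; splitting into complex-linear and antilinear parts undoes
  the complexification and brings back a^+ and a.\<close>

lemma derived_rep_heis:
  assumes "x \<in> SV"
  shows "derived_rep U (0, 0, \<beta>, 0) x = \<beta> *\<^sub>C oA x - cnj \<beta> *\<^sub>C oa x"
proof -
  have "(0, 0, \<beta>, 0) = Re \<beta> *\<^sub>R (0 :: real, 0 :: complex, 1 :: complex, 0 :: real) + Im \<beta> *\<^sub>R (0, 0, \<i>, 0)"
    by (simp add: complex_eq_iff)
  then have "derived_rep U (0, 0, \<beta>, 0) x
      = Re \<beta> *\<^sub>R derived_rep U (0, 0, 1, 0) x + Im \<beta> *\<^sub>R derived_rep U (0, 0, \<i>, 0) x"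
    by (simp only: derived_rep_linear[OF assms])
  also have "\<dots> = ((\<beta> + cnj \<beta>) / 2) *\<^sub>C derived_rep U (0, 0, 1, 0) x
      + (- \<i> * (\<beta> - cnj \<beta>) / 2) *\<^sub>C derived_rep U (0, 0, \<i>, 0) x"
    by (simp add: complex_add_cnj complex_diff_cnj algebra_simps flip: scaleC_of_real)
  finally show ?thesis
    by (simp add: op_ad_def op_a_def scaleC_add_right scaleC_diff_right scaleC_scaleC
        scaleC_add_left scaleC_diff_left add_divide_distrib diff_divide_distrib algebra_simps
        scaleC_minus_left scaleC_minus_right)
qed

lemma derived_rep_su:
  assumes "x \<in> SV"
  shows "derived_rep U (0, \<beta>, 0, 0) x = \<beta> *\<^sub>C oKp x - cnj \<beta> *\<^sub>C oKm x"
proof -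
  have "(0, \<beta>, 0, 0) = Re \<beta> *\<^sub>R (0 :: real, 1 :: complex, 0 :: complex, 0 :: real) + Im \<beta> *\<^sub>R (0, \<i>, 0, 0)"
    by (simp add: complex_eq_iff)
  then have "derived_rep U (0, \<beta>, 0, 0) x
      = Re \<beta> *\<^sub>R derived_rep U (0, 1, 0, 0) x + Im \<beta> *\<^sub>R derived_rep U (0, \<i>, 0, 0) x"
    by (simp only: derived_rep_linear[OF assms])
  also have "\<dots> = ((\<beta> + cnj \<beta>) / 2) *\<^sub>C derived_rep U (0, 1, 0, 0) x
      + (- \<i> * (\<beta> - cnj \<beta>) / 2) *\<^sub>C derived_rep U (0, \<i>, 0, 0) x"
    by (simp add: complex_add_cnj complex_diff_cnj algebra_simps flip: scaleC_of_real)
  finally show ?thesis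
    by (simp add: op_Kp_def op_Km_def scaleC_add_right scaleC_diff_right scaleC_scaleC
        scaleC_add_left scaleC_diff_left add_divide_distrib diff_divide_distrib algebra_simps
        scaleC_minus_left scaleC_minus_right)
qed

lemma derived_rep_K0: "derived_rep U (1, 0, 0, 0) x = (2 * \<i>) *\<^sub>C oK0 x"
  by (simp add: op_K0_def scaleC_scaleC)

lemma SV_op [intro, simp]:
  assumes "x \<in> SV"
  shows "oA x \<in> SV" "oa x \<in> SV" "oK0 x \<in> SV" "oKp x \<in> SV" "oKm x \<in> SV"
  using relations assms by (simp_all add: jacobi_relations_def Let_def)

lemma rel:
  assumes "x \<in> SV"
  shows "derived_rep U (0, 0, 0, 1) x = \<i> *\<^sub>C x"
    and "oa (oA x) = oA (oa x) + x" and "oK0 (oKp x) = oKp (oK0 x) + oKp x"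
    and "oKm (oKp x) = oKp (oKm x) + 2 *\<^sub>C oK0 x" and "oa (oKp x) = oKp (oa x) + oA x"
    and "oKm (oA x) = oA (oKm x) + oa x" and "oKp (oA x) = oA (oKp x)"
    and "oKm (oa x) = oa (oKm x)" and "oK0 (oA x) = oA (oK0 x) + (1 / 2) *\<^sub>C oA x"
  using relations assms by (simp_all add: jacobi_relations_def Let_def algebra_simps)

lemma adj:
  assumes "x \<in> SV" "y \<in> SV"
  shows "cinner (oA x) y = cinner x (oa y)" "cinner (oKp x) y = cinner x (oKm y)"
  using relations assms by (simp_all add: jacobi_relations_def Let_def)

lemma op_zero: "oA 0 = 0" "oa 0 = 0" "oKp 0 = 0" "oKm 0 = 0"
  using op_scaleC[OF e0_smooth, of 0] by simp_all

lemma op_sum: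
  assumes "\<And>i. i \<in> I \<Longrightarrow> f i \<in> SV"
  shows "oA (sum f I) = (\<Sum>i\<in>I. oA (f i))" "oa (sum f I) = (\<Sum>i\<in>I. oa (f i))"
    "oKp (sum f I) = (\<Sum>i\<in>I. oKp (f i))" "oKm (sum f I) = (\<Sum>i\<in>I. oKm (f i))"
  using assms
proof (induction I rule: infinite_finite_induct)
  case (insert x F)
  case 1
  have "f x \<in> SV" "sum f F \<in> SV" using 1 by auto
  then show ?case using insert 1 by (simp add: op_add)
next
  case (insert x F)
  case 2
  have "f x \<in> SV" "sum f F \<in> SV" using 2 by auto
  then show ?case using insert 2 by (simp add: op_add)
next
  case (insert x F)
  case 3
  have "f x \<in> SV" "sum f F \<in> SV" using 3 by auto
  then show ?case using insert 3 by (simp add: op_add)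
next
  case (insert x F)
  case 4
  have "f x \<in> SV" "sum f F \<in> SV" using 4 by auto
  then show ?case using insert 4 by (simp add: op_add)
qed (simp_all add: op_zero)

section \<open>Ladder relations and norms for powers of a^+, K_+ and K'_+\<close>

lemma SV_B [intro, simp]: "x \<in> SV \<Longrightarrow> oB x \<in> SV"
  by (auto simp: op_Kp'_def)

lemma Kp_eq_B: "oKp x = oB x + (1 / 2) *\<^sub>C oA (oA x)"
  by (simp add: op_Kp'_def)

lemma op_diff:
  assumes "x \<in> SV" "y \<in> SV"
  shows "oA (x - y) = oA x - oA y" "oa (x - y) = oa x - oa y" "oK0 (x - y) = oK0 x - oK0 y"
    "oKp (x - y) = oKp x - oKp y" "oKm (x - y) = oKm x - oKm y"
proof -
  have y: "(- 1) *\<^sub>C y \<in> SV" using assms(2) by auto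
  show "oA (x - y) = oA x - oA y" "oa (x - y) = oa x - oa y" "oK0 (x - y) = oK0 x - oK0 y"
    "oKp (x - y) = oKp x - oKp y" "oKm (x - y) = oKm x - oKm y"
    using op_add[OF assms(1) y] op_scaleC[OF assms(2), of "- 1"] by (simp_all add: scaleC_minus_left)
qed

text \<open>The correction -(a^+)^2/2 removes exactly the commutator [a, K_+] = a^+. So K'_+
  decouples from the oscillator, while still raising the K_0 eigenvalue by one.\<close>

lemma B_rel:
  assumes "x \<in> SV"
  shows "oa (oB x) = oB (oa x)" "oA (oB x) = oB (oA x)" "oK0 (oB x) = oB (oK0 x) + oB x"
proof -
  note s = assms SV_scaleC[of "oA (oA x)" "1 / 2"]
  show "oa (oB x) = oB (oa x)"
    using s unfolding op_Kp'_def
    by (simp add: op_diff op_scaleC rel op_add scaleC_add_right)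
      (simp add: algebra_simps flip: scaleC_add_left)
  show "oA (oB x) = oB (oA x)"
    using s unfolding op_Kp'_def by (simp add: op_diff op_scaleC rel)
  show "oK0 (oB x) = oB (oK0 x) + oB x"
    using s unfolding op_Kp'_def
    by (simp add: op_diff op_scaleC rel op_add scaleC_add_right SV_scaleC)
      (simp add: algebra_simps flip: scaleC_add_left)
qed

lemma SV_pow [intro, simp]:
  assumes "x \<in> SV"
  shows "(oA ^^ n) x \<in> SV" "(oB ^^ n) x \<in> SV" "(oKp ^^ n) x \<in> SV"
  by (induction n) (auto simp: assms)

lemma A_Kp_pow: "x \<in> SV \<Longrightarrow> oA ((oKp ^^ n) x) = (oKp ^^ n) (oA x)"
  by (induction n) (simp_all add: rel(7)[symmetric])

lemma Kp_A_pow: "x \<in> SV \<Longrightarrow> oKp ((oA ^^ n) x) = (oA ^^ n) (oKp x)"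
  by (induction n) (simp_all add: rel(7))

lemma a_A_pow:
  assumes "x \<in> SV"
  shows "oa ((oA ^^ Suc n) x) = (oA ^^ Suc n) (oa x) + of_nat (Suc n) *\<^sub>C (oA ^^ n) x"
proof (induction n)
  case 0
  then show ?case using assms by (simp add: rel)
next
  case (Suc n)
  have "oa ((oA ^^ Suc (Suc n)) x) = oA (oa ((oA ^^ Suc n) x)) + (oA ^^ Suc n) x"
    using assms SV_pow(1)[OF assms, of "Suc n"] unfolding funpow.simps(2)[of "Suc n"] o_apply
    by (simp only: rel(2))
  also have "oA (oa ((oA ^^ Suc n) x)) = oA ((oA ^^ Suc n) (oa x)) + of_nat (Suc n) *\<^sub>C oA ((oA ^^ n) x)"
    unfolding Suc using assms by (simp add: op_add op_scaleC SV_scaleC del: funpow.simps of_nat_Suc)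
  finally show ?case
    by (simp add: scaleC_of_nat_Suc[of "Suc n"] add.assoc del: of_nat_Suc)
qed

lemma a_Kp_pow: "oa ((oKp ^^ Suc n) e0) = of_nat (Suc n) *\<^sub>C oA ((oKp ^^ n) e0)"
proof (induction n)
  case 0
  then show ?case using e0_smooth by (simp add: rel e0_lowest op_zero)
next
  case (Suc n)
  have s: "(oKp ^^ Suc n) e0 \<in> SV" "(oKp ^^ n) e0 \<in> SV" using e0_smooth by (simp_all del: funpow.simps)
  have "oa ((oKp ^^ Suc (Suc n)) e0) = oKp (oa ((oKp ^^ Suc n) e0)) + oA ((oKp ^^ Suc n) e0)"
    unfolding funpow.simps(2)[of "Suc n"] o_apply using s by (simp only: rel(5))
  also have "oKp (oa ((oKp ^^ Suc n) e0)) = of_nat (Suc n) *\<^sub>C oA ((oKp ^^ Suc n) e0)"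
    unfolding Suc using s by (simp add: op_scaleC rel(7) del: of_nat_Suc)
  finally show ?case by (simp add: scaleC_of_nat_Suc[of "Suc n"] del: of_nat_Suc)
qed

lemma a_A_Kp_pow:
  "oa ((oA ^^ i) ((oKp ^^ j) e0)) =
    of_nat i *\<^sub>C (oA ^^ (i - 1)) ((oKp ^^ j) e0) + of_nat j *\<^sub>C (oA ^^ Suc i) ((oKp ^^ (j - 1)) e0)"
proof -
  have s: "(oKp ^^ j) e0 \<in> SV" using e0_smooth by simp
  have 1: "oa ((oKp ^^ j) e0) = of_nat j *\<^sub>C oA ((oKp ^^ (j - 1)) e0)"
    by (cases j) (use a_Kp_pow e0_lowest in \<open>simp_all del: funpow.simps(2) of_nat_Suc\<close>)
  have lin: "(oA ^^ n) (c *\<^sub>C x) = c *\<^sub>C (oA ^^ n) x" if "x \<in> SV" for n c x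
    by (induction n) (use that in \<open>simp_all add: op_scaleC\<close>)
  show ?thesis
  proof (cases i)
    case 0
    then show ?thesis using 1 by simp
  next
    case (Suc n)
    have "(oA ^^ Suc n) (oa ((oKp ^^ j) e0)) = of_nat j *\<^sub>C (oA ^^ Suc n) (oA ((oKp ^^ (j - 1)) e0))"
      unfolding 1 by (rule lin) (use e0_smooth in simp)
    then show ?thesis
      unfolding Suc a_A_pow[OF s] by (simp add: funpow_swap1 add.commute)
  qed
qed

text \<open>Each exchange of K_- with K_+ produces 2 K_0, with value 2(k + i) on K_+^i e_0. Summing
  over 0 \<le> i \<le> n gives (n + 1)(2k + n).\<close>

lemma Km_Kp_pow: "oKm ((oKp ^^ Suc n) e0) = (of_nat (Suc n) * (2 * of_real k + of_nat n)) *\<^sub>C (oKp ^^ n) e0"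
  and K0_Kp_pow: "oK0 ((oKp ^^ n) e0) = (of_real k + of_nat n) *\<^sub>C (oKp ^^ n) e0"
proof -
  show K0: "oK0 ((oKp ^^ n) e0) = (of_real k + of_nat n) *\<^sub>C (oKp ^^ n) e0" for n
  proof (induction n)
    case (Suc n)
    have s: "(oKp ^^ n) e0 \<in> SV" using e0_smooth by simp
    have "oK0 ((oKp ^^ Suc n) e0) = oKp (oK0 ((oKp ^^ n) e0)) + oKp ((oKp ^^ n) e0)"
      using s by (simp add: rel)
    then show ?case
      unfolding Suc op_scaleC[OF s] by (simp add: scaleC_add_left add_ac)
  qed (simp add: e0_lowest)
  show "oKm ((oKp ^^ Suc n) e0) = (of_nat (Suc n) * (2 * of_real k + of_nat n)) *\<^sub>C (oKp ^^ n) e0"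
  proof (induction n)
    case 0
    then show ?case using e0_smooth by (simp add: rel e0_lowest op_zero scaleC_scaleC)
  next
    case (Suc n)
    have s: "(oKp ^^ Suc n) e0 \<in> SV" "(oKp ^^ n) e0 \<in> SV" using e0_smooth by (simp_all del: funpow.simps)
    have "oKm ((oKp ^^ Suc (Suc n)) e0) = oKp (oKm ((oKp ^^ Suc n) e0)) + 2 *\<^sub>C oK0 ((oKp ^^ Suc n) e0)"
      unfolding funpow.simps(2)[of "Suc n"] o_apply using s by (simp only: rel(4))
    also have "\<dots> = ((of_nat (Suc n) * (2 * of_real k + of_nat n)) + 2 * (of_real k + of_nat (Suc n))) *\<^sub>C (oKp ^^ Suc n) e0"
      unfolding Suc K0 using s by (simp add: op_scaleC scaleC_scaleC scaleC_add_left scaleC_add_right del: of_nat_Suc)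
    also have "(of_nat (Suc n) * (2 * of_real k + of_nat n)) + 2 * (of_real k + of_nat (Suc n))
      = of_nat (Suc (Suc n)) * (2 * complex_of_real k + of_nat (Suc n))"
      by (simp add: algebra_simps)
    finally show ?case .
  qed
qed

lemma a_B_pow: "oa ((oB ^^ m) e0) = 0"
  by (induction m) (use e0_smooth e0_lowest in \<open>simp_all add: B_rel\<close>, simp add: op_Kp'_def op_zero)

lemma K0_B_pow: "oK0 ((oB ^^ m) e0) = (of_real k + of_nat m) *\<^sub>C (oB ^^ m) e0"
proof (induction m)
  case (Suc m)
  have s: "(oB ^^ m) e0 \<in> SV" using e0_smooth by simp
  have lin: "oB (c *\<^sub>C (oB ^^ m) e0) = c *\<^sub>C oB ((oB ^^ m) e0)" for c
    using s by (simp add: op_Kp'_def op_scaleC scaleC_diff_right scaleC_scaleC mult.commute)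
  have "oK0 ((oB ^^ Suc m) e0) = oB ((of_real k + of_nat m) *\<^sub>C (oB ^^ m) e0) + oB ((oB ^^ m) e0)"
    using s Suc by (simp add: B_rel)
  then show ?case
    unfolding lin by (simp add: scaleC_add_left add_ac)
qed (simp add: e0_lowest)

text \<open>The commutator of K_- with (a^+)^2/2 is a^+ a + 1/2, which is 1/2 on the kernel of a.
  Subtracting this zero-point value from 2 K_0 is what shifts k to k' = k - 1/4.\<close>

lemma Km_B:
  assumes "x \<in> SV" "oa x = 0"
  shows "oKm (oB x) = oB (oKm x) + 2 *\<^sub>C oK0 x - (1 / 2) *\<^sub>C x"
proof -
  have s: "oA x \<in> SV" "oA (oA x) \<in> SV" using assms by auto
  have "oKm (oA (oA x)) = oA (oA (oKm x)) + x"
    using s assms by (simp add: rel op_add op_zero)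
  then show ?thesis
    using s assms unfolding op_Kp'_def
    by (simp add: op_diff op_scaleC rel SV_scaleC scaleC_add_right)
qed

lemma Km_B_pow: "oKm ((oB ^^ Suc m) e0) = (of_nat (Suc m) * (2 * of_real k' + of_nat m)) *\<^sub>C (oB ^^ m) e0"
proof (induction m)
  have c: "2 * complex_of_real k - 1 / 2 = 2 * of_real k'"
    using arg_cong[OF k', of complex_of_real] by (simp add: algebra_simps)
  case 0
  have "oKm (oB e0) = (2 * complex_of_real k - 1 / 2) *\<^sub>C e0"
    using e0_smooth Km_B[OF e0_smooth] e0_lowest
    by (simp add: scaleC_diff_left scaleC_scaleC op_Kp'_def op_zero)
  then show ?case by (simp add: c)
next
  case (Suc m)
  have c: "2 * complex_of_real k - 1 / 2 = 2 * of_real k'"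
    using arg_cong[OF k', of complex_of_real] by (simp add: algebra_simps)
  have s: "(oB ^^ m) e0 \<in> SV" "(oB ^^ Suc m) e0 \<in> SV" using e0_smooth by (simp_all del: funpow.simps)
  have B: "oB (c *\<^sub>C (oB ^^ m) e0) = c *\<^sub>C (oB ^^ Suc m) e0" for c
    using s by (simp add: op_Kp'_def op_scaleC scaleC_diff_right scaleC_scaleC mult.commute)
  have "oKm ((oB ^^ Suc (Suc m)) e0) = oB (oKm ((oB ^^ Suc m) e0)) + 2 *\<^sub>C oK0 ((oB ^^ Suc m) e0)
      - (1 / 2) *\<^sub>C (oB ^^ Suc m) e0"
    unfolding funpow.simps(2)[of "Suc m"] o_apply by (rule Km_B[OF s(2) a_B_pow])
  also have "\<dots> = (of_nat (Suc m) * (2 * of_real k' + of_nat m) + 2 * (of_real k + of_nat (Suc m)) - 1 / 2)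
      *\<^sub>C (oB ^^ Suc m) e0"
    unfolding Suc B K0_B_pow
    by (simp add: scaleC_scaleC scaleC_add_left scaleC_add_right scaleC_diff_left del: of_nat_Suc funpow.simps)
  also have "of_nat (Suc m) * (2 * complex_of_real k' + of_nat m) + 2 * (of_real k + of_nat (Suc m)) - 1 / 2
    = of_nat (Suc (Suc m)) * (2 * complex_of_real k' + of_nat (Suc m))"
    using c by (simp add: algebra_simps)
  finally show ?case .
qed

text \<open>The adjoint of K'_+ is K_- - a^2/2, and this is K_- on the kernel of a.\<close>

lemma cinner_B:
  assumes "x \<in> SV" "y \<in> SV" "oa y = 0"
  shows "cinner (oB x) y = cinner x (oKm y)"
  using assms unfolding op_Kp'_def
  by (simp add: cinner_diff_left cinner_scaleC_left adj op_zero)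

lemma cinner_B_pow:
  "cinner ((oB ^^ m) e0) ((oB ^^ n) e0) = (if m = n then fact m * pochhammer (2 * of_real k') m else 0)"
proof (induction m arbitrary: n)
  case 0
  show ?case
  proof (cases n)
    case (Suc n')
    have "cinner ((oB ^^ n) e0) e0 = 0"
      using e0_smooth e0_lowest Suc by (simp add: cinner_B)
    then show ?thesis using Suc by (metis cinner_commute complex_cnj_zero funpow_0 nat.distinct(1))
  qed (simp add: e0_unit)
next
  case (Suc m)
  have s: "(oB ^^ i) e0 \<in> SV" for i using e0_smooth by simp
  have 1: "cinner ((oB ^^ Suc m) e0) ((oB ^^ n) e0) = cinner ((oB ^^ m) e0) (oKm ((oB ^^ n) e0))"
    using cinner_B[OF s s a_B_pow] by simp
  show ?case
  proof (cases n)
    case 0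
    then show ?thesis unfolding 1 using e0_lowest by simp
  next
    case (Suc n')
    show ?thesis
      unfolding 1 unfolding Suc Km_B_pow cinner_scaleC_right Suc.IH
      by (simp add: pochhammer_Suc algebra_simps)
  qed
qed

text \<open>The oscillator and K'_+ contribute independently. These values are the origin of the
  normalization in \<open>basis_vec\<close>, and they control the convergence of the coherent
  series.\<close>

lemma norm_A_B_pow: "(norm ((oA ^^ n) ((oB ^^ m) e0)))\<^sup>2 = fact n * (fact m * pochhammer (2 * k') m)"
proof -
  have s: "(oB ^^ m) e0 \<in> SV" using e0_smooth by simp
  have "cinner ((oA ^^ n) ((oB ^^ m) e0)) ((oA ^^ n) ((oB ^^ m) e0))
    = fact n * (fact m * pochhammer (2 * of_real k') m)"
  proof (induction n)
    case (Suc n)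
    have z: "(oA ^^ i) 0 = 0" for i by (induction i) (simp_all add: op_zero)
    have "cinner ((oA ^^ Suc n) ((oB ^^ m) e0)) ((oA ^^ Suc n) ((oB ^^ m) e0))
      = cinner ((oA ^^ n) ((oB ^^ m) e0)) (oa ((oA ^^ Suc n) ((oB ^^ m) e0)))"
      unfolding funpow.simps(2) o_apply by (rule adj(1)) (use s in auto)
    also have "\<dots> = of_nat (Suc n) * (fact n * (fact m * pochhammer (2 * of_real k') m))"
      unfolding a_A_pow[OF s] a_B_pow z cinner_scaleC_right add_0 Suc ..
    finally show ?case by (simp add: algebra_simps)
  qed (simp add: cinner_B_pow)
  also have "\<dots> = of_real (fact n * (fact m * pochhammer (2 * k') m))"
    by (simp flip: pochhammer_of_real)
  finally show ?thesis unfolding cinner_self using of_real_eq_iff by blast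
qed

end

subsection \<open>Vector-valued exponential series in two variables\<close>

text \<open>Divided powers: differentiation becomes an index shift, with 0 as the derivative at
  index 0 (\<open>epow'\<close>).\<close>

definition epow :: "nat \<Rightarrow> complex \<Rightarrow> complex" where
  "epow i z = z ^ i / fact i"

definition epow' :: "nat \<Rightarrow> complex \<Rightarrow> complex" where
  "epow' i z = (case i of 0 \<Rightarrow> 0 | Suc n \<Rightarrow> epow n z)"

lemma epow_0 [simp]: "epow 0 z = 1" and epow'_0 [simp]: "epow' 0 z = 0"
  and epow'_Suc [simp]: "epow' (Suc n) z = epow n z"
  by (simp_all add: epow_def epow'_def)

lemma of_nat_epow: "of_nat i * epow i z = z * epow' i z"
  by (cases i) (simp_all add: epow_def fact_Suc del: of_nat_Suc)

lemma has_field_derivative_epow: "(epow i has_field_derivative epow' i z) (at z)"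
proof (cases i)
  case (Suc n)
  have "((\<lambda>z. z ^ Suc n / fact (Suc n)) has_field_derivative (of_nat (Suc n) * z ^ n / fact (Suc n))) (at z)"
    using DERIV_cdivide[OF DERIV_power[OF DERIV_ident, of "Suc n" z UNIV], of "fact (Suc n)"]
    by (simp del: power_Suc of_nat_Suc fact_Suc)
  then show ?thesis
    unfolding Suc by (simp add: epow_def[abs_def] del: of_nat_Suc)
qed (simp add: epow_def[abs_def])

text \<open>The homogeneous part of total degree \<open>N\<close>, which is how the exponential
  series groups its terms. The coefficient \<open>v i j\<close> stands for (a^+)^i K_+^j e_0 and for
  the images of this family under operators.\<close>

definition pseries :: "(nat \<Rightarrow> nat \<Rightarrow> 'h::complex_hilbert) \<Rightarrow> nat \<Rightarrow> C2 \<Rightarrow> 'h" where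
  "pseries v N p = (\<Sum>i\<le>N. (epow i (fst p) * epow (N - i) (snd p)) *\<^sub>C v i (N - i))"

definition psum :: "(nat \<Rightarrow> nat \<Rightarrow> 'h::complex_hilbert) \<Rightarrow> C2 \<Rightarrow> 'h" where
  "psum v p = (\<Sum>N. pseries v N p)"

abbreviation (input) shift1 :: "(nat \<Rightarrow> nat \<Rightarrow> 'h) \<Rightarrow> nat \<Rightarrow> nat \<Rightarrow> 'h" where
  "shift1 v \<equiv> (\<lambda>i j. v (Suc i) j)"

abbreviation (input) shift2 :: "(nat \<Rightarrow> nat \<Rightarrow> 'h) \<Rightarrow> nat \<Rightarrow> nat \<Rightarrow> 'h" where
  "shift2 v \<equiv> (\<lambda>i j. v i (Suc j))"

lemma shift_sum1:
  fixes v :: "nat \<Rightarrow> nat \<Rightarrow> 'h::complex_hilbert"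
  shows "(\<Sum>i\<le>Suc N. (epow' i (fst p) * epow (Suc N - i) (snd p)) *\<^sub>C v i (Suc N - i)) = pseries (shift1 v) N p"
  unfolding sum.atMost_Suc_shift pseries_def by simp

lemma shift_sum2:
  fixes v :: "nat \<Rightarrow> nat \<Rightarrow> 'h::complex_hilbert"
  shows "(\<Sum>i\<le>Suc N. (epow i (fst p) * epow' (Suc N - i) (snd p)) *\<^sub>C v i (Suc N - i)) = pseries (shift2 v) N p"
proof -
  have "(\<Sum>i\<le>N. (epow i (fst p) * epow' (Suc N - i) (snd p)) *\<^sub>C v i (Suc N - i)) = pseries (shift2 v) N p"
    unfolding pseries_def by (rule sum.cong) (simp_all add: Suc_diff_le)
  then show ?thesis unfolding sum.atMost_Suc by simp
qed

text \<open>Euler's identity for homogeneous polynomials, with differentiation expressed by shifted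
  coefficients. It is the recursion that generates the exponential series.\<close>

lemma pseries_euler:
  "of_nat (Suc N) *\<^sub>C pseries v (Suc N) p
    = fst p *\<^sub>C pseries (shift1 v) N p + snd p *\<^sub>C pseries (shift2 v) N p"
proof -
  have c: "of_nat (Suc N) * (epow i (fst p) * epow (Suc N - i) (snd p))
    = fst p * (epow' i (fst p) * epow (Suc N - i) (snd p)) + snd p * (epow i (fst p) * epow' (Suc N - i) (snd p))"
    if "i \<le> Suc N" for i
  proof -
    have "of_nat (Suc N) = (of_nat i + of_nat (Suc N - i) :: complex)"
      using that by (simp flip: of_nat_add)
    then have "of_nat (Suc N) * (epow i (fst p) * epow (Suc N - i) (snd p))
      = (of_nat i * epow i (fst p)) * epow (Suc N - i) (snd p) + epow i (fst p) * (of_nat (Suc N - i) * epow (Suc N - i) (snd p))"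
      by (simp only: ring_distribs mult_ac)
    then show ?thesis unfolding of_nat_epow by (simp only: mult_ac)
  qed
  have "of_nat (Suc N) *\<^sub>C pseries v (Suc N) p = (\<Sum>i\<le>Suc N.
      fst p *\<^sub>C (epow' i (fst p) * epow (Suc N - i) (snd p)) *\<^sub>C v i (Suc N - i)
      + snd p *\<^sub>C (epow i (fst p) * epow' (Suc N - i) (snd p)) *\<^sub>C v i (Suc N - i))"
    unfolding pseries_def scaleC_sum_right scaleC_scaleC
    by (intro sum.cong refl) (simp only: c scaleC_add_left atMost_iff)
  then show ?thesis
    by (simp only: sum.distrib scaleC_sum_right[symmetric] shift_sum1 shift_sum2)
qed

section \<open>Termwise differentiation under a growth condition\<close>

lemma has_derivative_pseries:
  "(pseries v (Suc N) has_derivative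
    (\<lambda>u. fst u *\<^sub>C pseries (shift1 v) N p + snd u *\<^sub>C pseries (shift2 v) N p)) (at p)"
proof -
  have d: "((\<lambda>p. (epow i (fst p) * epow (Suc N - i) (snd p)) *\<^sub>C v i (Suc N - i)) has_derivative
    (\<lambda>u. fst u *\<^sub>C (epow' i (fst p) * epow (Suc N - i) (snd p)) *\<^sub>C v i (Suc N - i)
      + snd u *\<^sub>C (epow i (fst p) * epow' (Suc N - i) (snd p)) *\<^sub>C v i (Suc N - i))) (at p)" for i
  proof -
    have e: "((\<lambda>p. epow n (f p)) has_derivative (\<lambda>u. epow' n (f p) * f u)) (at p)"
      if "bounded_linear f" for n and f :: "C2 \<Rightarrow> complex"
      using has_derivative_compose[OF bounded_linear_imp_has_derivative[OF that]
          has_field_derivative_epow[unfolded has_field_derivative_def]] by simp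
    show ?thesis
      by (rule has_derivative_eq_rhs[OF bounded_linear.has_derivative[OF bounded_linear_scaleC_left
            has_derivative_mult[OF e[OF bounded_linear_fst] e[OF bounded_linear_snd]]]])
        (simp add: fun_eq_iff scaleC_add_left scaleC_scaleC mult_ac add_ac)
  qed
  have "(pseries v (Suc N) has_derivative (\<lambda>u. \<Sum>i\<le>Suc N.
      fst u *\<^sub>C (epow' i (fst p) * epow (Suc N - i) (snd p)) *\<^sub>C v i (Suc N - i)
      + snd u *\<^sub>C (epow i (fst p) * epow' (Suc N - i) (snd p)) *\<^sub>C v i (Suc N - i))) (at p)"
    unfolding pseries_def[abs_def] by (rule has_derivative_sum) (rule d)
  then show ?thesis
    by (simp only: sum.distrib scaleC_sum_right[symmetric] shift_sum1 shift_sum2)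
qed

text \<open>\<open>X\<close> may be arbitrarily small because z ranges over the whole plane,
  \<open>Y\<close> only arbitrarily close to 1 because |w| < 1. Quantifying over both makes the
  class stable under index shifts, hence under differentiation of the series.\<close>

definition moderate :: "(nat \<Rightarrow> nat \<Rightarrow> 'h::complex_hilbert) \<Rightarrow> bool" where
  "moderate v \<longleftrightarrow> (\<forall>X>0. \<forall>Y>1. \<exists>C. \<forall>i j. norm (v i j) \<le> C * (fact i * fact j * X ^ i * Y ^ j))"

lemma summable_Suc_geometric: "0 \<le> t \<Longrightarrow> t < 1 \<Longrightarrow> summable (\<lambda>n. real (Suc n) * t ^ n)"
  using geometric_deriv_sums[of t] by (auto intro: sums_summable)

lemma Suc_geometric_bounded:
  assumes "0 \<le> t" "t < (1::real)"
  obtains C where "C \<ge> 0" "\<And>n. real (Suc n) * t ^ n \<le> C"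
proof -
  obtain C where "\<And>n. norm (real (Suc n) * t ^ n) \<le> C"
    using summable_imp_Bseq[OF summable_Suc_geometric[OF assms]] unfolding Bseq_def by blast
  note C = this
  have "real (Suc n) * t ^ n \<le> C" for n using C[of n] by (metis abs_le_D1 real_norm_def)
  moreover have "C \<ge> 0" using C[of 0] by simp
  ultimately show ?thesis using that[of C] by blast
qed

lemma moderateI:
  assumes "\<And>X Y. X > 0 \<Longrightarrow> Y > 1 \<Longrightarrow> \<exists>C. \<forall>i j. norm (v i j) \<le> C * (fact i * fact (Suc j) * X ^ i * Y ^ j)"
  shows "moderate v"
  unfolding moderate_def
proof (intro allI impI)
  fix X Y :: real assume XY: "X > 0" "Y > 1"
  \<comment> \<open>The room between 1 and \<open>Y\<close> is split into two factors
    \<open>q\<close>: one carries the hypothesis, the other absorbs the surplus factor j +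
    1.\<close>
  define q where "q = sqrt Y"
  have q: "q > 1" "Y = q * q" using XY by (simp_all add: q_def)
  obtain C where C: "\<And>i j. norm (v i j) \<le> C * (fact i * fact (Suc j) * X ^ i * q ^ j)"
    using assms[OF XY(1) q(1)] by blast
  have "0 \<le> C" using order.trans[OF norm_ge_zero C[of 0 0]] by simp
  obtain C' where C': "C' \<ge> 0" "\<And>n. real (Suc n) * (1 / q) ^ n \<le> C'"
    by (rule Suc_geometric_bounded[of "1 / q"]) (use q in auto)
  have "norm (v i j) \<le> C * C' * (fact i * fact j * X ^ i * Y ^ j)" for i j
  proof -
    have "C * (fact i * fact (Suc j) * X ^ i * q ^ j)
        = C * (fact i * fact j * X ^ i * Y ^ j) * (real (Suc j) * (1 / q) ^ j)"
      using q by (simp add: power_mult_distrib power_divide)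
    also have "\<dots> \<le> C * (fact i * fact j * X ^ i * Y ^ j) * C'"
      using XY \<open>0 \<le> C\<close> by (intro mult_left_mono C') simp_all
    finally show ?thesis using C[of i j] by (simp add: mult_ac)
  qed
  then show "\<exists>C. \<forall>i j. norm (v i j) \<le> C * (fact i * fact j * X ^ i * Y ^ j)" by blast
qed

lemma moderate_shift2:
  assumes "moderate v"
  shows "moderate (shift2 v)"
proof (rule moderateI)
  fix X Y :: real assume "X > 0" "Y > 1"
  then obtain C where C: "\<And>i j. norm (v i j) \<le> C * (fact i * fact j * X ^ i * Y ^ j)"
    using assms unfolding moderate_def by blast
  show "\<exists>C. \<forall>i j. norm (v i (Suc j)) \<le> C * (fact i * fact (Suc j) * X ^ i * Y ^ j)"
    by (rule exI[of _ "C * Y"], intro allI) (use C[of _ "Suc _"] in \<open>simp only: power_Suc mult_ac\<close>)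
qed

text \<open>The surplus factor i + 1 is paid for by halving \<open>X\<close>, as i + 1 \<le> 2^(i +
  1).\<close>

lemma moderate_shift1:
  assumes "moderate v"
  shows "moderate (shift1 v)"
  unfolding moderate_def
proof (intro allI impI)
  fix X Y :: real assume XY: "X > 0" "Y > 1"
  then obtain C where C: "\<And>i j. norm (v i j) \<le> C * (fact i * fact j * (X / 2) ^ i * Y ^ j)"
    using assms unfolding moderate_def by (meson half_gt_zero)
  have "0 \<le> C" using order.trans[OF norm_ge_zero C[of 0 0]] by simp
  have "norm (v (Suc i) j) \<le> C * X * (fact i * fact j * X ^ i * Y ^ j)" for i j
  proof -
    have "real (Suc i) \<le> 2 ^ Suc i"
      by (metis of_nat_le_iff of_nat_numeral of_nat_power less_exp less_imp_le)
    then have le1: "real (Suc i) * (1 / 2) ^ Suc i \<le> 1"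
      by (simp add: power_divide del: of_nat_Suc power_Suc)
    have "C * (fact (Suc i) * fact j * (X / 2) ^ Suc i * Y ^ j)
        = C * X * (fact i * fact j * X ^ i * Y ^ j) * (real (Suc i) * (1 / 2) ^ Suc i)"
      by (simp add: power_divide)
    also have "\<dots> \<le> C * X * (fact i * fact j * X ^ i * Y ^ j) * 1"
      using XY \<open>0 \<le> C\<close> by (intro mult_left_mono le1) simp_all
    finally show ?thesis using C[of "Suc i" j] by simp
  qed
  then show "\<exists>C. \<forall>i j. norm (v (Suc i) j) \<le> C * (fact i * fact j * X ^ i * Y ^ j)" by blast
qed

lemma pseries_majorant:
  assumes "moderate v" "0 \<le> R" "0 \<le> r" "r < 1"
  obtains M :: "nat \<Rightarrow> real" where "summable M"
    "\<And>N p. cmod (fst p) \<le> R \<Longrightarrow> cmod (snd p) \<le> r \<Longrightarrow> norm (pseries v N p) \<le> M N"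
proof -
  \<comment> \<open>Chosen so that X R < 1 and Y r < 1. Degree N then has N + 1 terms, each of norm
    at most C t^N with t < 1.\<close>
  define X where "X = 1 / (2 * (R + 1))"
  define Y where "Y = 2 / (1 + r)"
  have X: "X > 0" "X * R < 1" using assms(2) by (simp_all add: X_def field_simps)
  have Y: "Y > 1" "Y * r < 1" using assms(3,4) by (simp_all add: Y_def field_simps)
  define t where "t = max (X * R) (Y * r)"
  have t: "0 \<le> t" "t < 1" "X * R \<le> t" "Y * r \<le> t" using X Y assms by (auto simp: t_def le_max_iff_disj)
  obtain C where C: "\<And>i j. norm (v i j) \<le> C * (fact i * fact j * X ^ i * Y ^ j)"
    using assms(1) X(1) Y(1) unfolding moderate_def by blast
  have "0 \<le> C" using order.trans[OF norm_ge_zero C[of 0 0]] by simp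
  show ?thesis
  proof (rule that[of "\<lambda>N. C * (real (Suc N) * t ^ N)"])
    show "summable (\<lambda>N. C * (real (Suc N) * t ^ N))"
      using summable_mult[OF summable_Suc_geometric[OF t(1,2)]] .
    fix N p assume p: "cmod (fst p) \<le> R" "cmod (snd p) \<le> r"
    have tm: "norm ((epow i (fst p) * epow (N - i) (snd p)) *\<^sub>C v i (N - i)) \<le> C * t ^ N"
      if "i \<le> N" for i
    proof -
      let ?j = "N - i"
      have "norm ((epow i (fst p) * epow ?j (snd p)) *\<^sub>C v i ?j)
        = cmod (fst p) ^ i / fact i * (cmod (snd p) ^ ?j / fact ?j) * norm (v i ?j)"
        by (simp add: norm_scaleC epow_def norm_mult norm_divide norm_power)
      also have "\<dots> \<le> R ^ i / fact i * (r ^ ?j / fact ?j) * (C * (fact i * fact ?j * X ^ i * Y ^ ?j))"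
      proof -
        have "cmod (fst p) ^ i / fact i * (cmod (snd p) ^ ?j / fact ?j) \<le> R ^ i / fact i * (r ^ ?j / fact ?j)"
          by (intro mult_mono divide_right_mono power_mono p) (simp_all add: assms)
        then show ?thesis by (rule mult_mono[OF _ C[of i ?j]]) (simp_all add: assms)
      qed
      also have "\<dots> = C * ((X * R) ^ i * (Y * r) ^ ?j)"
        by (simp add: power_mult_distrib)
      also have "\<dots> \<le> C * (t ^ i * t ^ ?j)"
        by (intro mult_left_mono mult_mono power_mono t) (use t X Y assms \<open>0 \<le> C\<close> in simp_all)
      also have "\<dots> = C * t ^ N" using that by (simp flip: power_add)
      finally show ?thesis .
    qed
    have "norm (pseries v N p) \<le> (\<Sum>i\<le>N. C * t ^ N)"
      unfolding pseries_def by (rule sum_norm_le) (use tm in simp)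
    then show "norm (pseries v N p) \<le> C * (real (Suc N) * t ^ N)" by (simp add: algebra_simps)
  qed
qed

lemma pseries_sums:
  assumes "moderate v" "p \<in> DJ"
  shows "(\<lambda>N. pseries v N p) sums psum v p"
proof -
  have p: "cmod (snd p) < 1" using assms(2) by (auto simp: DJ_def)
  obtain M where M: "summable M"
    "\<And>N q. cmod (fst q) \<le> cmod (fst p) \<Longrightarrow> cmod (snd q) \<le> cmod (snd p) \<Longrightarrow> norm (pseries v N q) \<le> M N"
    by (rule pseries_majorant[OF assms(1), of "cmod (fst p)" "cmod (snd p)"]) (use p in auto)
  have "summable (\<lambda>N. pseries v N p)"
    by (rule summable_comparison_test'[OF M(1)]) (use M(2) in auto)
  then show ?thesis unfolding psum_def by (rule summable_sums)
qed

text \<open>The degree 0 term is constant and gets derivative 0, so the partial sums of the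
  derivatives lag one index behind those of the shifted series.\<close>

definition dpseries :: "(nat \<Rightarrow> nat \<Rightarrow> 'h::complex_hilbert) \<Rightarrow> nat \<Rightarrow> C2 \<Rightarrow> C2 \<Rightarrow> 'h" where
  "dpseries v N q u = (case N of 0 \<Rightarrow> 0
     | Suc n \<Rightarrow> fst u *\<^sub>C pseries (shift1 v) n q + snd u *\<^sub>C pseries (shift2 v) n q)"

lemma dpseries_0: "dpseries v 0 q = (\<lambda>u. 0)"
  and dpseries_Suc: "dpseries v (Suc n) q
    = (\<lambda>u. fst u *\<^sub>C pseries (shift1 v) n q + snd u *\<^sub>C pseries (shift2 v) n q)"
  unfolding dpseries_def nat.case by (rule refl)+

definition dpsum :: "(nat \<Rightarrow> nat \<Rightarrow> 'h::complex_hilbert) \<Rightarrow> C2 \<Rightarrow> C2 \<Rightarrow> 'h" where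
  "dpsum v q = (\<lambda>u. fst u *\<^sub>C psum (shift1 v) q + snd u *\<^sub>C psum (shift2 v) q)"

text \<open>Both shifted series have summable majorants on a polydisc that is centred at the origin
  and contains p. The derivatives of the partial sums thus converge uniformly on a convex open
  set.\<close>

lemma has_derivative_psum:
  assumes v: "moderate v" and p: "p \<in> DJ"
  shows "(psum v has_derivative (\<lambda>u. fst u *\<^sub>C psum (shift1 v) p + snd u *\<^sub>C psum (shift2 v) p)) (at p)"
proof -
  define R where "R = cmod (fst p) + 1"
  define r where "r = (cmod (snd p) + 1) / 2"
  have sp: "cmod (snd p) < 1" using p by (auto simp: DJ_def)
  have r: "0 \<le> r" "r < 1" "cmod (snd p) < r" using sp by (simp_all add: r_def field_simps)
  have R: "0 \<le> R" "cmod (fst p) < R" by (simp_all add: R_def)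
  define S where "S = ball (0::complex) R \<times> ball (0::complex) r"
  have S: "open S" "convex S" "p \<in> S" unfolding S_def
    using r R by (auto intro: open_Times convex_Times simp: mem_Times_iff)
  have SDJ: "q \<in> DJ" if "q \<in> S" for q
  proof -
    have "snd q \<in> ball 0 r" using that unfolding S_def mem_Times_iff by blast
    then have "cmod (snd q) < 1" using r(2) unfolding mem_ball dist_0_norm by linarith
    then show ?thesis by (cases q) (simp add: DJ_def)
  qed
  note v1 = moderate_shift1[OF v] and v2 = moderate_shift2[OF v]
  obtain M1 where M1: "summable M1"
    "\<And>N q. cmod (fst q) \<le> R \<Longrightarrow> cmod (snd q) \<le> r \<Longrightarrow> norm (pseries (shift1 v) N q) \<le> M1 N"
    using pseries_majorant[OF v1 R(1) r(1,2)] by blast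
  obtain M2 where M2: "summable M2"
    "\<And>N q. cmod (fst q) \<le> R \<Longrightarrow> cmod (snd q) \<le> r \<Longrightarrow> norm (pseries (shift2 v) N q) \<le> M2 N"
    using pseries_majorant[OF v2 R(1) r(1,2)] by blast
  have S_le: "cmod (fst q) \<le> R" "cmod (snd q) \<le> r" if "q \<in> S" for q
  proof -
    have "fst q \<in> ball 0 R" "snd q \<in> ball 0 r" using that unfolding S_def mem_Times_iff by blast+
    then have "cmod (fst q) < R" "cmod (snd q) < r" unfolding mem_ball dist_0_norm .
    then show "cmod (fst q) \<le> R" "cmod (snd q) \<le> r" by (simp_all only: less_imp_le)
  qed
  have u1: "uniform_limit S (\<lambda>n q. \<Sum>i<n. pseries (shift1 v) i q) (psum (shift1 v)) sequentially"
    unfolding psum_def[abs_def] by (rule Weierstrass_m_test[OF _ M1(1)]) (rule M1(2)[OF S_le])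
  have u2: "uniform_limit S (\<lambda>n q. \<Sum>i<n. pseries (shift2 v) i q) (psum (shift2 v)) sequentially"
    unfolding psum_def[abs_def] by (rule Weierstrass_m_test[OF _ M2(1)]) (rule M2(2)[OF S_le])
  have sum_dpseries: "(\<Sum>i<Suc n. dpseries v i q u)
      = fst u *\<^sub>C (\<Sum>i<n. pseries (shift1 v) i q) + snd u *\<^sub>C (\<Sum>i<n. pseries (shift2 v) i q)"
    for n q u
    by (simp only: sum.lessThan_Suc_shift dpseries_0 dpseries_Suc add_0 sum.distrib scaleC_sum_right)
  have "\<exists>g. \<forall>x\<in>S. (\<lambda>n. pseries v n x) sums g x \<and> (g has_derivative dpsum v x) (at x within S)"
  proof (rule has_derivative_series[OF S(2), where f' = "dpseries v" and x = p and l = "psum v p"])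
    show "(pseries v n has_derivative dpseries v n x) (at x within S)" if "x \<in> S" for n x
    proof (cases n)
      case 0
      have "pseries v 0 = (\<lambda>_. v 0 0)" by (simp add: pseries_def fun_eq_iff)
      then show ?thesis by (simp add: 0 dpseries_0)
    next
      case (Suc m)
      show ?thesis unfolding Suc dpseries_Suc
        by (rule has_derivative_at_withinI[OF has_derivative_pseries])
    qed
    fix e :: real assume e: "e > 0"
    from u1[unfolded uniform_limit_iff, rule_format, of "e / 2"] u2[unfolded uniform_limit_iff, rule_format, of "e / 2"] e
    have "\<forall>\<^sub>F n in sequentially. (\<forall>q\<in>S. dist (\<Sum>i<n. pseries (shift1 v) i q) (psum (shift1 v) q) < e / 2)
      \<and> (\<forall>q\<in>S. dist (\<Sum>i<n. pseries (shift2 v) i q) (psum (shift2 v) q) < e / 2)"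
      by (auto intro: eventually_conj)
    then have "\<forall>\<^sub>F n in sequentially. \<forall>q\<in>S. \<forall>u. norm ((\<Sum>i<Suc n. dpseries v i q u) - dpsum v q u) \<le> e * norm u"
    proof (rule eventually_mono, intro ballI allI)
      fix n q u
      assume "(\<forall>q\<in>S. dist (\<Sum>i<n. pseries (shift1 v) i q) (psum (shift1 v) q) < e / 2)
        \<and> (\<forall>q\<in>S. dist (\<Sum>i<n. pseries (shift2 v) i q) (psum (shift2 v) q) < e / 2)" and q: "q \<in> S"
      then have le: "norm ((\<Sum>i<n. pseries (shift1 v) i q) - psum (shift1 v) q) \<le> e / 2"
        "norm ((\<Sum>i<n. pseries (shift2 v) i q) - psum (shift2 v) q) \<le> e / 2"
        by (auto simp: dist_norm less_imp_le)
      have "(\<Sum>i<Suc n. dpseries v i q u) - dpsum v q u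
        = fst u *\<^sub>C ((\<Sum>i<n. pseries (shift1 v) i q) - psum (shift1 v) q)
          + snd u *\<^sub>C ((\<Sum>i<n. pseries (shift2 v) i q) - psum (shift2 v) q)"
        unfolding sum_dpseries dpsum_def by (simp add: scaleC_diff_right)
      also have "norm \<dots> \<le> cmod (fst u) * (e / 2) + cmod (snd u) * (e / 2)"
        by (rule norm_triangle_mono; unfold norm_scaleC; rule mult_left_mono[OF _ norm_ge_zero]; rule le)
      also have "\<dots> \<le> norm u * (e / 2) + norm u * (e / 2)"
        using e norm_fst_le[of "fst u" "snd u"] norm_snd_le[of "snd u" "fst u"]
        by (intro add_mono mult_right_mono) (simp_all)
      finally show "norm ((\<Sum>i<Suc n. dpseries v i q u) - dpsum v q u) \<le> e * norm u" by (simp add: mult.commute)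
    qed
    then show "\<forall>\<^sub>F n in sequentially. \<forall>q\<in>S. \<forall>u. norm ((\<Sum>i<n. dpseries v i q u) - dpsum v q u) \<le> e * norm u"
      by (rule eventually_sequentially_Suc[THEN iffD1])
  qed (use S(3) pseries_sums[OF v p] in auto)
  then obtain g where g: "\<And>x. x \<in> S \<Longrightarrow> (\<lambda>n. pseries v n x) sums g x"
      "\<And>x. x \<in> S \<Longrightarrow> (g has_derivative dpsum v x) (at x within S)" by blast
  have eq: "g x = psum v x" if "x \<in> S" for x
    using sums_unique2[OF g(1)[OF that] pseries_sums[OF v SDJ[OF that]]] .
  have "(g has_derivative dpsum v p) (at p)"
    using g(2)[OF S(3)] unfolding at_within_open[OF S(3,1)] .
  then have "(psum v has_derivative dpsum v p) (at p)"
    by (rule has_derivative_transform_within_open[OF _ S(1,3) eq])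
  then show ?thesis unfolding dpsum_def .
qed

text \<open>The numbers (x)_m / m! are the coefficients of (1 - t)^-x, a power series of radius at
  least 1; convergence at t = 1/q bounds its terms there.\<close>

lemma pochhammer_le:
  assumes "q > (1::real)"
  obtains M where "\<And>m. pochhammer x m \<le> M * (fact m * q ^ m)" "M \<ge> 1"
proof -
  have "summable (\<lambda>n. ((- x) gchoose n) * (- 1 / q) ^ n)"
    using gen_binomial_real[of "- 1 / q" "- x"] assms by (intro sums_summable) auto
  then obtain M where M: "\<And>n. norm (((- x) gchoose n) * (- 1 / q) ^ n) \<le> M"
    using summable_imp_Bseq unfolding Bseq_def by blast
  show ?thesis
  proof (rule that[of "max M 1"])
    fix m
    have eq: "((- x) gchoose m) * (- 1 / q) ^ m = pochhammer x m / fact m * (1 / q) ^ m"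
    proof -
      have "(- 1 / q) ^ m = (- 1) ^ m * (1 / q) ^ m" by (simp flip: power_mult_distrib)
      moreover have "(- 1 :: real) ^ m * (- 1) ^ m = 1" by (simp flip: power_mult_distrib)
      moreover have "s * P / F * (s * Q) = s * s * (P / F * Q)" for s P F Q :: real by simp
      ultimately show ?thesis by (simp only: gbinomial_pochhammer minus_minus mult_1)
    qed
    have "pochhammer x m / fact m * (1 / q) ^ m \<le> M"
      using M[of m] unfolding eq real_norm_def by (rule abs_le_D1)
    then have "pochhammer x m / fact m * (1 / q) ^ m \<le> max M 1" by (rule max.coboundedI1)
    then have le: "(pochhammer x m / fact m * (1 / q) ^ m) * (fact m * q ^ m) \<le> max M 1 * (fact m * q ^ m)"
      by (rule mult_right_mono) (use assms in simp)
    have e: "(pochhammer x m / fact m * (1 / q) ^ m) * (fact m * q ^ m) = pochhammer x m"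
    proof -
      have "(1 / q) ^ m * q ^ m = 1" using assms by (simp flip: power_mult_distrib)
      then show ?thesis by simp
    qed
    show "pochhammer x m \<le> max M 1 * (fact m * q ^ m)" using le unfolding e .
  qed simp
qed

lemma power_div_fact_le_exp:
  assumes "0 \<le> x"
  shows "x ^ i / fact i \<le> exp (x::real)"
proof -
  have "(\<Sum>n\<in>{i}. x ^ n /\<^sub>R fact n) \<le> (\<Sum>n. x ^ n /\<^sub>R fact n)"
    by (rule sum_le_suminf[OF summable_exp_generic]) (use assms in simp_all)
  then have "(\<Sum>n\<in>{i}. x ^ n /\<^sub>R fact n) \<le> exp x" unfolding exp_def .
  then show ?thesis by (simp add: divide_inverse mult.commute)
qed

text \<open>Write (i + 2l)! as i! (2l)! times a binomial coefficient. With d = q - 1 that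
  coefficient times d^i is one term of (1 + d)^(i + 2l) = q^(i + 2l), and (2l)! \<le> (l!)^2 4^l.
  The geometric factor in i that is left over is swallowed by the second i! on the right. The right
  side is a square because it will bound a squared norm.\<close>

lemma fact_add_double_le:
  assumes q: "q > (1::real)" and X: "X > 0"
  obtains C where "C \<ge> 1" "\<And>i l. fact (i + 2 * l) \<le> C * (fact i * X ^ i * (fact l * 2 ^ l * q ^ l))\<^sup>2"
proof -
  define d where "d = q - 1"
  have d: "d > 0" using q by (simp add: d_def)
  show ?thesis
  proof (rule that[of "exp (q / d / X\<^sup>2)"])
    show "exp (q / d / X\<^sup>2) \<ge> 1" using q d X by simp
    fix i l :: nat
    let ?n = "i + 2 * l"
    have b: "real (?n choose i) * d ^ i \<le> q ^ ?n"
    proof -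
      have "real (?n choose i) * d ^ i * 1 ^ (?n - i) \<le> (\<Sum>k\<le>?n. real (?n choose k) * d ^ k * 1 ^ (?n - k))"
        by (rule member_le_sum) (use d in auto)
      also have "\<dots> = (d + 1) ^ ?n" by (rule binomial_ring[symmetric])
      finally show ?thesis by (simp add: d_def)
    qed
    have bf: "fact m * fact (n - m) * real (n choose m) = fact n" if "m \<le> n" for m n
      using arg_cong[OF binomial_fact_lemma[OF that], of real] by simp
    have "real (2 * l choose l) \<le> real (2 ^ (2 * l))"
      using binomial_le_pow2[of "2 * l" l] by (simp only: of_nat_le_iff)
    then have "fact l * fact l * real (2 * l choose l) \<le> fact l * fact l * 2 ^ (2 * l)"
      by (intro mult_left_mono) simp_all
    also have "fact l * fact l * real (2 * l choose l) = fact (2 * l)"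
      using bf[of l "2 * l"] by (simp add: mult_2)
    finally have f2: "fact (2 * l) \<le> ((fact l)\<^sup>2 * (2 ^ l)\<^sup>2 :: real)"
      by (simp only: power_even_eq power2_eq_square mult.assoc)
    have "fact ?n = fact i * fact (2 * l) * real (?n choose i)"
      using bf[of i ?n] by simp
    also have "\<dots> \<le> fact i * ((fact l)\<^sup>2 * (2 ^ l)\<^sup>2) * (q ^ ?n / d ^ i)"
    proof (rule mult_mono)
      show "real (?n choose i) \<le> q ^ ?n / d ^ i" using b d by (simp add: pos_le_divide_eq)
    qed (use f2 in simp_all)
    also have "q ^ ?n / d ^ i = (q / d / X\<^sup>2) ^ i * (X ^ i * q ^ l)\<^sup>2"
    proof -
      have "(X ^ i * q ^ l)\<^sup>2 = (X\<^sup>2) ^ i * q ^ (2 * l)"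
        by (simp add: power_mult_distrib mult.commute flip: power_mult)
      then show ?thesis using X by (simp add: power_divide power_add power_mult_distrib)
    qed
    also have "fact i * ((fact l)\<^sup>2 * (2 ^ l)\<^sup>2) * ((q / d / X\<^sup>2) ^ i * (X ^ i * q ^ l)\<^sup>2)
        = (q / d / X\<^sup>2) ^ i / fact i * (fact i * X ^ i * (fact l * 2 ^ l * q ^ l))\<^sup>2"
    proof -
      have "f * (g\<^sup>2 * h\<^sup>2) * (K * (x * y)\<^sup>2) = K / f * (f * x * (g * h * y))\<^sup>2" if "f \<noteq> 0"
        for f g h K x y :: real using that by (simp add: power2_eq_square)
      then show ?thesis by simp
    qed
    also have "\<dots> \<le> exp (q / d / X\<^sup>2) * (fact i * X ^ i * (fact l * 2 ^ l * q ^ l))\<^sup>2"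
      using q d X by (intro mult_right_mono power_div_fact_le_exp) simp_all
    finally show "fact ?n \<le> exp (q / d / X\<^sup>2) * (fact i * X ^ i * (fact l * 2 ^ l * q ^ l))\<^sup>2" .
  qed
qed

subsection \<open>Coherent states\<close>

context jacobi_rep
begin

section \<open>Convergence of the exponential series for |w| < 1\<close>

definition cvec :: "nat \<Rightarrow> nat \<Rightarrow> 'h" where
  "cvec i j = (oA ^^ i) ((oKp ^^ j) e0)"

lemma SV_cvec [simp, intro]: "cvec i j \<in> SV"
  using e0_smooth by (simp add: cvec_def)

lemma A_cvec: "oA (cvec i j) = cvec (Suc i) j"
  by (simp add: cvec_def)

lemma Kp_cvec: "oKp (cvec i j) = cvec i (Suc j)"
  using e0_smooth by (simp add: cvec_def Kp_A_pow)

lemma pow_linear: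
  assumes "x \<in> SV" "y \<in> SV"
  shows "(oA ^^ n) (x + c *\<^sub>C y) = (oA ^^ n) x + c *\<^sub>C (oA ^^ n) y"
    and "(oKp ^^ n) (x + c *\<^sub>C y) = (oKp ^^ n) x + c *\<^sub>C (oKp ^^ n) y"
  by (induction n) (simp_all add: op_add op_scaleC assms SV_scaleC)

lemma k'_pos: "2 * k' > 0"
  using k' k_ge by simp

text \<open>K_+ = K'_+ + (a^+)^2/2 is peeled off one factor at a time, each step raising m or l by
  one. The weight l! m! / (l + m + 1)! is built so that the two bounds of a step recombine exactly,
  since (m + 1) + (l + 1) = l + m + 2; the factor 2^l compensates the 1/2. The branching therefore
  does not reduce the radius of convergence in w.\<close>

lemma norm_mixed_le:
  fixes X Y :: real
  assumes X: "X > 0" and Y: "Y > 1"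
  shows "\<exists>D. \<forall>i j l m. norm ((oA ^^ (i + 2 * l)) ((oKp ^^ j) ((oB ^^ m) e0)))
    \<le> D * fact i * X ^ i * 2 ^ l * Y ^ (l + j + m) * (fact l * fact m * (fact (l + m + j + 1) / fact (l + m + 1)))"
proof -
  obtain C where C: "C \<ge> 1" "\<And>i l. fact (i + 2 * l) \<le> C * (fact i * X ^ i * (fact l * 2 ^ l * Y ^ l))\<^sup>2"
    by (rule fact_add_double_le[OF Y X]) blast
  have "Y\<^sup>2 > 1" using Y by simp
  then obtain M where M: "\<And>m. pochhammer (2 * k') m \<le> M * (fact m * (Y\<^sup>2) ^ m)" "M \<ge> 1"
    using pochhammer_le[of "Y\<^sup>2" "2 * k'"] by blast
  define D where "D = sqrt C * sqrt M"
  have D: "D \<ge> 0" "D\<^sup>2 = C * M" using C M by (simp_all add: D_def power_mult_distrib)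
  have "norm ((oA ^^ (i + 2 * l)) ((oKp ^^ j) ((oB ^^ m) e0)))
    \<le> D * fact i * X ^ i * 2 ^ l * Y ^ (l + j + m) * (fact l * fact m * (fact (l + m + j + 1) / fact (l + m + 1)))"
    for i j l m
  proof (induction j arbitrary: l m)
    case 0
    have "(norm ((oA ^^ (i + 2 * l)) ((oB ^^ m) e0)))\<^sup>2 = fact (i + 2 * l) * (fact m * pochhammer (2 * k') m)"
      by (rule norm_A_B_pow)
    also have "\<dots> \<le> C * (fact i * X ^ i * (fact l * 2 ^ l * Y ^ l))\<^sup>2 * (fact m * (M * (fact m * (Y\<^sup>2) ^ m)))"
      using C M pochhammer_nonneg[OF k'_pos] by (intro mult_mono C(2) M(1) mult_left_mono) simp_all
    also have "\<dots> = (D * fact i * X ^ i * 2 ^ l * Y ^ (l + m) * (fact l * fact m))\<^sup>2"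
    proof -
      have "(Y\<^sup>2) ^ m = (Y ^ m)\<^sup>2" by (simp add: mult.commute flip: power_mult)
      then show ?thesis
        by (simp only: power_mult_distrib power_add D(2)) (simp add: power2_eq_square)
    qed
    finally have "norm ((oA ^^ (i + 2 * l)) ((oB ^^ m) e0)) \<le> D * fact i * X ^ i * 2 ^ l * Y ^ (l + m) * (fact l * fact m)"
      by (rule power2_le_imp_le) (use D X Y in simp)
    then show ?case by simp
  next
    case (Suc j)
    let ?n = "i + 2 * l"
    define x where "x = (oB ^^ m) e0"
    have x: "x \<in> SV" "oB x \<in> SV" "oA (oA x) \<in> SV" using e0_smooth by (simp_all add: x_def)
    have 1: "(oKp ^^ Suc j) x = (oKp ^^ j) (oB x) + (1 / 2) *\<^sub>C oA (oA ((oKp ^^ j) x))"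
      unfolding funpow_Suc_right o_apply Kp_eq_B[of x] pow_linear(2)[OF x(2,3)]
      by (simp only: A_Kp_pow x SV_op)
    have s: "(oKp ^^ j) (oB x) \<in> SV" "oA (oA ((oKp ^^ j) x)) \<in> SV" using x by simp_all
    have n: "i + 2 * Suc l = Suc (Suc ?n)" by simp
    have "(oA ^^ ?n) ((oKp ^^ Suc j) x) = (oA ^^ ?n) ((oKp ^^ j) (oB x)) + (1 / 2) *\<^sub>C (oA ^^ (i + 2 * Suc l)) ((oKp ^^ j) x)"
    proof -
      have "(oA ^^ ?n) ((oKp ^^ Suc j) x) = (oA ^^ ?n) ((oKp ^^ j) (oB x) + (1 / 2) *\<^sub>C oA (oA ((oKp ^^ j) x)))"
        by (simp only: 1)
      also have "\<dots> = (oA ^^ ?n) ((oKp ^^ j) (oB x)) + (1 / 2) *\<^sub>C (oA ^^ ?n) (oA (oA ((oKp ^^ j) x)))"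
        by (rule pow_linear(1)[OF s])
      finally show ?thesis by (simp only: n funpow_Suc_right o_apply)
    qed
    also have "oB x = (oB ^^ Suc m) e0" by (simp add: x_def)
    finally have "norm ((oA ^^ ?n) ((oKp ^^ Suc j) x))
      \<le> norm ((oA ^^ ?n) ((oKp ^^ j) ((oB ^^ Suc m) e0))) + norm ((1 / 2 :: complex) *\<^sub>C (oA ^^ (i + 2 * Suc l)) ((oKp ^^ j) x))"
      by (simp only: norm_triangle_ineq)
    also have "norm ((1 / 2 :: complex) *\<^sub>C (oA ^^ (i + 2 * Suc l)) ((oKp ^^ j) x)) = 1 / 2 * norm ((oA ^^ (i + 2 * Suc l)) ((oKp ^^ j) x))"
      unfolding norm_scaleC by simp
    also have "norm ((oA ^^ ?n) ((oKp ^^ j) ((oB ^^ Suc m) e0))) + 1 / 2 * norm ((oA ^^ (i + 2 * Suc l)) ((oKp ^^ j) x))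
      \<le> D * fact i * X ^ i * 2 ^ l * Y ^ (l + j + Suc m) * (fact l * fact (Suc m) * (fact (l + Suc m + j + 1) / fact (l + Suc m + 1)))
      + 1 / 2 * (D * fact i * X ^ i * 2 ^ Suc l * Y ^ (Suc l + j + m) * (fact (Suc l) * fact m * (fact (Suc l + m + j + 1) / fact (Suc l + m + 1))))"
      unfolding x_def by (intro add_mono mult_left_mono Suc.IH) simp
    also have "\<dots> = D * fact i * X ^ i * 2 ^ l * Y ^ (l + Suc j + m) * (fact l * fact m * (fact (l + m + Suc j + 1) / fact (l + m + 1)))"
    proof -
      have f: "fact l * fact (Suc m) * (F / fact (Suc (Suc (l + m)))) + fact (Suc l) * fact m * (F / fact (Suc (Suc (l + m))))
        = fact l * fact m * (F / fact (Suc (l + m)))" for F :: real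
      proof -
        have "fact l * fact (Suc m) * (F / fact (Suc (Suc (l + m)))) + fact (Suc l) * fact m * (F / fact (Suc (Suc (l + m))))
          = (fact l * fact m * F) * (of_nat (Suc (Suc (l + m))) / fact (Suc (Suc (l + m))))"
          by (simp add: fact_Suc[of l] fact_Suc[of m] add_divide_distrib[symmetric] algebra_simps del: fact_Suc)
        also have "of_nat (Suc (Suc (l + m))) / fact (Suc (Suc (l + m))) = (1 / fact (Suc (l + m)) :: real)"
          by (simp only: fact_Suc[of "Suc (l + m)"]) simp
        finally show ?thesis by simp
      qed
      have i: "l + j + Suc m = l + Suc j + m" "Suc l + j + m = l + Suc j + m"
        "l + Suc m + j + 1 = l + m + Suc j + 1" "Suc l + m + j + 1 = l + m + Suc j + 1"
        "l + Suc m + 1 = Suc (Suc (l + m))" "Suc l + m + 1 = Suc (Suc (l + m))" "l + m + 1 = Suc (l + m)"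
        by simp_all
      show ?thesis
        unfolding i f[symmetric] by (simp add: distrib_left del: fact_Suc)
    qed
    finally show ?case unfolding x_def .
  qed
  then show ?thesis by blast
qed

lemma moderate_cvec: "moderate cvec"
proof (rule moderateI)
  fix X Y :: real assume "X > 0" "Y > 1"
  then obtain D where D: "\<And>i j l m. norm ((oA ^^ (i + 2 * l)) ((oKp ^^ j) ((oB ^^ m) e0)))
    \<le> D * fact i * X ^ i * 2 ^ l * Y ^ (l + j + m) * (fact l * fact m * (fact (l + m + j + 1) / fact (l + m + 1)))"
    using norm_mixed_le by meson
  \<comment> \<open>The case l = m = 0; it leaves the factor (j + 1)!, which is what
    \<open>moderateI\<close> tolerates.\<close>
  have "norm (cvec i j) \<le> D * (fact i * fact (Suc j) * X ^ i * Y ^ j)" for i j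
    using D[of i 0 j 0] by (simp add: cvec_def mult_ac del: fact_Suc)
  then show "\<exists>C. \<forall>i j. norm (cvec i j) \<le> C * (fact i * fact (Suc j) * X ^ i * Y ^ j)" by blast
qed

lemma pseries_op:
  assumes "\<And>i j. v i j \<in> SV"
  shows "pseries v N p \<in> SV"
    and "oA (pseries v N p) = pseries (\<lambda>i j. oA (v i j)) N p"
    and "oKp (pseries v N p) = pseries (\<lambda>i j. oKp (v i j)) N p"
    and "oa (pseries v N p) = pseries (\<lambda>i j. oa (v i j)) N p"
    and "oKm (pseries v N p) = pseries (\<lambda>i j. oKm (v i j)) N p"
proof -
  have s: "(epow i (fst p) * epow (N - i) (snd p)) *\<^sub>C v i (N - i) \<in> SV" for i
    using assms by auto
  show "pseries v N p \<in> SV" "oA (pseries v N p) = pseries (\<lambda>i j. oA (v i j)) N p"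
    "oKp (pseries v N p) = pseries (\<lambda>i j. oKp (v i j)) N p"
    "oa (pseries v N p) = pseries (\<lambda>i j. oa (v i j)) N p"
    "oKm (pseries v N p) = pseries (\<lambda>i j. oKm (v i j)) N p"
    unfolding pseries_def using s by (auto simp: op_sum[OF s] op_scaleC[OF assms])
qed

lemma pseries_cvec:
  shows SV_pseries: "pseries cvec N p \<in> SV" "pseries (shift1 cvec) N p \<in> SV"
    and A_pseries: "oA (pseries cvec N p) = pseries (shift1 cvec) N p"
    and Kp_pseries: "oKp (pseries cvec N p) = pseries (shift2 cvec) N p"
  by (simp_all add: pseries_op A_cvec Kp_cvec)

definition E :: "C2 \<Rightarrow> 'h" where "E = psum cvec"
definition EA :: "C2 \<Rightarrow> 'h" where "EA = psum (shift1 cvec)"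
definition EK :: "C2 \<Rightarrow> 'h" where "EK = psum (shift2 cvec)"

text \<open>a^+ and K_+ commute, so (z a^+ + w K_+)^n e_0 / n! expands into divided powers of total
  degree n; the induction step is Euler's identity.\<close>

lemma coherent_eq: "coherent U e0 p = E p"
proof -
  define T where "T = (\<lambda>v. fst p *\<^sub>C oA v + snd p *\<^sub>C oKp v)"
  have "(1 / fact n) *\<^sub>C (T ^^ n) e0 = pseries cvec n p" for n
  proof (induction n)
    case 0
    then show ?case by (simp add: pseries_def cvec_def)
  next
    case (Suc n)
    have T: "(T ^^ n) e0 \<in> SV" for n
      by (induction n) (auto simp: e0_smooth T_def)
    have "(1 / fact (Suc n)) *\<^sub>C (T ^^ Suc n) e0 = (1 / of_nat (Suc n)) *\<^sub>C (1 / fact n) *\<^sub>C T ((T ^^ n) e0)"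
      by (simp add: scaleC_scaleC)
    also have "(1 / fact n) *\<^sub>C T ((T ^^ n) e0) = T ((1 / fact n) *\<^sub>C (T ^^ n) e0)"
      using T[of n] by (simp add: T_def op_scaleC scaleC_add_right scaleC_scaleC mult.commute)
    also have "\<dots> = of_nat (Suc n) *\<^sub>C pseries cvec (Suc n) p"
      unfolding Suc pseries_euler by (simp add: T_def A_pseries Kp_pseries)
    finally show ?case by (simp add: scaleC_scaleC del: of_nat_Suc)
  qed
  then show ?thesis
    by (simp add: coherent_def E_def psum_def T_def case_prod_unfold)
qed

lemma E_sums:
  assumes "p \<in> DJ"
  shows "(\<lambda>N. pseries cvec N p) sums E p" "(\<lambda>N. pseries (shift1 cvec) N p) sums EA p"
    "(\<lambda>N. pseries (shift2 cvec) N p) sums EK p"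
  unfolding E_def EA_def EK_def
  by (intro pseries_sums assms moderate_shift1 moderate_shift2 moderate_cvec)+

lemma has_derivative_E:
  "p \<in> DJ \<Longrightarrow> (E has_derivative (\<lambda>u. fst u *\<^sub>C EA p + snd u *\<^sub>C EK p)) (at p)"
  unfolding E_def EA_def EK_def by (rule has_derivative_psum[OF moderate_cvec])

section \<open>Action of a on the coherent vectors, and the kernel in closed form\<close>

lemma a_pseries_0: "oa (pseries cvec 0 p) = 0"
  using e0_smooth by (simp add: pseries_def op_scaleC cvec_def e0_lowest)

text \<open>As a e_0 = 0, the commutators [a, a^+] = 1 and [a, K_+] = a^+ make a act on the
  exponential as z + w a^+. Each homogeneous part loses one degree.\<close>

lemma a_pseries_Suc:
  "oa (pseries cvec (Suc N) p) = fst p *\<^sub>C pseries cvec N p + snd p *\<^sub>C pseries (shift1 cvec) N p"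
proof -
  have a: "oa (cvec i j) = of_nat i *\<^sub>C cvec (i - 1) j + of_nat j *\<^sub>C cvec (Suc i) (j - 1)" for i j
    unfolding cvec_def by (rule a_A_Kp_pow)
  have c: "(epow i (fst p) * epow j (snd p)) *\<^sub>C oa (cvec i j)
    = fst p *\<^sub>C (epow' i (fst p) * epow j (snd p)) *\<^sub>C cvec (i - 1) j
      + snd p *\<^sub>C (epow i (fst p) * epow' j (snd p)) *\<^sub>C cvec (Suc i) (j - 1)" for i j
  proof -
    have "(epow i (fst p) * epow j (snd p)) *\<^sub>C oa (cvec i j)
      = ((of_nat i * epow i (fst p)) * epow j (snd p)) *\<^sub>C cvec (i - 1) j
      + (epow i (fst p) * (of_nat j * epow j (snd p))) *\<^sub>C cvec (Suc i) (j - 1)"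
      unfolding a scaleC_add_right scaleC_scaleC by (simp add: mult_ac)
    then show ?thesis unfolding of_nat_epow by (simp add: scaleC_scaleC mult_ac)
  qed
  have "oa (pseries cvec (Suc N) p)
    = fst p *\<^sub>C (\<Sum>i\<le>Suc N. (epow' i (fst p) * epow (Suc N - i) (snd p)) *\<^sub>C cvec (i - 1) (Suc N - i))
      + snd p *\<^sub>C (\<Sum>i\<le>Suc N. (epow i (fst p) * epow' (Suc N - i) (snd p)) *\<^sub>C cvec (Suc i) (Suc N - i - 1))"
    unfolding pseries_op(4)[of cvec, OF SV_cvec]
    unfolding pseries_def c sum.distrib scaleC_sum_right ..
  then show ?thesis
    unfolding shift_sum1[of p N "\<lambda>i j. cvec (i - 1) j"] shift_sum2[of p N "\<lambda>i j. cvec (Suc i) (j - 1)"]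
    by simp
qed

lemma cinner_sums_right: "f sums x \<Longrightarrow> (\<lambda>n. cinner y (f n)) sums cinner y (x::'h)"
  by (rule bounded_linear.sums[OF bounded_linear_cinner_right])

lemma cinner_sums_left: "f sums x \<Longrightarrow> (\<lambda>n. cinner (f n) y) sums cinner (x::'h) y"
  by (rule bounded_linear.sums[OF bounded_linear_cinner_left])

lemma scaleC_sums: "f sums x \<Longrightarrow> (\<lambda>n. c *\<^sub>C f n) sums (c *\<^sub>C (x::'h))"
  by (rule bounded_linear.sums[OF bounded_linear_scaleC_right])

text \<open>The formula a E = z E + w a^+ E in a form that does not presuppose \<open>E p\<close> to
  lie in the domain of \<open>op_a\<close>.\<close>

lemma a_E_sums:
  assumes "p \<in> DJ"
  shows "(\<lambda>N. oa (pseries cvec N p)) sums (fst p *\<^sub>C E p + snd p *\<^sub>C EA p)"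
proof -
  have "(\<lambda>N. oa (pseries cvec (Suc N) p)) sums (fst p *\<^sub>C E p + snd p *\<^sub>C EA p)"
    unfolding a_pseries_Suc by (intro sums_add scaleC_sums E_sums assms)
  then show ?thesis using sums_Suc[of "\<lambda>N. oa (pseries cvec N p)"] by (simp add: a_pseries_0)
qed

lemma cinner_EA:
  assumes "p \<in> DJ" "y \<in> SV"
  shows "cinner (EA p) y = cinner (E p) (oa y)"
proof (rule sums_unique2)
  show "(\<lambda>N. cinner (pseries (shift1 cvec) N p) y) sums cinner (EA p) y"
    by (intro cinner_sums_left E_sums assms)
  have "cinner (pseries (shift1 cvec) N p) y = cinner (pseries cvec N p) (oa y)" for N
    unfolding A_pseries[symmetric] by (rule adj(1)[OF SV_pseries(1) assms(2)])
  then show "(\<lambda>N. cinner (pseries (shift1 cvec) N p) y) sums cinner (E p) (oa y)"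
    by (simp only:) (intro cinner_sums_left E_sums assms)
qed

lemma cinner_EA_E:
  assumes "p \<in> DJ" "q \<in> DJ"
  shows "cinner (EA p) (E q) = fst q * cinner (E p) (E q) + snd q * cinner (E p) (EA q)"
proof (rule sums_unique2)
  show "(\<lambda>N. cinner (EA p) (pseries cvec N q)) sums cinner (EA p) (E q)"
    by (intro cinner_sums_right E_sums assms)
  have "(\<lambda>N. cinner (E p) (oa (pseries cvec N q))) sums cinner (E p) (fst q *\<^sub>C E q + snd q *\<^sub>C EA q)"
    by (intro cinner_sums_right a_E_sums assms)
  then show "(\<lambda>N. cinner (EA p) (pseries cvec N q)) sums (fst q * cinner (E p) (E q) + snd q * cinner (E p) (EA q))"
    by (simp add: cinner_EA[OF assms(1) SV_pseries(1)] cinner_add_right cinner_scaleC_right)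
qed

lemma cinner_A_E:
  assumes "p \<in> DJ" "y \<in> SV"
  shows "cinner (E p) (oA y) = cnj (fst p) * cinner (E p) y + cnj (snd p) * cinner (E p) (oa y)"
proof -
  have "cinner (oA y) (E p) = cinner y (fst p *\<^sub>C E p + snd p *\<^sub>C EA p)"
  proof (rule sums_unique2)
    show "(\<lambda>N. cinner (oA y) (pseries cvec N p)) sums cinner (oA y) (E p)"
      by (intro cinner_sums_right E_sums assms)
    show "(\<lambda>N. cinner (oA y) (pseries cvec N p)) sums cinner y (fst p *\<^sub>C E p + snd p *\<^sub>C EA p)"
      unfolding adj(1)[OF assms(2) SV_pseries(1)] by (intro cinner_sums_right a_E_sums assms)
  qed
  then have "cinner (E p) (oA y) = cinner (fst p *\<^sub>C E p + snd p *\<^sub>C EA p) y"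
    by (metis cinner_commute)
  then show ?thesis by (simp add: cinner_add_left cinner_scaleC_left cinner_EA[OF assms])
qed

text \<open>Each K_+ moves across as K_- and takes the chain \<open>f\<close> one step down. It
  serves the powers of K_+ with c = k and those of K'_+ with c = k'.\<close>

lemma cinner_Kp_pow_Km:
  assumes "\<And>n. f n \<in> SV" "oKm (f 0) = 0" "cinner e0 (f 0) = 1" "\<And>n. cinner e0 (f (Suc n)) = 0"
    and "\<And>n. oKm (f (Suc n)) = (of_nat (Suc n) * (2 * of_real c + of_nat n)) *\<^sub>C f n"
  shows "cinner ((oKp ^^ m) e0) (f n) = (if m = n then fact m * pochhammer (2 * of_real c) m else 0)"
proof (induction m arbitrary: n)
  case 0
  then show ?case using assms(3,4) by (cases n) simp_all
next
  case (Suc m)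
  have 1: "cinner ((oKp ^^ Suc m) e0) (f n) = cinner ((oKp ^^ m) e0) (oKm (f n))"
    using adj(2)[OF SV_pow(3)[OF e0_smooth] assms(1)] by simp
  show ?case
  proof (cases n)
    case 0
    then show ?thesis unfolding 1 using assms(2) by simp
  next
    case (Suc n')
    show ?thesis
      unfolding 1 unfolding Suc assms(5) cinner_scaleC_right Suc.IH
      by (simp add: pochhammer_Suc algebra_simps)
  qed
qed

lemma cinner_Kp_pow:
  "cinner ((oKp ^^ m) e0) ((oKp ^^ n) e0) = (if m = n then fact m * pochhammer (2 * of_real k) m else 0)"
proof (rule cinner_Kp_pow_Km[where f = "\<lambda>n. (oKp ^^ n) e0"])
  show "cinner e0 ((oKp ^^ Suc n) e0) = 0" for n
  proof -
    have "cinner (oKp ((oKp ^^ n) e0)) e0 = 0"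
      using adj(2)[OF SV_pow(3)[OF e0_smooth] e0_smooth] e0_lowest by simp
    then show ?thesis unfolding cinner_commute[of e0 "(oKp ^^ Suc n) e0"] by simp
  qed
qed (use e0_smooth e0_lowest e0_unit Km_Kp_pow in simp_all)

lemma cinner_Kp_pow_B_pow:
  "cinner ((oKp ^^ m) e0) ((oB ^^ n) e0) = (if m = n then fact m * pochhammer (2 * of_real k') m else 0)"
proof (rule cinner_Kp_pow_Km[where f = "\<lambda>n. (oB ^^ n) e0"])
  show "cinner e0 ((oB ^^ Suc n) e0) = 0" for n
    using cinner_B_pow[of 0 "Suc n"] by simp
qed (use e0_smooth e0_lowest e0_unit Km_B_pow in simp_all)

lemma pseries_zero: "pseries cvec N (0, w) = epow N w *\<^sub>C (oKp ^^ N) e0"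
proof -
  have "epow i 0 = (if i = 0 then 1 else 0)" for i by (cases i) (simp_all add: epow_def)
  then have "pseries cvec N (0, w) = (\<Sum>i\<le>N. if i = 0 then epow N w *\<^sub>C cvec 0 N else 0)"
    unfolding pseries_def by (intro sum.cong) auto
  then show ?thesis by (simp add: cvec_def)
qed

lemma zero_DJ: "cmod w < 1 \<Longrightarrow> (0, w) \<in> DJ"
  by (simp add: DJ_def)

text \<open>At z = 0 orthogonality of the vectors K_+^n e_0 leaves the binomial series with exponent
  -2k in the product of w and conj v.\<close>

lemma cinner_E_zero:
  assumes "cmod v < 1" "cmod w < 1"
  shows "cinner (E (0, v)) (E (0, w)) = (1 - cnj v * w) powr (- 2 * of_real k)"
proof -
  have x: "cmod (cnj v * w) < 1"
    using assms mult_strict_mono[of "cmod v" 1 "cmod w" 1] by (simp add: norm_mult)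
  have 1: "cinner (E (0, v)) ((oKp ^^ N) e0) = cnj v ^ N * pochhammer (2 * of_real k) N" for N
  proof (rule sums_unique2)
    show "(\<lambda>M. cinner (pseries cvec M (0, v)) ((oKp ^^ N) e0)) sums cinner (E (0, v)) ((oKp ^^ N) e0)"
      by (intro cinner_sums_left E_sums zero_DJ assms)
    have "(\<lambda>M. cinner (pseries cvec M (0, v)) ((oKp ^^ N) e0))
      = (\<lambda>M. if M = N then cnj (epow N v) * (fact N * pochhammer (2 * of_real k) N) else 0)"
      by (auto simp: pseries_zero cinner_scaleC_left cinner_Kp_pow)
    then have "(\<lambda>M. cinner (pseries cvec M (0, v)) ((oKp ^^ N) e0)) sums (cnj (epow N v) * (fact N * pochhammer (2 * of_real k) N))"
      using sums_single[of N "\<lambda>_. cnj (epow N v) * (fact N * pochhammer (2 * of_real k) N)"] by simp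
    then show "(\<lambda>M. cinner (pseries cvec M (0, v)) ((oKp ^^ N) e0)) sums (cnj v ^ N * pochhammer (2 * of_real k) N)"
      by (simp add: epow_def)
  qed
  show ?thesis
  proof (rule sums_unique2)
    show "(\<lambda>N. cinner (E (0, v)) (pseries cvec N (0, w))) sums cinner (E (0, v)) (E (0, w))"
      by (intro cinner_sums_right E_sums zero_DJ assms)
    have "(\<lambda>n. ((- 2 * complex_of_real k) gchoose n) * (- (cnj v * w)) ^ n) sums (1 + - (cnj v * w)) powr (- 2 * of_real k)"
      by (rule gen_binomial_complex) (use x in simp)
    moreover have "((- 2 * complex_of_real k) gchoose n) * (- (cnj v * w)) ^ n = cinner (E (0, v)) (pseries cvec n (0, w))" for n
    proof -
      have s1: "(- 1 :: complex) ^ n * (- 1) ^ n = 1" by (simp flip: power_mult_distrib)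
      have "s * P / F * (s * Q) = s * s * (P / F * Q)" for s P F Q :: complex by simp
      from this[of "(- 1) ^ n"] have s: "(- 1) ^ n * P / F * ((- 1) ^ n * Q) = P / F * Q" for P F Q :: complex
        unfolding s1 by simp
      have "((- 2 * complex_of_real k) gchoose n) * (- (cnj v * w)) ^ n = pochhammer (2 * of_real k) n / fact n * (cnj v * w) ^ n"
        unfolding gbinomial_pochhammer power_minus[of "cnj v * w"] s by simp
      then show ?thesis
        unfolding pseries_zero cinner_scaleC_right 1 by (simp add: epow_def power_mult_distrib)
    qed
    ultimately show "(\<lambda>N. cinner (E (0, v)) (pseries cvec N (0, w))) sums (1 - cnj v * w) powr (- 2 * of_real k)"
      by simp
  qed
qed

lemma DJ_prod_less: "p \<in> DJ \<Longrightarrow> q \<in> DJ \<Longrightarrow> cmod (snd q * cnj (snd p)) < 1"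
  using mult_strict_mono[of "cmod (snd q)" 1 "cmod (snd p)" 1]
  by (cases p; cases q) (simp add: DJ_def norm_mult)

text \<open>As a function of x = conj z the product is holomorphic. The two products that contain
  one \<open>EA\<close> are tied by a pair of linear relations with determinant D; solving them
  gives g' = (z' + w' x) g / D for q = (z', w'). The exponential is the solution, normalized at z =
  0.\<close>

lemma cinner_E_fst:
  assumes "(z, v) \<in> DJ" "q \<in> DJ"
  shows "cinner (E (z, v)) (E q)
    = cinner (E (0, v)) (E q) * exp ((fst q * cnj z + snd q * (cnj z)\<^sup>2 / 2) / (1 - snd q * cnj v))"
proof -
  define D where "D = 1 - snd q * cnj v"
  have "cmod (snd q * cnj v) < 1" using DJ_prod_less[OF assms] by simp
  then have D: "D \<noteq> 0" unfolding D_def by (metis norm_one order_less_irrefl right_minus_eq)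
  have DJ: "(x, v) \<in> DJ" for x using assms(1) by (simp add: DJ_def)
  define g where "g = (\<lambda>x. cinner (E (cnj x, v)) (E q))"
  define e where "e = (\<lambda>x. exp (- ((fst q * x + snd q * x\<^sup>2 / 2) / D)))"
  have der: "(g has_field_derivative ((fst q + snd q * x) / D * g x)) (at x)" for x
  proof -
    have "((\<lambda>x. (cnj x, v)) has_derivative (\<lambda>u. (cnj u, 0))) (at x)"
      by (intro has_derivative_Pair bounded_linear_imp_has_derivative bounded_linear_cnj has_derivative_const)
    from has_derivative_compose[OF this has_derivative_E[OF DJ]]
    have "((\<lambda>x. E (cnj x, v)) has_derivative (\<lambda>u. cnj u *\<^sub>C EA (cnj x, v))) (at x)" by simp
    from bounded_linear.has_derivative[OF bounded_linear_cinner_left this, of "E q"]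
    have "(g has_field_derivative cinner (EA (cnj x, v)) (E q)) (at x)"
      unfolding g_def has_field_derivative_def
      by (rule has_derivative_eq_rhs) (simp add: fun_eq_iff cinner_scaleC_left)
    moreover have "cinner (EA (cnj x, v)) (E q) = (fst q + snd q * x) / D * g x"
    proof -
      let ?a = "cinner (EA (cnj x, v)) (E q)"
      have "cinner (E (cnj x, v)) (EA q) = cnj (cinner (EA q) (E (cnj x, v)))" by (rule cinner_commute)
      also have "\<dots> = x * g x + cnj v * ?a"
        unfolding cinner_EA_E[OF assms(2) DJ] g_def
        by (simp only: complex_cnj_add complex_cnj_mult fst_conv snd_conv complex_cnj_cnj cinner_commute[symmetric])
      finally have "?a = fst q * g x + snd q * (x * g x + cnj v * ?a)"
        using cinner_EA_E[OF DJ assms(2), of "cnj x"] by (simp add: g_def)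
      then have "?a * D = (fst q + snd q * x) * g x" by (simp add: D_def algebra_simps) 
      then show ?thesis using D by (simp add: field_simps)
    qed
    ultimately show ?thesis by simp
  qed
  have dere: "(e has_field_derivative (- ((fst q + snd q * x) / D) * e x)) (at x)" for x
  proof -
    have "((\<lambda>x. fst q * x + snd q * x\<^sup>2 / 2) has_field_derivative (fst q + snd q * x)) (at x)"
      by (auto intro!: derivative_eq_intros)
    from DERIV_chain2[OF DERIV_exp DERIV_minus[OF DERIV_cdivide[OF this, of D]]]
    show ?thesis unfolding e_def by (simp only: mult.commute)
  qed
  have "((\<lambda>x. g x * e x) has_field_derivative 0) (at x)" for x
    by (rule DERIV_cong[OF DERIV_mult[OF der dere]]) simp
  then obtain c where c: "\<And>x. g x * e x = c"
    using has_field_derivative_zero_constant[OF convex_UNIV, of "\<lambda>x. g x * e x"] by auto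
  have "g (cnj z) * e (cnj z) = g 0 * e 0" by (simp only: c)
  moreover have "e 0 = 1" by (simp add: e_def)
  moreover have "e (cnj z) = inverse (exp ((fst q * cnj z + snd q * (cnj z)\<^sup>2 / 2) / D))"
    by (simp add: e_def exp_minus)
  ultimately have "g (cnj z) = g 0 * exp ((fst q * cnj z + snd q * (cnj z)\<^sup>2 / 2) / D)"
    by (simp add: field_simps del: exp_not_eq_zero) (metis exp_not_eq_zero nonzero_eq_divide_eq)
  then show ?thesis by (simp add: g_def D_def)
qed

lemma cinner_E:
  assumes "p \<in> DJ" "q \<in> DJ"
  shows "cinner (E p) (E q) = (1 - cnj (snd p) * snd q) powr (- 2 * of_real k)
    * exp ((2 * cnj (fst p) * fst q + (cnj (fst p))\<^sup>2 * snd q + (fst q)\<^sup>2 * cnj (snd p)) / (2 * (1 - cnj (snd p) * snd q)))"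
proof -
  obtain z v where p: "p = (z, v)" by (cases p)
  obtain z' v' where q: "q = (z', v')" by (cases q)
  have v: "cmod v < 1" "cmod v' < 1" using assms by (simp_all add: p q DJ_def)
  \<comment> \<open>Conjugate symmetry applies the previous lemma to the second argument, so that
    only z = z' = 0 remains.\<close>
  have 1: "cinner (E (0, v)) (E (z', v')) = cinner (E (0, v)) (E (0, v')) * exp (cnj v * z'\<^sup>2 / 2 / (1 - cnj v * v'))"
    using arg_cong[OF cinner_E_fst[OF assms(2)[unfolded q] zero_DJ[OF v(1)]], of cnj]
    by (simp add: exp_cnj mult.commute flip: cinner_commute[of "E (0, v)"])
  have "cinner (E p) (E q) = cinner (E (0, v)) (E (0, v')) * (exp (cnj v * z'\<^sup>2 / 2 / (1 - cnj v * v'))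
      * exp ((z' * cnj z + v' * (cnj z)\<^sup>2 / 2) / (1 - v' * cnj v)))"
    using cinner_E_fst[OF assms(1)[unfolded p] assms(2)] 1 by (simp add: p q)
  also have "exp (cnj v * z'\<^sup>2 / 2 / (1 - cnj v * v')) * exp ((z' * cnj z + v' * (cnj z)\<^sup>2 / 2) / (1 - v' * cnj v))
    = exp ((2 * cnj z * z' + (cnj z)\<^sup>2 * v' + z'\<^sup>2 * cnj v) / (2 * (1 - cnj v * v')))"
  proof -
    have "b / 2 / d + (a + c / 2) / d = (2 * a + c + b) / (2 * d)" for a b c d :: complex
      by (cases "d = 0") (simp_all add: field_simps)
    from this[of "cnj v * z'\<^sup>2" "1 - cnj v * v'" "z' * cnj z" "v' * (cnj z)\<^sup>2"]
    show ?thesis by (simp add: mult_ac flip: exp_add)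
  qed
  finally show ?thesis by (simp add: p q cinner_E_zero[OF v])
qed

end

subsection \<open>The polynomials attached to the basis\<close>

lemma P_poly_epow: "P_poly n z w = fact n * (\<Sum>q\<le>n div 2. epow q (w / 2) * epow (n - 2 * q) z)"
  by (simp add: P_poly_def epow_def)

lemma P_poly_0: "P_poly 0 z w = 1" and P_poly_1: "P_poly (Suc 0) z w = z"
  by (simp_all add: P_poly_epow, simp add: epow_def)

text \<open>Give z weight 1 and w weight 2. P_n is homogeneous of weight n, and splitting the weight
  n + 2 of each monomial into its z part and its w part yields the two terms.\<close>

lemma P_poly_rec: "P_poly (Suc (Suc n)) z w = z * P_poly (Suc n) z w + of_nat (Suc n) * (w * P_poly n z w)"
proof -
  define Q where "Q = (\<lambda>n. \<Sum>q\<le>n div 2. epow q (w / 2) * epow (n - 2 * q) z)"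
  let ?N = "Suc (Suc n)"
  have div: "?N div 2 = Suc (n div 2)" by simp
  have tm: "of_nat ?N * (epow q (w / 2) * epow (?N - 2 * q) z)
      = z * (epow q (w / 2) * epow' (?N - 2 * q) z) + w * (epow' q (w / 2) * epow (?N - 2 * q) z)"
    if "q \<le> Suc (n div 2)" for q
  proof -
    have "2 * q \<le> ?N" using that by simp
    then have "(of_nat ?N :: complex) = of_nat (?N - 2 * q) + of_nat (2 * q)"
      by (metis le_add_diff_inverse2 of_nat_add)
    then have "of_nat ?N * (epow q (w / 2) * epow (?N - 2 * q) z)
      = epow q (w / 2) * (of_nat (?N - 2 * q) * epow (?N - 2 * q) z) + 2 * (of_nat q * epow q (w / 2)) * epow (?N - 2 * q) z"
      by (simp only: of_nat_mult of_nat_numeral ring_distribs mult_ac)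
    then show ?thesis unfolding of_nat_epow by (simp add: mult_ac)
  qed
  have s1: "(\<Sum>q\<le>Suc (n div 2). epow q (w / 2) * epow' (?N - 2 * q) z) = Q (Suc n)"
  proof -
    have "(\<Sum>q\<le>Suc (n div 2). epow q (w / 2) * epow' (?N - 2 * q) z)
        = (\<Sum>q\<le>Suc n div 2. epow q (w / 2) * epow' (?N - 2 * q) z)"
    \<comment> \<open>For even n the longer range has one index more; there the exponent of z is 0,
      where \<open>epow'\<close> vanishes.\<close>
    proof (rule sum.mono_neutral_right)
      show "{..Suc n div 2} \<subseteq> {..Suc (n div 2)}" by auto
      show "\<forall>q\<in>{..Suc (n div 2)} - {..Suc n div 2}. epow q (w / 2) * epow' (?N - 2 * q) z = 0"
      proof
        fix q assume "q \<in> {..Suc (n div 2)} - {..Suc n div 2}"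
        then have "?N - 2 * q = 0" by auto
        then show "epow q (w / 2) * epow' (?N - 2 * q) z = 0" by (simp only: epow'_0 mult_zero_right)
      qed
    qed simp
    also have "\<dots> = Q (Suc n)"
      unfolding Q_def
    proof (rule sum.cong[OF refl])
      fix q assume "q \<in> {..Suc n div 2}"
      then have "?N - 2 * q = Suc (Suc n - 2 * q)" by auto
      then show "epow q (w / 2) * epow' (?N - 2 * q) z = epow q (w / 2) * epow (Suc n - 2 * q) z"
        by (simp only: epow'_Suc)
    qed
    finally show ?thesis .
  qed
  have s2: "(\<Sum>q\<le>Suc (n div 2). epow' q (w / 2) * epow (?N - 2 * q) z) = Q n"
    unfolding sum.atMost_Suc_shift Q_def by simp
  have "of_nat ?N * Q ?N = (\<Sum>q\<le>Suc (n div 2). z * (epow q (w / 2) * epow' (?N - 2 * q) z)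
      + w * (epow' q (w / 2) * epow (?N - 2 * q) z))"
    unfolding Q_def div sum_distrib_left by (rule sum.cong[OF refl]) (simp only: tm atMost_iff)
  then have rec: "of_nat ?N * Q ?N = z * Q (Suc n) + w * Q n"
    unfolding sum.distrib sum_distrib_left[symmetric] s1 s2 .
  have P: "P_poly i z w = fact i * Q i" for i by (simp only: P_poly_epow Q_def)
  have "P_poly ?N z w = fact (Suc n) * (of_nat ?N * Q ?N)"
    unfolding P by (simp only: fact_Suc[of "Suc n"] mult_ac)
  also have "\<dots> = z * P_poly (Suc n) z w + of_nat (Suc n) * (w * P_poly n z w)"
    unfolding rec P by (simp only: fact_Suc[of n] ring_distribs mult_ac)
  finally show ?thesis .
qed

context jacobi_rep
begin

text \<open>Terms of \<open>E p\<close> with at least one a^+ drop out, because a annihilates K'_+^m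
  e_0. Hence the result does not depend on z.\<close>

lemma cinner_E_B_pow:
  assumes "p \<in> DJ"
  shows "cinner (E p) ((oB ^^ m) e0) = cnj (snd p) ^ m * pochhammer (2 * of_real k') m"
proof (rule sums_unique2)
  let ?c = "cnj (epow m (snd p)) * (fact m * pochhammer (2 * of_real k') m)"
  have s: "(oB ^^ m) e0 \<in> SV" using e0_smooth by simp
  show "(\<lambda>N. cinner (pseries cvec N p) ((oB ^^ m) e0)) sums cinner (E p) ((oB ^^ m) e0)"
    by (intro cinner_sums_left E_sums assms)
  have z: "cinner (cvec (Suc i) j) ((oB ^^ m) e0) = 0" for i j
    unfolding A_cvec[symmetric] adj(1)[OF SV_cvec s] a_B_pow by simp
  have "cinner (pseries cvec N p) ((oB ^^ m) e0)
      = (\<Sum>i\<le>N. if i = 0 then cnj (epow N (snd p)) * cinner ((oKp ^^ N) e0) ((oB ^^ m) e0) else 0)" for N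
    unfolding pseries_def cinner_sum_left
  proof (rule sum.cong[OF refl])
    fix i assume "i \<in> {..N}"
    show "cinner ((epow i (fst p) * epow (N - i) (snd p)) *\<^sub>C cvec i (N - i)) ((oB ^^ m) e0)
      = (if i = 0 then cnj (epow N (snd p)) * cinner ((oKp ^^ N) e0) ((oB ^^ m) e0) else 0)"
      by (cases i) (simp_all add: cinner_scaleC_left z, simp add: cvec_def)
  qed
  then have "cinner (pseries cvec N p) ((oB ^^ m) e0) = (if N = m then ?c else 0)" for N
    by (simp add: cinner_Kp_pow_B_pow)
  then have "(\<lambda>N. cinner (pseries cvec N p) ((oB ^^ m) e0)) sums ?c"
    using sums_single[of m "\<lambda>_. ?c"] by simp
  then show "(\<lambda>N. cinner (pseries cvec N p) ((oB ^^ m) e0)) sums (cnj (snd p) ^ m * pochhammer (2 * of_real k') m)"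
    by (simp add: epow_def)
qed

text \<open>Paired with \<open>E p\<close>, the operator a^+ acts as conj z + conj w a, and a lowers
  (a^+)^n with the factor n. This is the recurrence of the P_n.\<close>

lemma cinner_E_A_B_pow:
  assumes "p \<in> DJ"
  shows "cinner (E p) ((oA ^^ n) ((oB ^^ m) e0))
    = P_poly n (cnj (fst p)) (cnj (snd p)) * (cnj (snd p) ^ m * pochhammer (2 * of_real k') m)"
proof -
  let ?x = "(oB ^^ m) e0"
  let ?G = "\<lambda>n. cinner (E p) ((oA ^^ n) ?x)"
  let ?P = "\<lambda>n. P_poly n (cnj (fst p)) (cnj (snd p))"
  have s: "?x \<in> SV" "(oA ^^ i) ?x \<in> SV" for i using e0_smooth by simp_all
  have z: "(oA ^^ i) 0 = 0" for i by (induction i) (simp_all add: op_zero)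
  have 1: "?G (Suc 0) = cnj (fst p) * ?G 0"
    using cinner_A_E[OF assms s(1)] by (simp add: a_B_pow)
  have 2: "?G (Suc (Suc i)) = cnj (fst p) * ?G (Suc i) + cnj (snd p) * (of_nat (Suc i) * ?G i)" for i
  proof -
    have "?G (Suc (Suc i)) = cinner (E p) (oA ((oA ^^ Suc i) ?x))" by simp
    then show ?thesis
      unfolding cinner_A_E[OF assms s(2)] a_A_pow[OF s(1)] a_B_pow z add_0 cinner_scaleC_right .
  qed
  have "?G n = ?P n * ?G 0 \<and> ?G (Suc n) = ?P (Suc n) * ?G 0" for n
  proof (induction n)
    case 0
    show ?case unfolding 1 P_poly_0 P_poly_1 by simp
  next
    case (Suc n)
    have "?G (Suc (Suc n)) = ?P (Suc (Suc n)) * ?G 0"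
      unfolding 2 P_poly_rec conjunct1[OF Suc] conjunct2[OF Suc] by (simp only: ring_distribs mult_ac)
    with Suc show ?case by blast
  qed
  then have "?G n = ?P n * ?G 0" by blast
  then show ?thesis by (simp only: funpow_0 cinner_E_B_pow[OF assms])
qed

lemma conj2_DJ: "p \<in> DJ \<Longrightarrow> conj2 p \<in> DJ"
  by (cases p) (simp add: conj2_def DJ_def)

lemma coh_fun_eq: "p \<in> DJ \<Longrightarrow> coh_fun U e0 \<psi> p = cinner (E (conj2 p)) \<psi>"
  by (simp add: coh_fun_def coherent_eq)

text \<open>The Pochhammer symbol is the quotient \<Gamma>(m + 2k') / \<Gamma>(2k'). Multiplying the
  normalizing square root by it inverts the quotient of Gamma values under the root.\<close>

lemma coh_fun_basis:
  assumes "cmod w < 1"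
  shows "coh_fun U e0 (basis_vec U e0 k' n m) (z, w) =
    complex_of_real (sqrt (Gamma (real m + 2 * k') / (fact m * Gamma (2 * k'))))
      * w ^ m * (P_poly n z w / complex_of_real (sqrt (fact n)))"
proof -
  have DJ: "(z, w) \<in> DJ" using assms by (simp add: DJ_def)
  define a where "a = Gamma (2 * k')"
  define b where "b = Gamma (real m + 2 * k')"
  have ab: "a > 0" "b > 0" using k'_pos by (simp_all add: a_def b_def Gamma_real_pos)
  have "2 * k' \<notin> \<int>\<^sub>\<le>\<^sub>0" using k'_pos by (metis nonpos_Ints_nonpos not_le)
  then have poch: "pochhammer (2 * k') m = b / a"
    using pochhammer_Gamma[of "2 * k'" m] by (simp add: a_def b_def add.commute)
  have r: "sqrt (a / (fact m * b)) * (b / a) = sqrt (b / (fact m * a))"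
  proof -
    have "b / a = sqrt ((b / a)\<^sup>2)" using ab by simp
    then have "sqrt (a / (fact m * b)) * (b / a) = sqrt (a / (fact m * b) * (b / a)\<^sup>2)"
      by (simp only: real_sqrt_mult)
    also have "a / (fact m * b) * (b / a)\<^sup>2 = b / (fact m * a)"
      using ab by (simp add: power2_eq_square)
    finally show ?thesis .
  qed
  have "coh_fun U e0 (basis_vec U e0 k' n m) (z, w)
    = complex_of_real (1 / sqrt (fact n) * sqrt (a / (fact m * b)))
      * (P_poly n z w * (w ^ m * pochhammer (2 * of_real k') m))"
    unfolding coh_fun_eq[OF DJ] basis_vec_def cinner_scaleC_right cinner_E_A_B_pow[OF conj2_DJ[OF DJ]]
    by (simp add: conj2_def a_def b_def)
  also have "pochhammer (2 * complex_of_real k') m = of_real (b / a)"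
    using poch by (metis of_real_mult of_real_numeral pochhammer_of_real)
  also have "complex_of_real (1 / sqrt (fact n) * sqrt (a / (fact m * b))) * (P_poly n z w * (w ^ m * of_real (b / a)))
    = complex_of_real (sqrt (a / (fact m * b)) * (b / a)) * w ^ m * (P_poly n z w / complex_of_real (sqrt (fact n)))"
    by (simp add: mult_ac)
  finally show ?thesis unfolding r unfolding a_def b_def .
qed

end

subsection \<open>One-parameter subgroups\<close>

context jacobi_rep
begin

definition one_param :: "(real \<Rightarrow> jacobi) \<Rightarrow> bool" where
  "one_param \<gamma> \<longleftrightarrow> \<gamma> 0 = jacobi_one \<and> (\<forall>s. \<gamma> s \<in> jacobi_group) \<and> (\<forall>s t. \<gamma> (s + t) = jacobi_mult (\<gamma> s) (\<gamma> t))"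

text \<open>The graph of the infinitesimal generator, as a relation; it makes sense for vectors that
  are not known to be smooth.\<close>

definition gen :: "(real \<Rightarrow> jacobi) \<Rightarrow> 'h \<Rightarrow> 'h \<Rightarrow> bool" where
  "gen \<gamma> v x \<longleftrightarrow> ((\<lambda>h. U (\<gamma> h) v) has_vector_derivative x) (at 0)"

lemma gen_at:
  assumes \<gamma>: "one_param \<gamma>" and g: "gen \<gamma> v x"
  shows "((\<lambda>h. U (\<gamma> h) v) has_vector_derivative U (\<gamma> s) x) (at s)"
proof -
  have grp: "\<gamma> s \<in> jacobi_group" for s using \<gamma> by (simp add: one_param_def)
  have "((\<lambda>t. t - s) has_vector_derivative 1) (at s)" by (auto intro!: derivative_eq_intros)
  moreover have "((\<lambda>h. U (\<gamma> h) v) has_vector_derivative x) (at (s - s))" using g by (simp add: gen_def)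
  ultimately have "((\<lambda>h. U (\<gamma> h) v) \<circ> (\<lambda>t. t - s) has_vector_derivative (1 *\<^sub>R x)) (at s)"
    by (rule vector_diff_chain_at)
  from bounded_linear.has_vector_derivative[OF bounded_linear_U[OF grp[of s]] this]
  have "((\<lambda>t. U (\<gamma> s) (U (\<gamma> (t - s)) v)) has_vector_derivative U (\<gamma> s) x) (at s)" by (simp add: o_def)
  moreover have "U (\<gamma> s) (U (\<gamma> (t - s)) v) = U (\<gamma> t) v" for t
  proof -
    have "\<gamma> t = jacobi_mult (\<gamma> s) (\<gamma> (t - s))"
      using \<gamma> unfolding one_param_def by (metis add.commute diff_add_cancel)
    then show ?thesis using U_mult[OF grp grp] by simp
  qed
  ultimately show ?thesis by simp
qed

text \<open>Curves tangent to the generator are orbits. The generator of a unitary group is skew, so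
  all scalar products between c s and the orbit of c 0 are constant in s; their distance is 0 at s =
  0 and stays 0.\<close>

lemma flow:
  assumes \<gamma>: "one_param \<gamma>"
    and c: "\<And>s. (c has_vector_derivative c' s) (at s)" and g: "\<And>s. gen \<gamma> (c s) (c' s)"
  shows "U (\<gamma> s) (c 0) = c s"
proof -
  have grp: "\<gamma> s \<in> jacobi_group" for s using \<gamma> by (simp add: one_param_def)
  have U0: "U (\<gamma> 0) x = x" for x using \<gamma> by (simp add: one_param_def U_one)
  define u where "u = (\<lambda>s. U (\<gamma> s) (c 0))"
  define u' where "u' = (\<lambda>s. U (\<gamma> s) (c' 0))"
  have u: "(u has_vector_derivative u' s) (at s)" for s
    unfolding u_def u'_def by (rule gen_at[OF \<gamma> g])
  have gu: "gen \<gamma> (u s) (u' s)" for s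
  proof -
    have "((\<lambda>h. h + s) has_vector_derivative 1) (at 0)" by (auto intro!: derivative_eq_intros)
    from vector_diff_chain_at[OF this, of u "u' s"] u[of s]
    have "((\<lambda>h. u (h + s)) has_vector_derivative u' s) (at 0)" by (simp add: o_def)
    moreover have "u (h + s) = U (\<gamma> h) (u s)" for h
      using \<gamma> U_mult[OF grp grp] by (simp add: u_def one_param_def)
    ultimately show ?thesis unfolding gen_def by simp
  qed
  have skew: "cinner x y' + cinner x' y = 0" if "gen \<gamma> x x'" "gen \<gamma> y y'" for x x' y y'
  proof -
    have "((\<lambda>h. cinner (U (\<gamma> h) x) (U (\<gamma> h) y)) has_vector_derivative
        (cinner (U (\<gamma> 0) x) y' + cinner x' (U (\<gamma> 0) y))) (at 0)"
      using that unfolding gen_def by (rule bounded_bilinear.has_vector_derivative[OF bounded_bilinear_cinner])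
    then have "((\<lambda>h. cinner x y) has_vector_derivative (cinner x y' + cinner x' y)) (at 0)"
      by (simp only: cinner_U[OF grp] U0)
    from vector_derivative_unique_at[OF this has_vector_derivative_const] show ?thesis .
  qed
  have const: "cinner (f s) (h s) = cinner (f 0) (h 0)"
    if "\<And>s. (f has_vector_derivative f' s) (at s)" "\<And>s. (h has_vector_derivative h' s) (at s)"
      "\<And>s. gen \<gamma> (f s) (f' s)" "\<And>s. gen \<gamma> (h s) (h' s)" for f f' h h' s
  proof -
    have D: "((\<lambda>s. cinner (f s) (h s)) has_vector_derivative 0) (at s within UNIV)" for s
      using bounded_bilinear.has_vector_derivative[OF bounded_bilinear_cinner that(1,2), of s]
      by (simp add: skew[OF that(3,4)])
    obtain d where d: "\<And>s. s \<in> UNIV \<Longrightarrow> cinner (f s) (h s) = d"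
    proof (rule has_vector_derivative_zero_constant[OF convex_UNIV D])
      fix d assume h: "\<And>s. s \<in> UNIV \<Longrightarrow> cinner (f s) (h s) = d"
      show thesis by (rule that, rule h)
    qed
    show ?thesis unfolding d[OF UNIV_I] ..
  qed
  have "u 0 = c 0" by (simp add: u_def U0)
  have "cinner (u s - c s) (u s - c s) = cinner (u s) (u s) - cinner (u s) (c s) - cinner (c s) (u s) + cinner (c s) (c s)"
    by (simp add: cinner_diff_left cinner_diff_right)
  also have "\<dots> = 0"
    unfolding const[OF u u gu gu, of s] const[OF u c gu g, of s] const[OF c u g gu, of s] const[OF c c g g, of s] \<open>u 0 = c 0\<close> by simp
  finally have "u s = c s" by (simp add: cinner_self)
  then show ?thesis by (simp add: u_def)
qed

text \<open>The generator is closed: by unitarity the derivatives U (\<gamma> s) (x n) converge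
  uniformly in s, so the limit may be differentiated.\<close>

lemma gen_limit:
  assumes \<gamma>: "one_param \<gamma>" and g: "\<And>n. gen \<gamma> (v n) (x n)" and v: "v \<longlonglongrightarrow> v'" and x: "x \<longlonglongrightarrow> x'"
  shows "gen \<gamma> v' x'"
proof -
  have grp: "\<gamma> s \<in> jacobi_group" for s using \<gamma> by (simp add: one_param_def)
  have U0: "U (\<gamma> 0) x = x" for x using \<gamma> by (simp add: one_param_def U_one)
  have "\<exists>f. \<forall>s\<in>UNIV. (\<lambda>n. U (\<gamma> s) (v n)) \<longlonglongrightarrow> f s \<and> (f has_derivative (\<lambda>h. h *\<^sub>R U (\<gamma> s) x')) (at s within UNIV)"
  proof (rule has_derivative_sequence[where f' = "\<lambda>n s h. h *\<^sub>R U (\<gamma> s) (x n)" and ?x0.0 = 0 and l = v'])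
    show "((\<lambda>s. U (\<gamma> s) (v n)) has_derivative (\<lambda>h. h *\<^sub>R U (\<gamma> s) (x n))) (at s within UNIV)" for n s
      using gen_at[OF \<gamma> g] unfolding has_vector_derivative_def .
    fix e :: real assume "e > 0"
    with x have "\<forall>\<^sub>F n in sequentially. norm (x n - x') < e" by (simp add: tendsto_iff dist_norm)
    then show "\<forall>\<^sub>F n in sequentially. \<forall>s\<in>UNIV. \<forall>h. norm (h *\<^sub>R U (\<gamma> s) (x n) - h *\<^sub>R U (\<gamma> s) x') \<le> e * norm h"
    proof (rule eventually_mono, intro ballI allI)
      fix n s and h :: real assume "norm (x n - x') < e"
      moreover have "h *\<^sub>R U (\<gamma> s) (x n) - h *\<^sub>R U (\<gamma> s) x' = h *\<^sub>R U (\<gamma> s) (x n - x')"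
        using linear_diff[OF bounded_linear.linear[OF bounded_linear_U[OF grp]]] by (simp add: scaleR_diff_right)
      ultimately show "norm (h *\<^sub>R U (\<gamma> s) (x n) - h *\<^sub>R U (\<gamma> s) x') \<le> e * norm h"
        using mult_left_mono[of "norm (x n - x')" e "\<bar>h\<bar>"] by (simp add: norm_U[OF grp] mult.commute)
    qed
  qed (use v U0 in simp_all)
  then obtain f where f': "\<forall>s\<in>UNIV. (\<lambda>n. U (\<gamma> s) (v n)) \<longlonglongrightarrow> f s
    \<and> (f has_derivative (\<lambda>h. h *\<^sub>R U (\<gamma> s) x')) (at s within UNIV)" by (rule exE)
  have f: "(\<lambda>n. U (\<gamma> s) (v n)) \<longlonglongrightarrow> f s"
    "(f has_derivative (\<lambda>h. h *\<^sub>R U (\<gamma> 0) x')) (at 0)" for s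
    using bspec[OF f' UNIV_I[of s]] bspec[OF f' UNIV_I[of 0]] by simp_all
  have "f s = U (\<gamma> s) v'" for s
    using LIMSEQ_unique[OF f(1) bounded_linear.tendsto[OF bounded_linear_U[OF grp] v]] .
  then have "f = (\<lambda>s. U (\<gamma> s) v')" by blast
  with f(2) show ?thesis unfolding gen_def has_vector_derivative_def U0 by simp
qed

lemma gen_chart:
  assumes v: "v \<in> SV" and \<kappa>: "(\<kappa> has_vector_derivative X) (at 0)" "\<kappa> 0 = 0"
    and \<gamma>: "\<And>h. \<gamma> h = jacobi_chart (\<kappa> h)"
  shows "gen \<gamma> v (derived_rep U X v)"
proof -
  have "((\<lambda>p. U (jacobi_chart p) v) has_derivative (\<lambda>X. derived_rep U X v)) (at (\<kappa> 0))"
    using has_derivative_orbit[OF v] \<kappa>(2) by simp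
  from has_derivative_compose[OF \<kappa>(1)[unfolded has_vector_derivative_def] this]
  show ?thesis
    unfolding gen_def has_vector_derivative_def \<gamma> by (simp add: derived_rep_linear(2)[OF v])
qed

end

subsection \<open>The orbit of the lowest weight vector\<close>

lemma has_vector_derivative_exp_real:
  "((\<lambda>s. exp (\<kappa> * of_real s)) has_vector_derivative (\<kappa> * exp (\<kappa> * of_real s))) (at s)"
  for \<kappa> :: complex
proof -
  have "((\<lambda>z. exp (\<kappa> * z)) has_field_derivative (exp (\<kappa> * of_real s) * \<kappa>)) (at (of_real s))"
    by (auto intro!: derivative_eq_intros)
  from has_vector_derivative_real_field[OF this] show ?thesis by (simp add: mult.commute)
qed

context jacobi_rep
begin

definition centre_curve :: "real \<Rightarrow> jacobi" where "centre_curve s = (su_mat 1 0, 0, s)"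
definition rot_curve :: "real \<Rightarrow> jacobi" where "rot_curve s = (su_mat (cis s) 0, 0, 0)"
definition heis_curve :: "complex \<Rightarrow> real \<Rightarrow> jacobi" where
  "heis_curve \<beta> s = (su_mat 1 0, of_real s * \<beta>, 0)"
text \<open>In the chart of the group this is the point with \<theta> = 0 and b = y sinh s, because
  sqrt (1 + sinh^2 s) = cosh s when |y| = 1.\<close>

definition hyp_curve :: "complex \<Rightarrow> real \<Rightarrow> jacobi" where
  "hyp_curve y s = (su_mat (of_real (cosh s)) (y * of_real (sinh s)), 0, 0)"

lemma cosh_sinh_sq: "(cosh s)\<^sup>2 = 1 + (sinh s)\<^sup>2" for s :: real
  using hyperbolic_pythagoras[of s] by simp

lemma one_param_curves:
  shows "one_param centre_curve" "one_param rot_curve" "one_param (heis_curve \<beta>)"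
    and "cmod y = 1 \<Longrightarrow> one_param (hyp_curve y)"
proof -
  have g1: "(mat 1, x, t) \<in> jacobi_group" for x t
    using jacobi_groupI[of 1 0 x t] by (simp add: su_mat_one)
  show "one_param centre_curve"
    unfolding one_param_def centre_curve_def jacobi_mult_su_mat
    by (simp add: g1 jacobi_one_def su_mat_one)
  show "one_param rot_curve"
    unfolding one_param_def rot_curve_def jacobi_mult_su_mat
    by (simp add: jacobi_groupI jacobi_one_def su_mat_one cis_mult)
  have "Im (of_real s * \<beta> * cnj (of_real t * \<beta>)) = 0" for s t
    by (simp add: mult.commute)
  then show "one_param (heis_curve \<beta>)"
    unfolding one_param_def heis_curve_def jacobi_mult_su_mat
    by (simp add: g1 jacobi_one_def su_mat_one distrib_right)
  assume y: "cmod y = 1"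
  have yy: "y * cnj y = 1" using y by (simp flip: complex_norm_square)
  have "(cmod (complex_of_real (cosh s)))\<^sup>2 - (cmod (y * of_real (sinh s)))\<^sup>2 = 1" for s
    using y by (simp add: norm_mult cosh_sinh_sq)
  moreover have "complex_of_real (cosh (s + t)) = of_real (cosh s) * of_real (cosh t) + y * of_real (sinh s) * cnj (y * of_real (sinh t))"
    for s t
  proof -
    have "y * of_real (sinh s) * cnj (y * of_real (sinh t)) = (y * cnj y) * (of_real (sinh s) * of_real (sinh t))"
      by (simp only: complex_cnj_mult complex_cnj_complex_of_real mult_ac)
    then show ?thesis unfolding yy by (simp add: cosh_add)
  qed
  moreover have "y * complex_of_real (sinh (s + t)) = of_real (cosh s) * (y * of_real (sinh t)) + y * of_real (sinh s) * cnj (of_real (cosh t))"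
    for s t by (simp add: sinh_add algebra_simps)
  moreover have "hyp_curve y 0 = jacobi_one"
    by (simp add: hyp_curve_def jacobi_one_def su_mat_one)
  ultimately show "one_param (hyp_curve y)"
    unfolding one_param_def by (simp add: hyp_curve_def jacobi_mult_su_mat jacobi_groupI del: jacobi_mult.simps)
qed

lemma gen_centre: "v \<in> SV \<Longrightarrow> gen centre_curve v (\<i> *\<^sub>C v)"
proof -
  assume v: "v \<in> SV"
  have "((\<lambda>h. (0 :: real, 0 :: complex, 0 :: complex, h :: real)) has_vector_derivative (0, 0, 0, 1)) (at 0)"
    by (intro has_vector_derivative_Pair has_vector_derivative_const has_vector_derivative_id)
  from gen_chart[OF v this, of centre_curve] show ?thesis
    by (simp add: centre_curve_def rel(1)[OF v] zero_prod_def)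
qed

lemma gen_rot: "v \<in> SV \<Longrightarrow> gen rot_curve v ((2 * \<i>) *\<^sub>C oK0 v)"
proof -
  assume v: "v \<in> SV"
  have "((\<lambda>h. (h :: real, 0 :: complex, 0 :: complex, 0 :: real)) has_vector_derivative (1, 0, 0, 0)) (at 0)"
    by (intro has_vector_derivative_Pair has_vector_derivative_const has_vector_derivative_id)
  from gen_chart[OF v this, of rot_curve] show ?thesis
    by (simp add: rot_curve_def derived_rep_K0 zero_prod_def)
qed

lemma gen_heis: "v \<in> SV \<Longrightarrow> gen (heis_curve \<beta>) v (\<beta> *\<^sub>C oA v - cnj \<beta> *\<^sub>C oa v)"
proof -
  assume v: "v \<in> SV"
  have "((\<lambda>h. of_real h * \<beta>) has_vector_derivative (of_real 1 * \<beta>)) (at 0)"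
    by (intro has_vector_derivative_mult_left has_vector_derivative_of_real DERIV_ident)
  then have "((\<lambda>h. of_real h * \<beta>) has_vector_derivative \<beta>) (at 0)" by simp
  then have "((\<lambda>h. (0 :: real, 0 :: complex, of_real h * \<beta>, 0 :: real)) has_vector_derivative (0, 0, \<beta>, 0)) (at 0)"
    by (intro has_vector_derivative_Pair has_vector_derivative_const)
  from gen_chart[OF v this, of "heis_curve \<beta>"] show ?thesis
    by (simp add: heis_curve_def derived_rep_heis[OF v] zero_prod_def)
qed

lemma gen_hyp:
  assumes y: "cmod y = 1" and v: "v \<in> SV"
  shows "gen (hyp_curve y) v (y *\<^sub>C oKp v - cnj y *\<^sub>C oKm v)"
proof -
  have "((\<lambda>h. of_real (sinh h)) has_vector_derivative complex_of_real (cosh 0 * 1)) (at 0)"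
    by (rule has_vector_derivative_of_real) (auto intro!: derivative_eq_intros)
  from has_vector_derivative_mult_right[OF this, of y]
  have "((\<lambda>h. y * of_real (sinh h)) has_vector_derivative y) (at 0)" by simp
  then have d: "((\<lambda>h. (0 :: real, y * of_real (sinh h), 0 :: complex, 0 :: real)) has_vector_derivative (0, y, 0, 0)) (at 0)"
    by (intro has_vector_derivative_Pair has_vector_derivative_const)
  have "sqrt (1 + (cmod (y * of_real (sinh h)))\<^sup>2) = cosh h" for h :: real
  proof -
    have "1 + (cmod (y * of_real (sinh h)))\<^sup>2 = (cosh h)\<^sup>2" using y by (simp add: norm_mult cosh_sinh_sq)
    then show ?thesis by simp
  qed
  then have "hyp_curve y h = jacobi_chart (0, y * of_real (sinh h), 0, 0)" for h
    by (simp add: hyp_curve_def del: of_real_mult)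
  from gen_chart[OF v d _ this] show ?thesis
    by (simp add: derived_rep_su[OF v] zero_prod_def)
qed

lemma U_centre: "U (centre_curve s) e0 = exp (\<i> * of_real s) *\<^sub>C e0"
proof -
  have "U (centre_curve s) (exp (\<i> * of_real 0) *\<^sub>C e0) = exp (\<i> * of_real s) *\<^sub>C e0"
  proof (rule flow[OF one_param_curves(1), where c' = "\<lambda>s. (\<i> * exp (\<i> * of_real s)) *\<^sub>C e0"])
    show "((\<lambda>s. exp (\<i> * of_real s) *\<^sub>C e0) has_vector_derivative (\<i> * exp (\<i> * of_real s)) *\<^sub>C e0) (at s)" for s
      by (rule bounded_linear.has_vector_derivative[OF bounded_linear_scaleC_left has_vector_derivative_exp_real])
    show "gen centre_curve (exp (\<i> * of_real s) *\<^sub>C e0) ((\<i> * exp (\<i> * of_real s)) *\<^sub>C e0)" for s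
      using gen_centre[OF SV_scaleC[OF e0_smooth, of "exp (\<i> * of_real s)"]] by (simp add: scaleC_scaleC)
  qed
  then show ?thesis by simp
qed

lemma U_rot: "U (rot_curve s) e0 = exp (2 * \<i> * of_real k * of_real s) *\<^sub>C e0"
proof -
  let ?\<kappa> = "2 * \<i> * complex_of_real k"
  have "U (rot_curve s) (exp (?\<kappa> * of_real 0) *\<^sub>C e0) = exp (?\<kappa> * of_real s) *\<^sub>C e0"
  proof (rule flow[OF one_param_curves(2), where c' = "\<lambda>s. (?\<kappa> * exp (?\<kappa> * of_real s)) *\<^sub>C e0"])
    show "((\<lambda>s. exp (?\<kappa> * of_real s) *\<^sub>C e0) has_vector_derivative (?\<kappa> * exp (?\<kappa> * of_real s)) *\<^sub>C e0) (at s)" for s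
      by (rule bounded_linear.has_vector_derivative[OF bounded_linear_scaleC_left has_vector_derivative_exp_real])
    show "gen rot_curve (exp (?\<kappa> * of_real s) *\<^sub>C e0) ((?\<kappa> * exp (?\<kappa> * of_real s)) *\<^sub>C e0)" for s
      using gen_rot[OF SV_scaleC[OF e0_smooth, of "exp (?\<kappa> * of_real s)"]]
      by (simp add: scaleC_scaleC op_scaleC e0_smooth e0_lowest mult_ac)
  qed
  then show ?thesis by simp
qed

lemma has_vector_derivative_E:
  assumes "p s \<in> DJ" "((\<lambda>s. fst (p s)) has_vector_derivative a) (at s)" "((\<lambda>s. snd (p s)) has_vector_derivative b) (at s)"
  shows "((\<lambda>s. E (p s)) has_vector_derivative (a *\<^sub>C EA (p s) + b *\<^sub>C EK (p s))) (at s)"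
proof -
  have "(p has_vector_derivative (a, b)) (at s)"
    using has_vector_derivative_Pair[OF assms(2,3)] by simp
  from has_derivative_compose[OF this[unfolded has_vector_derivative_def] has_derivative_E[OF assms(1)]]
  show ?thesis
    unfolding has_vector_derivative_def
    by (rule has_derivative_eq_rhs) (simp add: fun_eq_iff scaleC_scaleC scaleR_conv_of_real scaleC_add_right flip: scaleC_of_real)
qed

lemma partial_sums_SV: "(\<Sum>M<N. pseries cvec M p) \<in> SV"
  by (rule SV_sum) (rule SV_pseries(1))

text \<open>True for the partial sums, which are smooth vectors; their images under the generator
  converge, and the generator is closed.\<close>

lemma gen_heis_E:
  assumes p: "p \<in> DJ"
  shows "gen (heis_curve \<beta>) (c *\<^sub>C E p) (c *\<^sub>C (\<beta> *\<^sub>C EA p - cnj \<beta> *\<^sub>C (fst p *\<^sub>C E p + snd p *\<^sub>C EA p)))"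
proof (rule gen_limit[OF one_param_curves(3)])
  let ?S = "\<lambda>N. \<Sum>M<N. pseries cvec M p"
  have S: "?S N \<in> SV" for N by (rule partial_sums_SV)
  show "gen (heis_curve \<beta>) (c *\<^sub>C ?S N) (c *\<^sub>C (\<beta> *\<^sub>C (\<Sum>M<N. pseries (shift1 cvec) M p) - cnj \<beta> *\<^sub>C (\<Sum>M<N. oa (pseries cvec M p))))" for N
    using gen_heis[OF SV_scaleC[OF S[of N]], where \<beta> = \<beta>, of c]
    by (simp add: op_scaleC[OF S] op_sum SV_pseries A_pseries scaleC_diff_right scaleC_scaleC mult.commute)
  show "(\<lambda>N. c *\<^sub>C ?S N) \<longlonglongrightarrow> c *\<^sub>C E p"
    by (intro bounded_linear.tendsto[OF bounded_linear_scaleC_right] E_sums(1)[OF p, unfolded sums_def])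
  show "(\<lambda>N. c *\<^sub>C (\<beta> *\<^sub>C (\<Sum>M<N. pseries (shift1 cvec) M p) - cnj \<beta> *\<^sub>C (\<Sum>M<N. oa (pseries cvec M p))))
      \<longlonglongrightarrow> c *\<^sub>C (\<beta> *\<^sub>C EA p - cnj \<beta> *\<^sub>C (fst p *\<^sub>C E p + snd p *\<^sub>C EA p))"
    by (intro bounded_linear.tendsto[OF bounded_linear_scaleC_right] tendsto_diff
        E_sums(2)[OF p, unfolded sums_def] a_E_sums[OF p, unfolded sums_def])
qed

text \<open>Ansatz f(s) E(s q, w). Comparison with the generator forces the velocity q = \<beta> - w
  conj \<beta> and the scalar equation f' = \<kappa> s f with \<kappa> = - q conj \<beta>.\<close>

lemma U_heis:
  assumes w: "cmod w < 1"
  shows "U (heis_curve \<beta> s) (E (0, w)) = exp ((w * (cnj \<beta>)\<^sup>2 - \<beta> * cnj \<beta>) / 2 * (of_real s)\<^sup>2) *\<^sub>C E (of_real s * (\<beta> - w * cnj \<beta>), w)"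
proof -
  define q where "q = \<beta> - w * cnj \<beta>"
  define \<kappa> where "\<kappa> = w * (cnj \<beta>)\<^sup>2 - \<beta> * cnj \<beta>"
  define f where "f = (\<lambda>s. exp (\<kappa> / 2 * (complex_of_real s)\<^sup>2))"
  define p where "p = (\<lambda>s. (complex_of_real s * q, w))"
  have pDJ: "p s \<in> DJ" for s using w by (simp add: p_def DJ_def)
  have f: "(f has_vector_derivative (\<kappa> * of_real s * f s)) (at s)" for s
  proof -
    have "((\<lambda>z. exp (\<kappa> / 2 * z\<^sup>2)) has_field_derivative (exp (\<kappa> / 2 * (of_real s)\<^sup>2) * (\<kappa> * of_real s))) (at (of_real s))"
      by (auto intro!: derivative_eq_intros)
    from has_vector_derivative_real_field[OF this] show ?thesis unfolding f_def by (simp add: mult_ac)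
  qed
  have E': "((\<lambda>s. E (p s)) has_vector_derivative (q *\<^sub>C EA (p s) + 0 *\<^sub>C EK (p s))) (at s)" for s
  proof (rule has_vector_derivative_E[OF pDJ])
    have "((\<lambda>s. of_real s * q) has_vector_derivative (of_real 1 * q)) (at s)"
      by (intro has_vector_derivative_mult_left has_vector_derivative_of_real DERIV_ident)
    then show "((\<lambda>s. fst (p s)) has_vector_derivative q) (at s)"
      unfolding p_def fst_conv by simp
    show "((\<lambda>s. snd (p s)) has_vector_derivative 0) (at s)" unfolding p_def snd_conv by simp
  qed
  have "U (heis_curve \<beta> s) (f 0 *\<^sub>C E (p 0)) = f s *\<^sub>C E (p s)"
  proof (rule flow[OF one_param_curves(3)])
    show "((\<lambda>s. f s *\<^sub>C E (p s)) has_vector_derivative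
        (f s *\<^sub>C (q *\<^sub>C EA (p s) + 0 *\<^sub>C EK (p s)) + (\<kappa> * of_real s * f s) *\<^sub>C E (p s))) (at s)" for s
      by (rule bounded_bilinear.has_vector_derivative[OF bounded_bilinear_scaleC f E'])
    have "f s *\<^sub>C (\<beta> *\<^sub>C EA (p s) - cnj \<beta> *\<^sub>C (fst (p s) *\<^sub>C E (p s) + snd (p s) *\<^sub>C EA (p s)))
        = f s *\<^sub>C (q *\<^sub>C EA (p s) + 0 *\<^sub>C EK (p s)) + (\<kappa> * of_real s * f s) *\<^sub>C E (p s)" for s
    proof -
      have "\<kappa> = - (cnj \<beta> * q)" by (simp add: \<kappa>_def q_def power2_eq_square algebra_simps)
      then show ?thesis
        by (simp add: p_def q_def scaleC_add_right scaleC_diff_right scaleC_scaleC scaleC_diff_left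
            scaleC_minus_left right_diff_distrib left_diff_distrib mult_ac)
    qed
    with gen_heis_E[OF pDJ] show "gen (heis_curve \<beta>) (f s *\<^sub>C E (p s))
        (f s *\<^sub>C (q *\<^sub>C EA (p s) + 0 *\<^sub>C EK (p s)) + (\<kappa> * of_real s * f s) *\<^sub>C E (p s))" for s by metis
  qed
  then show ?thesis by (simp add: f_def p_def \<kappa>_def q_def)
qed

lemma Km_pseries_0: "oKm (pseries cvec 0 (0, w)) = 0"
  using e0_smooth by (simp add: pseries_zero op_scaleC e0_lowest)

text \<open>K_- acts on the series at (0, w) as 2 k w + w^2 d/dw; on the homogeneous part of degree
  N the operator w d/dw is multiplication by N.\<close>

lemma Km_pseries_Suc:
  "oKm (pseries cvec (Suc N) (0, w)) = (2 * of_real k * w) *\<^sub>C pseries cvec N (0, w) + w *\<^sub>C (of_nat N *\<^sub>C pseries cvec N (0, w))"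
proof -
  have "oKm (pseries cvec (Suc N) (0, w)) = (of_nat (Suc N) * epow (Suc N) w * (2 * of_real k + of_nat N)) *\<^sub>C (oKp ^^ N) e0"
    unfolding pseries_zero op_scaleC(5)[OF SV_pow(3)[OF e0_smooth]] Km_Kp_pow scaleC_scaleC by (simp only: mult_ac)
  also have "of_nat (Suc N) * epow (Suc N) w = w * epow N w" using of_nat_epow[of "Suc N" w] by (simp only: epow'_Suc)
  also have "(w * epow N w * (2 * of_real k + of_nat N)) *\<^sub>C (oKp ^^ N) e0
      = (2 * of_real k * w) *\<^sub>C pseries cvec N (0, w) + w *\<^sub>C (of_nat N *\<^sub>C pseries cvec N (0, w))"
    unfolding pseries_zero scaleC_scaleC scaleC_add_left[symmetric]
    by (simp only: ring_distribs mult_ac)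
  finally show ?thesis .
qed

lemma Km_E_sums:
  assumes w: "cmod w < 1"
  shows "(\<lambda>N. oKm (pseries cvec N (0, w))) sums ((2 * of_real k * w) *\<^sub>C E (0, w) + w *\<^sub>C (w *\<^sub>C EK (0, w)))"
proof -
  note DJ = zero_DJ[OF w]
  have "(\<lambda>N. of_nat (Suc N) *\<^sub>C pseries cvec (Suc N) (0, w)) sums (w *\<^sub>C EK (0, w))"
    unfolding pseries_euler fst_conv snd_conv scaleC_zero_left add_0 by (rule scaleC_sums[OF E_sums(3)[OF DJ]])
  then have "(\<lambda>N. of_nat N *\<^sub>C pseries cvec N (0, w)) sums (w *\<^sub>C EK (0, w))"
    using sums_Suc[of "\<lambda>N. of_nat N *\<^sub>C pseries cvec N (0, w)"] by simp
  then have "(\<lambda>N. oKm (pseries cvec (Suc N) (0, w))) sums ((2 * of_real k * w) *\<^sub>C E (0, w) + w *\<^sub>C (w *\<^sub>C EK (0, w)))"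
    unfolding Km_pseries_Suc by (intro sums_add scaleC_sums E_sums(1)[OF DJ])
  from sums_Suc[OF this] show ?thesis by (simp add: Km_pseries_0)
qed

lemma gen_hyp_E:
  assumes y: "cmod y = 1" and w: "cmod w < 1"
  shows "gen (hyp_curve y) (c *\<^sub>C E (0, w))
    (c *\<^sub>C (y *\<^sub>C EK (0, w) - cnj y *\<^sub>C ((2 * of_real k * w) *\<^sub>C E (0, w) + w *\<^sub>C (w *\<^sub>C EK (0, w)))))"
proof (rule gen_limit[OF one_param_curves(4)[OF y]])
  note DJ = zero_DJ[OF w]
  let ?S = "\<lambda>N. \<Sum>M<N. pseries cvec M (0, w)"
  have S: "?S N \<in> SV" for N by (rule partial_sums_SV)
  show "gen (hyp_curve y) (c *\<^sub>C ?S N) (c *\<^sub>C (y *\<^sub>C (\<Sum>M<N. pseries (shift2 cvec) M (0, w)) - cnj y *\<^sub>C (\<Sum>M<N. oKm (pseries cvec M (0, w)))))" for N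
    using gen_hyp[OF y SV_scaleC[OF S[of N]]]
    by (simp add: op_scaleC[OF S] op_sum SV_pseries Kp_pseries scaleC_diff_right scaleC_scaleC mult.commute)
  show "(\<lambda>N. c *\<^sub>C ?S N) \<longlonglongrightarrow> c *\<^sub>C E (0, w)"
    by (intro bounded_linear.tendsto[OF bounded_linear_scaleC_right] E_sums(1)[OF DJ, unfolded sums_def])
  show "(\<lambda>N. c *\<^sub>C (y *\<^sub>C (\<Sum>M<N. pseries (shift2 cvec) M (0, w)) - cnj y *\<^sub>C (\<Sum>M<N. oKm (pseries cvec M (0, w)))))
      \<longlonglongrightarrow> c *\<^sub>C (y *\<^sub>C EK (0, w) - cnj y *\<^sub>C ((2 * of_real k * w) *\<^sub>C E (0, w) + w *\<^sub>C (w *\<^sub>C EK (0, w))))"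
    by (intro bounded_linear.tendsto[OF bounded_linear_scaleC_right] tendsto_diff
        E_sums(3)[OF DJ, unfolded sums_def] Km_E_sums[OF w, unfolded sums_def])
qed

lemma E_zero: "E (0, 0) = e0"
proof -
  have "pseries cvec N (0, 0) = (if N = 0 then e0 else 0)" for N
    unfolding pseries_zero by (cases N) (simp_all add: epow_def)
  then have "(\<lambda>N. pseries cvec N (0, 0)) sums e0"
    using sums_single[of 0 "\<lambda>_. e0"] by simp
  with E_sums(1)[OF zero_DJ] show ?thesis by (metis norm_zero sums_unique2 zero_less_one)
qed

text \<open>The same kind of ansatz: the point y tanh s has velocity y (1 - tanh^2 s), and the
  scalar obeys f' = -2k tanh(s) f, so f is the power -2k of cosh s.\<close>

lemma U_hyp:
  assumes y: "cmod y = 1"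
  shows "U (hyp_curve y s) e0 = of_real (exp (- 2 * k * ln (cosh s))) *\<^sub>C E (0, y * of_real (tanh s))"
proof -
  define f where "f = (\<lambda>s. exp (- 2 * k * ln (cosh s)))"
  define w where "w = (\<lambda>s. y * complex_of_real (tanh s))"
  have w: "cmod (w s) < 1" for s
    using y tanh_real_lt_1[of s] tanh_real_gt_neg1[of s] by (simp add: w_def norm_mult abs_less_iff)
  have yy: "cnj y * y = 1" using y by (simp add: mult.commute flip: complex_norm_square)
  have f: "((\<lambda>s. complex_of_real (f s)) has_vector_derivative of_real (- 2 * k * tanh s * f s)) (at s)" for s
  proof (rule has_vector_derivative_of_real)
    have "cosh s > 0" by simp
    then show "(f has_field_derivative (- 2 * k * tanh s * f s)) (at s)"
      unfolding f_def by (auto intro!: derivative_eq_intros simp: tanh_def)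
  qed
  have wd: "(w has_vector_derivative (y * of_real (1 - (tanh s)\<^sup>2))) (at s)" for s
    unfolding w_def
    by (rule has_vector_derivative_mult_right[OF has_vector_derivative_of_real])
      (auto intro!: derivative_eq_intros)
  have E': "((\<lambda>s. E (0, w s)) has_vector_derivative (0 *\<^sub>C EA (0, w s) + (y * of_real (1 - (tanh s)\<^sup>2)) *\<^sub>C EK (0, w s))) (at s)" for s
    by (rule has_vector_derivative_E[where p = "\<lambda>s. (0, w s)"]) (use w wd zero_DJ in simp_all)
  have "U (hyp_curve y s) (of_real (f 0) *\<^sub>C E (0, w 0)) = of_real (f s) *\<^sub>C E (0, w s)"
  proof (rule flow[OF one_param_curves(4)[OF y]])
    show "((\<lambda>s. of_real (f s) *\<^sub>C E (0, w s)) has_vector_derivative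
        (of_real (f s) *\<^sub>C (0 *\<^sub>C EA (0, w s) + (y * of_real (1 - (tanh s)\<^sup>2)) *\<^sub>C EK (0, w s))
         + of_real (- 2 * k * tanh s * f s) *\<^sub>C E (0, w s))) (at s)" for s
      by (rule bounded_bilinear.has_vector_derivative[OF bounded_bilinear_scaleC f E'])
    have eq: "c *\<^sub>C (y *\<^sub>C EK (0, w s) - cnj y *\<^sub>C ((2 * of_real k * w s) *\<^sub>C E (0, w s) + w s *\<^sub>C (w s *\<^sub>C EK (0, w s))))
        = c *\<^sub>C (0 *\<^sub>C EA (0, w s) + (y * of_real (1 - (tanh s)\<^sup>2)) *\<^sub>C EK (0, w s)) + (of_real (- 2 * k * tanh s) * c) *\<^sub>C E (0, w s)" for s c
    proof -
      have 1: "cnj y * (2 * of_real k * w s) = of_real (2 * k * tanh s)"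
        using yy by (simp add: w_def mult_ac)
      have 2: "cnj y * (w s * w s) = y * of_real ((tanh s)\<^sup>2)"
      proof -
        have "cnj y * (w s * w s) = (cnj y * y) * (y * of_real (tanh s * tanh s))"
          unfolding w_def of_real_mult by (simp only: mult_ac)
        then show ?thesis unfolding yy by (simp add: power2_eq_square)
      qed
      have "y *\<^sub>C EK (0, w s) - cnj y *\<^sub>C ((2 * of_real k * w s) *\<^sub>C E (0, w s) + w s *\<^sub>C (w s *\<^sub>C EK (0, w s)))
        = (y - y * of_real ((tanh s)\<^sup>2)) *\<^sub>C EK (0, w s) - of_real (2 * k * tanh s) *\<^sub>C E (0, w s)"
        unfolding scaleC_add_right scaleC_scaleC 1 2 scaleC_diff_left by simp
      then have "c *\<^sub>C (y *\<^sub>C EK (0, w s) - cnj y *\<^sub>C ((2 * of_real k * w s) *\<^sub>C E (0, w s) + w s *\<^sub>C (w s *\<^sub>C EK (0, w s))))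
        = (c * (y - y * of_real ((tanh s)\<^sup>2))) *\<^sub>C EK (0, w s) - (c * of_real (2 * k * tanh s)) *\<^sub>C E (0, w s)"
        by (simp only: scaleC_diff_right scaleC_scaleC)
      then show ?thesis
        by (simp add: scaleC_scaleC scaleC_minus_left algebra_simps)
    qed
    show "gen (hyp_curve y) (of_real (f s) *\<^sub>C E (0, w s))
        (of_real (f s) *\<^sub>C (0 *\<^sub>C EA (0, w s) + (y * of_real (1 - (tanh s)\<^sup>2)) *\<^sub>C EK (0, w s))
         + of_real (- 2 * k * tanh s * f s) *\<^sub>C E (0, w s))" for s
      using gen_hyp_E[OF y w, of "of_real (f s)" s] unfolding eq by simp
  qed
  then show ?thesis by (simp add: f_def w_def E_zero)
qed

text \<open>g is factored as Heisenberg part, hyperbolic part, rotation and centre. The last two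
  multiply e_0 by phases, the hyperbolic part carries it to the line of E(0, b / conj a), and the
  Heisenberg part adjusts z.\<close>

theorem orbit_e0:
  assumes "g \<in> jacobi_group"
  shows "\<exists>l. l \<noteq> 0 \<and> U g e0 = l *\<^sub>C E (jacobi_act g (0, 0))"
proof -
  obtain a b \<alpha> t where g: "g = (su_mat a b, \<alpha>, t)" and ab: "(cmod a)\<^sup>2 - (cmod b)\<^sup>2 = 1"
    by (rule jacobi_groupE[OF assms])
  have a0: "a \<noteq> 0"
  proof
    assume "a = 0"
    then have "(cmod b)\<^sup>2 = - 1" using ab by simp
    then show False by (metis neg_0_le_iff_le not_one_le_zero zero_le_power2)
  qed
  \<comment> \<open>Polar decomposition of the matrix: with the rotation by \<theta> = Arg a split
    off on the right, the remaining entries are cosh s = |a| and y sinh s = b cis \<theta>. For b =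
    0 the unit direction y is arbitrary and set to 1.\<close>
  define \<theta> where "\<theta> = Arg a"
  define b' where "b' = b * cis \<theta>"
  define y where "y = (if b' = 0 then 1 else b' / of_real (cmod b'))"
  define s where "s = arsinh (cmod b')"
  have y: "cmod y = 1" by (simp add: y_def norm_divide)
  have a_eq: "a = of_real (cmod a) * cis \<theta>" by (simp add: \<theta>_def flip: rcis_def rcis_cmod_Arg)
  have nb: "cmod b' = cmod b" by (simp add: b'_def norm_mult)
  have sinh: "sinh s = cmod b'" by (simp add: s_def)
  have ysinh: "y * of_real (sinh s) = b'" by (simp add: y_def sinh)
  have "(cosh s)\<^sup>2 = (cmod a)\<^sup>2" unfolding cosh_sinh_sq sinh nb using ab by simp
  then have cosh: "cosh s = cmod a" by (simp add: power2_eq_iff_nonneg)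
  define w where "w = b / cnj a"
  have w1: "cmod w < 1"
  proof -
    have "(cmod b)\<^sup>2 < (cmod a)\<^sup>2" using ab by simp
    then have "cmod b < cmod a" by (rule power_less_imp_less_base) simp
    then show ?thesis using a0 by (simp add: w_def norm_divide)
  qed
  have wy: "y * of_real (tanh s) = w"
  proof -
    have "y * of_real (tanh s) = b' / of_real (cmod a)"
      unfolding tanh_def of_real_divide times_divide_eq_right ysinh cosh ..
    also have "\<dots> = w"
    proof -
      have "cnj a = of_real (cmod a) * cis (- \<theta>)" using arg_cong[OF a_eq, of cnj] by (simp add: cis_cnj)
      moreover have "cis (- \<theta>) * cis \<theta> = 1" by (simp add: cis_mult)
      ultimately show ?thesis using a0 by (simp add: w_def b'_def field_simps)
    qed
    finally show ?thesis .
  qed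
  \<comment> \<open>\<beta> is g.\<alpha>: the composition law applies the inverse of the right
    factor to the translation on the left.\<close>
  define \<beta> where "\<beta> = a * \<alpha> + b * cnj \<alpha>"
  note n = SU11_norm[OF ab]
  have grp: "heis_curve \<beta> 1 \<in> jacobi_group" "hyp_curve y s \<in> jacobi_group" "rot_curve \<theta> \<in> jacobi_group" "centre_curve t \<in> jacobi_group"
    using one_param_curves y unfolding one_param_def by blast+
  have m1: "jacobi_mult (rot_curve \<theta>) (centre_curve t) = (su_mat (cis \<theta>) 0, 0, t)"
    unfolding rot_curve_def centre_curve_def jacobi_mult_su_mat by simp
  have m2: "jacobi_mult (hyp_curve y s) (su_mat (cis \<theta>) 0, 0, t) = (su_mat a b, 0, t)"
  proof -
    have "of_real (cosh s) * cis \<theta> = a" using a_eq cosh by simp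
    moreover have "b' * cnj (cis \<theta>) = b" by (simp add: b'_def cis_cnj cis_mult mult.assoc)
    ultimately show ?thesis
      unfolding hyp_curve_def jacobi_mult_su_mat ysinh by simp
  qed
  have m3: "jacobi_mult (heis_curve \<beta> 1) (su_mat a b, 0, t) = g"
  proof -
    have "cnj a * \<beta> - b * cnj \<beta> = (a * cnj a - b * cnj b) * \<alpha>" by (simp add: \<beta>_def algebra_simps)
    then have "cnj a * \<beta> - b * cnj \<beta> = \<alpha>" using n by simp
    then show ?thesis unfolding heis_curve_def jacobi_mult_su_mat g by simp
  qed
  have grp2: "(su_mat (cis \<theta>) 0, 0, t) \<in> jacobi_group" "(su_mat a b, 0, t) \<in> jacobi_group"
    using jacobi_mult_closed[OF grp(3,4)] ab unfolding m1 by (auto intro: jacobi_groupI)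
  define l1 where "l1 = exp (\<i> * complex_of_real t)"
  define l2 where "l2 = exp (2 * \<i> * of_real k * complex_of_real \<theta>)"
  define l3 where "l3 = complex_of_real (exp (- 2 * k * ln (cosh s)))"
  define l4 where "l4 = exp ((w * (cnj \<beta>)\<^sup>2 - \<beta> * cnj \<beta>) / 2 * (complex_of_real 1)\<^sup>2)"
  have "U g e0 = U (heis_curve \<beta> 1) (U (su_mat a b, 0, t) e0)"
    unfolding m3[symmetric] by (rule U_mult[OF grp(1) grp2(2)])
  also have "U (su_mat a b, 0, t) e0 = U (hyp_curve y s) (U (su_mat (cis \<theta>) 0, 0, t) e0)"
    unfolding m2[symmetric] by (rule U_mult[OF grp(2) grp2(1)])
  also have "U (su_mat (cis \<theta>) 0, 0, t) e0 = U (rot_curve \<theta>) (U (centre_curve t) e0)"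
    unfolding m1[symmetric] by (rule U_mult[OF grp(3,4)])
  also have "U (centre_curve t) e0 = l1 *\<^sub>C e0" unfolding U_centre l1_def ..
  also have "U (rot_curve \<theta>) (l1 *\<^sub>C e0) = (l1 * l2) *\<^sub>C e0"
    unfolding U_scaleC[OF grp(3)] U_rot l2_def scaleC_scaleC ..
  also have "U (hyp_curve y s) ((l1 * l2) *\<^sub>C e0) = (l1 * l2 * l3) *\<^sub>C E (0, w)"
    unfolding U_scaleC[OF grp(2)] U_hyp[OF y] l3_def scaleC_scaleC wy ..
  also have "U (heis_curve \<beta> 1) ((l1 * l2 * l3) *\<^sub>C E (0, w)) = (l1 * l2 * l3 * l4) *\<^sub>C E (of_real 1 * (\<beta> - w * cnj \<beta>), w)"
    unfolding U_scaleC[OF grp(1)] U_heis[OF w1] l4_def scaleC_scaleC ..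
  also have "(of_real 1 * (\<beta> - w * cnj \<beta>), w) = jacobi_act g (0, 0)"
  proof -
    have "(\<beta> - w * cnj \<beta>) * cnj a = (a * cnj a - b * cnj b) * \<alpha>"
      using a0 by (simp add: w_def \<beta>_def field_simps)
    then have "\<beta> - w * cnj \<beta> = \<alpha> / cnj a" using n a0 by (simp add: field_simps)
    then show ?thesis by (simp add: g w_def)
  qed
  finally have "U g e0 = (l1 * l2 * l3 * l4) *\<^sub>C E (jacobi_act g (0, 0))" .
  moreover have "l1 * l2 * l3 * l4 \<noteq> 0" by (simp add: l1_def l2_def l3_def l4_def)
  ultimately show ?thesis by blast
qed

end

subsection \<open>The isometry onto the function space\<close>

context jacobi_rep
begin

lemma conj2_conj2 [simp]: "conj2 (conj2 p) = p"
  by (simp add: conj2_def)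

lemma cis_mat_group: "(su_mat (cis \<theta>) 0, 0, 0) \<in> jacobi_group"
  by (rule jacobi_groupI) simp

lemma rho_eq_exp:
  assumes "p \<in> DJ"
  shows "rho k p = exp (- kpot k p)"
proof -
  define d where "d = 1 - (cmod (snd p))\<^sup>2"
  have "d > 0" using Re_jD_pos[OF assms] by (simp add: d_def)
  then have dp: "d powr (2 * k) = exp (2 * k * ln d)" by (simp add: powr_def)
  define X where "X = (cmod (fst p))\<^sup>2 + Re ((fst p)\<^sup>2 * cnj (snd p))"
  have "rho k p = exp (2 * k * ln d + - X / d)"
    unfolding rho_def d_def[symmetric] X_def[symmetric] dp exp_add ..
  also have "2 * k * ln d + - X / d = - kpot k p"
    unfolding kpot_def d_def[symmetric] X_def[symmetric] by simp
  finally show ?thesis .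
qed

lemma cinner_E_self:
  assumes "p \<in> DJ"
  shows "cinner (E (conj2 p)) (E (conj2 p)) = of_real (exp (kpot k p))"
proof -
  define d where "d = 1 - (cmod (snd p))\<^sup>2"
  define X where "X = 2 * fst p * cnj (fst p) + (fst p)\<^sup>2 * cnj (snd p) + (cnj (fst p))\<^sup>2 * snd p"
  have d: "d > 0" using Re_jD_pos[OF assms] by (simp add: d_def)
  have J: "1 - cnj (snd (conj2 p)) * snd (conj2 p) = of_real d"
    using jD_of_real[of p] unfolding jD_def d_def conj2_def by simp
  have X: "2 * cnj (fst (conj2 p)) * fst (conj2 p) + (cnj (fst (conj2 p)))\<^sup>2 * snd (conj2 p)
      + (fst (conj2 p))\<^sup>2 * cnj (snd (conj2 p)) = X"
    by (simp add: conj2_def X_def)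
  have "complex_of_real d powr (- 2 * of_real k) = exp (- 2 * of_real k * of_real (ln d))"
    using d by (simp add: powr_def Ln_of_real)
  then have "cinner (E (conj2 p)) (E (conj2 p)) = exp (- 2 * of_real k * of_real (ln d)) * exp (X / (2 * of_real d))"
    unfolding cinner_E[OF conj2_DJ[OF assms] conj2_DJ[OF assms]] J X by simp
  also have "\<dots> = exp (complex_of_real (kpot k p))"
    unfolding kpot_eq jD_of_real d_def[symmetric] X_def[symmetric] exp_add[symmetric] by simp
  finally show ?thesis by (simp add: exp_of_real)
qed

lemma rho_norm: "p \<in> DJ \<Longrightarrow> rho k p * (norm (E (conj2 p)))\<^sup>2 = 1"
proof -
  assume p: "p \<in> DJ"
  have "(norm (E (conj2 p)))\<^sup>2 = exp (kpot k p)"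
    using cinner_E_self[OF p] unfolding cinner_self of_real_eq_iff .
  then show ?thesis by (simp add: rho_eq_exp[OF p] exp_minus)
qed

text \<open>p is the image of the origin under some h, so \<open>E p\<close> is a multiple of U h
  e_0 and its translate a multiple of U (gh) e_0.\<close>

lemma U_E:
  assumes g: "g \<in> jacobi_group" and p: "p \<in> DJ"
  shows "\<exists>l. l \<noteq> 0 \<and> U g (E p) = l *\<^sub>C E (jacobi_act g p)"
proof -
  obtain h where h: "h \<in> jacobi_group" "jacobi_act h (0, 0) = p" using jacobi_act_transitive[OF p] by blast
  obtain l where l: "l \<noteq> 0" "U h e0 = l *\<^sub>C E p" using orbit_e0[OF h(1)] unfolding h(2) by blast
  obtain m where m: "m \<noteq> 0" "U (jacobi_mult g h) e0 = m *\<^sub>C E (jacobi_act (jacobi_mult g h) (0, 0))"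
    using orbit_e0[OF jacobi_mult_closed[OF g h(1)]] by blast
  have "jacobi_act (jacobi_mult g h) (0, 0) = jacobi_act g p"
    using jacobi_act_mult[OF g h(1), of "(0, 0)"] h(2) by (simp add: DJ_def)
  then have "m *\<^sub>C E (jacobi_act g p) = l *\<^sub>C U g (E p)"
    using m(2) U_mult[OF g h(1), of e0] by (simp add: l(2) U_scaleC[OF g])
  then have "inverse l *\<^sub>C m *\<^sub>C E (jacobi_act g p) = inverse l *\<^sub>C l *\<^sub>C U g (E p)" by simp
  then have "U g (E p) = (inverse l * m) *\<^sub>C E (jacobi_act g p)"
    using l(1) by (simp add: scaleC_scaleC)
  then show ?thesis using l(1) m(1) by (intro exI[of _ "inverse l * m"]) simp
qed

section \<open>The invariant integrand and the form defined by it\<close>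

definition Q :: "'h \<Rightarrow> 'h \<Rightarrow> C2 \<Rightarrow> complex" where
  "Q \<phi> \<psi> p = cnj (coh_fun U e0 \<phi> p) * coh_fun U e0 \<psi> p * of_real (rho k p)"

text \<open>\<rho> is the reciprocal of the squared norm of the coherent vector, so \<open>Q\<close>
  depends only on the line spanned by that vector. A unitary action permuting these lines must
  preserve it.\<close>

lemma Q_eq_quotient:
  assumes p: "p \<in> DJ" and x: "x = l *\<^sub>C E (conj2 p)" and l: "l \<noteq> 0"
  shows "Q \<phi> \<psi> p = cinner \<phi> x * cinner x \<psi> / of_real ((norm x)\<^sup>2)"
proof -
  define e where "e = E (conj2 p)"
  have e: "rho k p * (norm e)\<^sup>2 = 1" unfolding e_def by (rule rho_norm[OF p])
  then have "e \<noteq> 0" by auto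
  have "rho k p = 1 / (norm e)\<^sup>2" using e \<open>e \<noteq> 0\<close> by (simp add: field_simps)
  moreover have "Q \<phi> \<psi> p = cinner \<phi> e * cinner e \<psi> * of_real (rho k p)"
    unfolding Q_def coh_fun_eq[OF p] e_def by (subst cinner_commute[of \<phi>]) simp
  moreover have "cinner \<phi> x * cinner x \<psi> = of_real ((cmod l)\<^sup>2) * (cinner \<phi> e * cinner e \<psi>)"
    unfolding x e_def[symmetric] cinner_scaleC_right cinner_scaleC_left complex_norm_square by (simp add: mult_ac)
  moreover have "(norm x)\<^sup>2 = (cmod l)\<^sup>2 * (norm e)\<^sup>2"
    unfolding x e_def[symmetric] norm_scaleC power_mult_distrib ..
  ultimately show ?thesis using l \<open>e \<noteq> 0\<close> by simp
qed

text \<open>f_\<psi> at p pairs with the coherent vector at the conjugate point, so U g moves the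
  argument of f_\<psi> by the element with conjugated entries.\<close>

fun conj_elt :: "jacobi \<Rightarrow> jacobi" where
  "conj_elt (g, \<alpha>, t) = (su_mat (cnj (g $ 1 $ 1)) (cnj (g $ 1 $ 2)), cnj \<alpha>, t)"

lemma conj_elt_group: "g \<in> jacobi_group \<Longrightarrow> conj_elt g \<in> jacobi_group"
  by (erule jacobi_groupE) (simp add: jacobi_groupI)

lemma conj_elt_act: "g \<in> jacobi_group \<Longrightarrow> jacobi_act (conj_elt g) p = conj2 (jacobi_act g (conj2 p))"
  by (erule jacobi_groupE, cases p) (simp add: conj2_def)

lemma Q_invariant:
  assumes g: "g \<in> jacobi_group" and p: "p \<in> DJ"
  shows "Q (U g \<phi>) (U g \<psi>) (jacobi_act (conj_elt g) p) = Q \<phi> \<psi> p"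
proof -
  obtain l where l: "l \<noteq> 0" "U g (E (conj2 p)) = l *\<^sub>C E (jacobi_act g (conj2 p))"
    using U_E[OF g conj2_DJ[OF p]] by blast
  have "U g (E (conj2 p)) = l *\<^sub>C E (conj2 (jacobi_act (conj_elt g) p))"
    unfolding conj_elt_act[OF g] conj2_conj2 by (rule l(2))
  from Q_eq_quotient[OF jacobi_act_DJ[OF conj_elt_group[OF g] p] this l(1), where \<phi> = "U g \<phi>" and \<psi> = "U g \<psi>"]
  have "Q (U g \<phi>) (U g \<psi>) (jacobi_act (conj_elt g) p)
      = cinner \<phi> (E (conj2 p)) * cinner (E (conj2 p)) \<psi> / of_real ((norm (E (conj2 p)))\<^sup>2)"
    unfolding cinner_U[OF g] norm_U[OF g] .
  also have "\<dots> = Q \<phi> \<psi> p"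
    by (rule Q_eq_quotient[OF p, of _ 1, symmetric]) simp_all
  finally show ?thesis .
qed

lemma coh_fun_add: "coh_fun U e0 (\<phi> + \<psi>) p = coh_fun U e0 \<phi> p + coh_fun U e0 \<psi> p"
  and coh_fun_scaleC: "coh_fun U e0 (c *\<^sub>C \<phi>) p = c * coh_fun U e0 \<phi> p"
  and coh_fun_diff: "coh_fun U e0 (\<phi> - \<psi>) p = coh_fun U e0 \<phi> p - coh_fun U e0 \<psi> p"
  and coh_fun_zero: "coh_fun U e0 0 p = 0"
  by (simp_all add: coh_fun_def cinner_add_right cinner_scaleC_right cinner_diff_right)

lemma coh_fun_has_derivative:
  assumes p: "p \<in> DJ"
  shows "(coh_fun U e0 \<psi> has_derivative
    (\<lambda>u. cinner (EA (conj2 p)) \<psi> * fst u + cinner (EK (conj2 p)) \<psi> * snd u)) (at p)"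
proof -
  have bl: "bounded_linear conj2"
    unfolding conj2_def by (intro bounded_linear_intros bounded_linear_compose[OF bounded_linear_cnj])
  have "((\<lambda>q. E (conj2 q)) has_derivative (\<lambda>u. fst (conj2 u) *\<^sub>C EA (conj2 p) + snd (conj2 u) *\<^sub>C EK (conj2 p))) (at p)"
    by (rule has_derivative_compose[OF bounded_linear_imp_has_derivative[OF bl] has_derivative_E[OF conj2_DJ[OF p]]])
  from bounded_linear.has_derivative[OF bounded_linear_cinner_left this, of \<psi>]
  have d: "((\<lambda>q. cinner (E (conj2 q)) \<psi>) has_derivative
      (\<lambda>u. cinner (EA (conj2 p)) \<psi> * fst u + cinner (EK (conj2 p)) \<psi> * snd u)) (at p)"
    by (rule has_derivative_eq_rhs) (simp add: fun_eq_iff conj2_def cinner_add_left cinner_scaleC_left mult.commute)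
  show ?thesis
    by (rule has_derivative_transform_within_open[OF d open_DJ p]) (simp add: coh_fun_eq)
qed

lemma coh_fun_holomorphic2: "holomorphic2_on (coh_fun U e0 \<psi>) DJ"
  unfolding holomorphic2_on_def using coh_fun_has_derivative by blast

lemma coh_fun_continuous: "continuous_on DJ (coh_fun U e0 \<psi>)"
  by (rule differentiable_imp_continuous_on)
    (auto simp: differentiable_on_def intro: differentiable_at_withinI differentiableI[OF coh_fun_has_derivative])

lemma coh_fun_measurable: "coh_fun U e0 \<psi> \<in> borel_measurable jacobi_measure"
  using borel_measurable_continuous_on_restrict[OF coh_fun_continuous]
  by (simp add: measurable_cong_sets[OF sets_jacobi_measure refl])

lemma rho_measurable_jacobi: "rho k \<in> borel_measurable jacobi_measure"
  by (rule measurable_jacobi_measureI[OF rho_measurable])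

lemma rho_pos: "p \<in> DJ \<Longrightarrow> rho k p > 0"
  by (simp add: rho_eq_exp)

lemma Q_measurable: "Q \<phi> \<psi> \<in> borel_measurable jacobi_measure"
proof -
  have "(\<lambda>p. complex_of_real (rho k p)) \<in> borel_measurable jacobi_measure"
    by (rule measurable_compose[OF rho_measurable_jacobi]) (intro borel_measurable_continuous_onI continuous_intros)
  moreover have "(\<lambda>p. cnj (coh_fun U e0 \<phi> p)) \<in> borel_measurable jacobi_measure"
    by (rule measurable_compose[OF coh_fun_measurable]) (intro borel_measurable_continuous_onI continuous_intros)
  ultimately show ?thesis
    unfolding Q_def[abs_def] by (intro borel_measurable_times coh_fun_measurable)
qed

lemma coh_fun_e0: "p \<in> DJ \<Longrightarrow> coh_fun U e0 e0 p = 1"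
  using cinner_E[OF conj2_DJ zero_DJ[of 0], of p]
  by (simp add: coh_fun_eq E_zero)

text \<open>Extended-real valued, because finiteness is established only in
  \<open>N_finite\<close>.\<close>

definition N :: "'h \<Rightarrow> ennreal" where
  "N \<phi> = (\<integral>\<^sup>+ p. ennreal ((cmod (coh_fun U e0 \<phi> p))\<^sup>2 * rho k p) \<partial>jacobi_measure)"

definition L :: real where "L = (4 * k - 3) / (2 * pi\<^sup>2)"

lemma L_pos: "L > 0" using k_ge by (simp add: L_def)

lemma N_e0: "N e0 = ennreal (1 / L)"
proof -
  have "N e0 = (\<integral>\<^sup>+ p. ennreal (rho k p) \<partial>jacobi_measure)"
    unfolding N_def by (rule nn_integral_cong) (simp add: space_jacobi_measure coh_fun_e0)
  also have "\<dots> = ennreal (1 / L)" using nn_integral_rho[of k] k_ge by (simp add: L_def)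
  finally show ?thesis .
qed

lemma norm_Q: "p \<in> DJ \<Longrightarrow> norm (Q \<phi> \<psi> p) = cmod (coh_fun U e0 \<phi> p) * cmod (coh_fun U e0 \<psi> p) * rho k p"
  unfolding Q_def using rho_pos[of p] by (simp add: norm_mult)

lemma Q_self: "Q \<phi> \<phi> p = of_real ((cmod (coh_fun U e0 \<phi> p))\<^sup>2 * rho k p)"
  unfolding Q_def of_real_mult complex_norm_square by (simp add: mult_ac)

lemma integrable_Q:
  assumes "N \<phi> < \<infinity>" "N \<psi> < \<infinity>"
  shows "integrable jacobi_measure (Q \<phi> \<psi>)"
proof (rule integrableI_bounded[OF Q_measurable])
  have "(\<integral>\<^sup>+ p. ennreal (norm (Q \<phi> \<psi> p)) \<partial>jacobi_measure) \<le>
    (\<integral>\<^sup>+ p. ennreal ((cmod (coh_fun U e0 \<phi> p))\<^sup>2 * rho k p) + ennreal ((cmod (coh_fun U e0 \<psi> p))\<^sup>2 * rho k p) \<partial>jacobi_measure)"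
  proof (rule nn_integral_mono)
    fix p assume "p \<in> space jacobi_measure"
    then have p: "p \<in> DJ" by (simp add: space_jacobi_measure)
    define a b where "a = cmod (coh_fun U e0 \<phi> p)" and "b = cmod (coh_fun U e0 \<psi> p)"
    have "a * b \<le> a\<^sup>2 + b\<^sup>2"
    proof -
      have "0 \<le> a * b" by (simp add: a_def b_def)
      moreover have "2 * (a * b) \<le> a\<^sup>2 + b\<^sup>2" using sum_squares_bound[of a b] by (simp add: mult.assoc)
      ultimately show ?thesis by linarith
    qed
    then have "a * b * rho k p \<le> a\<^sup>2 * rho k p + b\<^sup>2 * rho k p"
      using mult_right_mono[of "a * b" "a\<^sup>2 + b\<^sup>2" "rho k p"] rho_pos[OF p] by (simp add: distrib_right)
    then show "ennreal (norm (Q \<phi> \<psi> p)) \<le> ennreal ((cmod (coh_fun U e0 \<phi> p))\<^sup>2 * rho k p) + ennreal ((cmod (coh_fun U e0 \<psi> p))\<^sup>2 * rho k p)"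
      unfolding norm_Q[OF p] a_def[symmetric] b_def[symmetric]
      using rho_pos[OF p] by (simp flip: ennreal_plus add: ennreal_leI)
  qed
  also have "\<dots> = N \<phi> + N \<psi>"
    unfolding N_def
    by (intro nn_integral_add measurable_compose[OF _ measurable_ennreal] borel_measurable_times borel_measurable_power
        rho_measurable_jacobi measurable_compose[OF coh_fun_measurable borel_measurable_norm])
  also have "\<dots> < \<infinity>" using assms by simp
  finally show "(\<integral>\<^sup>+ p. ennreal (norm (Q \<phi> \<psi> p)) \<partial>jacobi_measure) < \<infinity>" .
qed

definition B :: "'h \<Rightarrow> 'h \<Rightarrow> complex" where
  "B \<phi> \<psi> = of_real L * (LINT p|jacobi_measure. Q \<phi> \<psi> p)"

text \<open>Transport along \<open>jacobi_act (conj_elt g)\<close>, which preserves the measure and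
  takes the integrand for the translated vectors back to the original one.\<close>

lemma Q_act_distr:
  assumes g: "g \<in> jacobi_group"
  shows "N (U g \<phi>) = N \<phi>" and "B (U g \<phi>) (U g \<psi>) = B \<phi> \<psi>"
proof -
  note m = jacobi_act_measurable_jacobi[OF conj_elt_group[OF g]]
  note d = distr_jacobi_measure[OF conj_elt_group[OF g]]
  have "N (U g \<phi>) = (\<integral>\<^sup>+ p. ennreal (norm (Q (U g \<phi>) (U g \<phi>) p)) \<partial>jacobi_measure)"
    unfolding N_def by (rule nn_integral_cong) (simp add: space_jacobi_measure norm_Q power2_eq_square)
  also have "\<dots> = (\<integral>\<^sup>+ p. ennreal (norm (Q (U g \<phi>) (U g \<phi>) p)) \<partial>distr jacobi_measure jacobi_measure (jacobi_act (conj_elt g)))"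
    unfolding d ..
  also have "\<dots> = (\<integral>\<^sup>+ p. ennreal (norm (Q (U g \<phi>) (U g \<phi>) (jacobi_act (conj_elt g) p))) \<partial>jacobi_measure)"
    by (rule nn_integral_distr[OF m]) (simp only: measurable_distr_eq1, intro measurable_compose[OF _ measurable_ennreal] measurable_compose[OF Q_measurable borel_measurable_norm])
  also have "\<dots> = N \<phi>"
    unfolding N_def by (rule nn_integral_cong) (simp add: space_jacobi_measure Q_invariant[OF g] norm_Q power2_eq_square)
  finally show "N (U g \<phi>) = N \<phi>" .
  have "(LINT p|jacobi_measure. Q (U g \<phi>) (U g \<psi>) p) = (LINT p|distr jacobi_measure jacobi_measure (jacobi_act (conj_elt g)). Q (U g \<phi>) (U g \<psi>) p)"
    unfolding d ..
  also have "\<dots> = (LINT p|jacobi_measure. Q (U g \<phi>) (U g \<psi>) (jacobi_act (conj_elt g) p))"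
    by (rule integral_distr[OF m Q_measurable])
  also have "\<dots> = (LINT p|jacobi_measure. Q \<phi> \<psi> p)"
    by (rule Bochner_Integration.integral_cong[OF refl]) (simp add: space_jacobi_measure Q_invariant[OF g])
  finally show "B (U g \<phi>) (U g \<psi>) = B \<phi> \<psi>" unfolding B_def by simp
qed

end

section \<open>Averaging over the rotation subgroup\<close>

lemma circle_mean:
  assumes hol: "g holomorphic_on ball 0 R" and R: "R > 1"
  shows "(LINT t|restrict_space lborel {0..1}. g (cis (2 * pi * t))) = g 0"
proof -
  have sub: "cball 0 1 \<subseteq> ball (0::complex) R" using R by auto
  have "((\<lambda>u. g u / (u - 0)) has_contour_integral (2 * of_real pi * \<i> * g 0)) (circlepath 0 1)"
    by (rule Cauchy_integral_circlepath_simple[OF holomorphic_on_subset[OF hol sub]]) simp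
  then have "((\<lambda>x. g (circlepath 0 1 x) / (circlepath 0 1 x - 0) * vector_derivative (circlepath 0 1) (at x))
      has_integral (2 * of_real pi * \<i> * g 0)) {0..1}"
    unfolding has_contour_integral .
  moreover have "g (circlepath 0 1 x) / (circlepath 0 1 x - 0) * vector_derivative (circlepath 0 1) (at x)
      = (2 * of_real pi * \<i>) * g (cis (2 * pi * x))" for x
  proof -
    have "circlepath 0 1 x = cis (2 * pi * x)"
      by (simp add: circlepath cis_conv_exp mult_ac)
    moreover have "vector_derivative (circlepath 0 1) (at x) = 2 * of_real pi * \<i> * cis (2 * pi * x)"
      by (simp add: vector_derivative_circlepath cis_conv_exp mult_ac)
    ultimately show ?thesis by simp
  qed
  ultimately have "((\<lambda>x. (2 * of_real pi * \<i>) * g (cis (2 * pi * x))) has_integral (2 * of_real pi * \<i> * g 0)) {0..1}"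
    by simp
  from has_integral_mult_right[OF this, of "1 / (2 * of_real pi * \<i>)"]
  have h: "((\<lambda>x. g (cis (2 * pi * x))) has_integral g 0) {0..1}" by simp
  have "continuous_on {0..1} (\<lambda>x. g (cis (2 * pi * x)))"
    by (rule continuous_on_compose2[OF holomorphic_on_imp_continuous_on[OF hol]])
      (use R in \<open>auto intro!: continuous_intros\<close>)
  then have "set_integrable lborel {0..1} (\<lambda>x. g (cis (2 * pi * x)))"
    by (rule borel_integrable_atLeastAtMost')
  from set_borel_integral_eq_integral(2)[OF this] integral_unique[OF h]
  show ?thesis by (simp add: integral_restrict_space set_lebesgue_integral_def)
qed

lemma sigma_finite_jacobi_measure: "sigma_finite_measure jacobi_measure"
proof -
  interpret S: sigma_finite_measure "restrict_space lborel DJ :: C2 measure"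
    by (rule sigma_finite_measure_restrict_space[OF sigma_finite_lborel]) simp
  have "(\<lambda>p::C2. ennreal (1 / (1 - (cmod (snd p))\<^sup>2) ^ 3)) \<in> borel_measurable borel"
    by (intro measurable_compose[OF _ measurable_ennreal] borel_measurable_divide borel_measurable_const
        borel_measurable_continuous_onI continuous_intros)
  then have "(\<lambda>p::C2. ennreal (1 / (1 - (cmod (snd p))\<^sup>2) ^ 3)) \<in> borel_measurable lborel" by simp
  then have m: "(\<lambda>(z, w). ennreal (1 / (1 - (cmod w)\<^sup>2) ^ 3)) \<in> borel_measurable (restrict_space lborel DJ :: C2 measure)"
    unfolding case_prod_unfold by (rule measurable_restrict_space1)
  show ?thesis
    unfolding jacobi_measure_def S.sigma_finite_iff_density_finite[OF m] by (simp add: case_prod_unfold)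
qed

context jacobi_rep
begin

text \<open>Parametrized with period 1, so that averaging is integration over [0, 1], a space of
  total mass 1.\<close>

definition rot :: "real \<Rightarrow> jacobi" where "rot t = (su_mat (cis (2 * pi * t)) 0, 0, 0)"

lemma rot_group: "rot t \<in> jacobi_group"
  unfolding rot_def by (rule cis_mat_group)

lemma rot_act: "jacobi_act (rot t) p = (cis (2 * pi * t) * fst p, (cis (2 * pi * t))\<^sup>2 * snd p)"
proof -
  define c where "c = cis (2 * pi * t)"
  have cc: "c * cnj c = 1" by (simp add: c_def cis_cnj cis_mult)
  have "x / cnj c = c * x" for x
  proof -
    have "c * x * cnj c = (c * cnj c) * x" by (simp only: mult_ac)
    then have "x = c * x * cnj c" unfolding cc by simp
    moreover have "cnj c \<noteq> 0" by (simp add: c_def)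
    ultimately show ?thesis by (metis nonzero_mult_div_cancel_right)
  qed
  then show ?thesis
    unfolding rot_def c_def[symmetric] by (cases p) (simp add: power2_eq_square mult_ac)
qed

lemma rho_rot: "rho k (jacobi_act (rot t) p) = rho k p"
proof -
  define c where "c = cis (2 * pi * t)"
  have c: "c\<^sup>2 * cnj (c\<^sup>2) = 1" "cmod c = 1"
    by (simp_all add: c_def power2_eq_square cis_cnj cis_mult)
  have "(c * fst p)\<^sup>2 * cnj (c\<^sup>2 * snd p) = (c\<^sup>2 * cnj (c\<^sup>2)) * ((fst p)\<^sup>2 * cnj (snd p))"
    by (simp only: power_mult_distrib complex_cnj_mult mult_ac)
  then show ?thesis
    unfolding rot_act rho_def fst_conv snd_conv c_def[symmetric] by (simp only: c norm_mult norm_power) simp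
qed

text \<open>The orbit map extends from the unit circle to the holomorphic map u -> (u z, u^2 w), and
  the circle mean is the value at u = 0, the origin of the domain.\<close>

lemma coh_fun_circle:
  assumes p: "p \<in> DJ"
  shows "(LINT t|restrict_space lborel {0..1}. coh_fun U e0 \<phi> (jacobi_act (rot t) p)) = cinner e0 \<phi>"
proof -
  define r where "r = cmod (snd p)"
  have r: "0 \<le> r" "r < 1" using p by (auto simp: r_def DJ_def)
  \<comment> \<open>This radius satisfies R > 1 and R^2 r < 1, so (u z, u^2 w) stays in
    \<open>DJ\<close> for |u| < R.\<close>
  define R where "R = 2 / (1 + r)"
  have R: "R > 1" using r by (simp add: R_def)
  have "4 * r < (1 + r)\<^sup>2"
  proof -
    have "(1 - r)\<^sup>2 > 0" using r by simp
    then show ?thesis by (simp add: power2_eq_square algebra_simps)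
  qed
  then have Rr: "R\<^sup>2 * r < 1" using r by (simp add: R_def power_divide)
  define q where "q = (\<lambda>u. (u * fst p, u\<^sup>2 * snd p))"
  have "(\<lambda>u. coh_fun U e0 \<phi> (q u)) holomorphic_on ball 0 R"
    unfolding holomorphic_on_open[OF open_ball]
  proof
    fix u :: complex assume "u \<in> ball 0 R"
    then have "cmod u < R" by simp
    then have "(cmod u)\<^sup>2 \<le> R\<^sup>2" by (intro power_mono) simp_all
    then have "(cmod u)\<^sup>2 * r \<le> R\<^sup>2 * r" using r by (intro mult_right_mono)
    then have qDJ: "q u \<in> DJ" using Rr by (simp add: q_def DJ_def norm_mult norm_power r_def)
    have "(q has_derivative (\<lambda>h. (h * fst p, (2 * u * h) * snd p))) (at u)"
      unfolding q_def by (auto intro!: derivative_eq_intros simp: mult_ac)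
    from has_derivative_compose[OF this coh_fun_has_derivative[OF qDJ, of \<phi>]]
    have "((\<lambda>u. coh_fun U e0 \<phi> (q u)) has_field_derivative
      (cinner (EA (conj2 (q u))) \<phi> * fst p + cinner (EK (conj2 (q u))) \<phi> * (2 * u * snd p))) (at u)"
      unfolding has_field_derivative_def by (rule has_derivative_eq_rhs) (simp add: fun_eq_iff algebra_simps)
    then show "\<exists>f'. ((\<lambda>u. coh_fun U e0 \<phi> (q u)) has_field_derivative f') (at u)" by blast
  qed
  from circle_mean[OF this R]
  have "(LINT t|restrict_space lborel {0..1}. coh_fun U e0 \<phi> (jacobi_act (rot t) p)) = coh_fun U e0 \<phi> (0, 0)"
    by (simp add: q_def rot_act)
  also have "\<dots> = cinner e0 \<phi>"
    using coh_fun_eq[of "(0, 0)" \<phi>] by (simp add: DJ_def conj2_def E_zero)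
  finally show ?thesis .
qed

lemma N_eq_norm_Q: "N \<phi> = (\<integral>\<^sup>+ p. ennreal (norm (Q \<phi> \<phi> p)) \<partial>jacobi_measure)"
  unfolding N_def by (rule nn_integral_cong) (simp add: space_jacobi_measure norm_Q power2_eq_square)

lemma N_finite_iff: "N \<phi> < \<infinity> \<longleftrightarrow> integrable jacobi_measure (Q \<phi> \<phi>)"
  unfolding N_eq_norm_Q integrable_iff_bounded using Q_measurable by blast

lemma N_e0_finite: "N e0 < \<infinity>"
  by (simp add: N_e0)

lemma integral_rho: "(LINT p|jacobi_measure. rho k p) = 1 / L"
proof -
  have "(LINT p|jacobi_measure. rho k p) = enn2real (\<integral>\<^sup>+ p. ennreal (rho k p) \<partial>jacobi_measure)"
    by (rule integral_eq_nn_integral[OF rho_measurable_jacobi])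
      (auto intro!: AE_I2 simp: space_jacobi_measure less_imp_le[OF rho_pos])
  also have "(\<integral>\<^sup>+ p. ennreal (rho k p) \<partial>jacobi_measure) = ennreal (1 / L)"
    using nn_integral_rho[of k] k_ge by (simp add: L_def)
  finally show ?thesis using L_pos by simp
qed

text \<open>The function of e_0 is 1 and \<rho> is rotation invariant, so averaging turns the
  integrand into a constant multiple of \<rho>, whose integral is 1 / \<open>L\<close>. Fubini
  applies since all rotated integrands have the same integral of their absolute value.\<close>

lemma mean_value:
  assumes "N \<phi> < \<infinity>"
  shows "(LINT p|jacobi_measure. Q e0 \<phi> p) = cinner e0 \<phi> * of_real (1 / L)"
proof -
  let ?I = "restrict_space lborel {0..1::real}"
  define h where "h = (\<lambda>t p. Q e0 \<phi> (jacobi_act (rot t) p))"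
  have h_eq: "h t p = coh_fun U e0 \<phi> (jacobi_act (rot t) p) * of_real (rho k p)" if "p \<in> DJ" for t p
    unfolding h_def Q_def coh_fun_e0[OF jacobi_act_DJ[OF rot_group that]] rho_rot by simp
  note int = integrable_Q[OF N_e0_finite assms]
  note m = jacobi_act_measurable_jacobi[OF rot_group] and d = distr_jacobi_measure[OF rot_group]
  have h_int: "integrable jacobi_measure (h t)" for t
    unfolding h_def using int integrable_distr_eq[OF m Q_measurable] unfolding d by blast
  have h_val: "(LINT p|jacobi_measure. h t p) = (LINT p|jacobi_measure. Q e0 \<phi> p)" for t
    unfolding h_def using integral_distr[OF m Q_measurable, symmetric] unfolding d .
  have nQ: "(\<lambda>p. norm (Q e0 \<phi> p)) \<in> borel_measurable jacobi_measure"
    by (rule measurable_compose[OF Q_measurable borel_measurable_norm])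
  have h_norm: "(LINT p|jacobi_measure. norm (h t p)) = (LINT p|jacobi_measure. norm (Q e0 \<phi> p))" for t
    unfolding h_def using integral_distr[OF m nQ, symmetric] unfolding d .
  have finI: "finite_measure ?I"
    by (rule finite_measureI) (simp add: emeasure_restrict_space)
  have measI: "measure ?I (space ?I) = 1"
    by (simp add: measure_restrict_space)
  interpret I: finite_measure ?I by (rule finI)
  interpret J: sigma_finite_measure jacobi_measure by (rule sigma_finite_jacobi_measure)
  interpret P: pair_sigma_finite ?I jacobi_measure ..
  have c: "(\<lambda>t. cis (2 * pi * t)) \<in> borel_measurable ?I"
    by (rule measurable_restrict_space1) (simp add: borel_measurable_continuous_onI continuous_intros)
  have c': "(\<lambda>x. cis (2 * pi * fst x)) \<in> borel_measurable (?I \<Otimes>\<^sub>M jacobi_measure)"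
    by (rule measurable_compose[OF measurable_fst c])
  have f': "(\<lambda>x. f (snd x)) \<in> borel_measurable (?I \<Otimes>\<^sub>M jacobi_measure)" if "continuous_on UNIV f" for f :: "C2 \<Rightarrow> complex"
    by (rule measurable_compose[OF measurable_snd measurable_jacobi_measureI[OF borel_measurable_continuous_onI[OF that]]])
  have "(\<lambda>x. jacobi_act (rot (fst x)) (snd x)) \<in> borel_measurable (?I \<Otimes>\<^sub>M jacobi_measure)"
    unfolding rot_act
    by (intro borel_measurable_Pair borel_measurable_times borel_measurable_power c' f' continuous_intros)
  then have "(\<lambda>x. jacobi_act (rot (fst x)) (snd x)) \<in> measurable (?I \<Otimes>\<^sub>M jacobi_measure) jacobi_measure"
    unfolding measurable_cong_sets[OF refl sets_jacobi_measure]
    by (rule measurable_restrict_space2[rotated])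
      (auto simp: space_pair_measure space_jacobi_measure intro: jacobi_act_DJ[OF rot_group])
  from measurable_compose[OF this Q_measurable]
  have hm: "case_prod h \<in> borel_measurable (?I \<Otimes>\<^sub>M jacobi_measure)"
    unfolding h_def case_prod_unfold .
  have hint: "integrable (?I \<Otimes>\<^sub>M jacobi_measure) (case_prod h)"
    by (rule P.Fubini_integrable[OF hm]) (simp_all add: h_norm h_int)
  have "(LINT p|jacobi_measure. Q e0 \<phi> p) = (LINT t|?I. (LINT p|jacobi_measure. h t p))"
    unfolding h_val using measI by simp
  also have "\<dots> = (LINT p|jacobi_measure. (LINT t|?I. h t p))"
    by (rule P.Fubini_integral[OF hint, symmetric])
  also have "\<dots> = (LINT p|jacobi_measure. cinner e0 \<phi> * of_real (rho k p))"
  proof (rule Bochner_Integration.integral_cong[OF refl])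
    fix p assume "p \<in> space jacobi_measure"
    then have p: "p \<in> DJ" by (simp add: space_jacobi_measure)
    show "(LINT t|?I. h t p) = cinner e0 \<phi> * of_real (rho k p)"
      unfolding h_eq[OF p] integral_mult_left_zero coh_fun_circle[OF p] ..
  qed
  also have "\<dots> = cinner e0 \<phi> * of_real (1 / L)"
    unfolding integral_mult_right_zero integral_complex_of_real integral_rho ..
  finally show ?thesis .
qed

lemma B_e0: "N \<phi> < \<infinity> \<Longrightarrow> B e0 \<phi> = cinner e0 \<phi>"
  unfolding B_def using L_pos by (simp add: mean_value)

lemma U_inv: "g \<in> jacobi_group \<Longrightarrow> U g (U (jacobi_inv g) x) = x"
  using U_mult[of g "jacobi_inv g" x] jacobi_inv[of g] by (simp add: U_one)

text \<open>Both forms are invariant under U g, and so is finiteness of \<open>N\<close>; this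
  reduces the claim to e_0.\<close>

lemma B_orbit:
  assumes g: "g \<in> jacobi_group" and "N \<phi> < \<infinity>"
  shows "B (U g e0) \<phi> = cinner (U g e0) \<phi>"
proof -
  define \<psi> where "\<psi> = U (jacobi_inv g) \<phi>"
  have \<phi>: "\<phi> = U g \<psi>" unfolding \<psi>_def U_inv[OF g] ..
  then show ?thesis
    using assms(2) by (simp add: Q_act_distr[OF g] cinner_U[OF g] B_e0)
qed

section \<open>From the orbit span to the whole space\<close>

lemma Q_lin_left: "Q (c *\<^sub>C x + y) z = (\<lambda>p. cnj c * Q x z p + Q y z p)"
  and Q_lin_right: "Q z (c *\<^sub>C x + y) = (\<lambda>p. c * Q z x p + Q z y p)"
  by (simp_all add: fun_eq_iff Q_def coh_fun_add coh_fun_scaleC algebra_simps)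

lemma N_lin:
  assumes "N x < \<infinity>" "N y < \<infinity>"
  shows "N (c *\<^sub>C x + y) < \<infinity>"
  unfolding N_finite_iff Q_lin_left unfolding Q_lin_right
  by (intro Bochner_Integration.integrable_add integrable_mult_right integrable_Q assms)

lemma B_lin_left:
  assumes "N x < \<infinity>" "N y < \<infinity>" "N z < \<infinity>"
  shows "B (c *\<^sub>C x + y) z = cnj c * B x z + B y z"
proof -
  have "(LINT p|jacobi_measure. cnj c * Q x z p + Q y z p)
      = (LINT p|jacobi_measure. cnj c * Q x z p) + (LINT p|jacobi_measure. Q y z p)"
    by (intro Bochner_Integration.integral_add integrable_mult_right integrable_Q assms)
  then show ?thesis unfolding B_def Q_lin_left by (simp add: algebra_simps)
qed

lemma B_lin_right:
  assumes "N x < \<infinity>" "N y < \<infinity>" "N z < \<infinity>"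
  shows "B z (c *\<^sub>C x + y) = c * B z x + B z y"
proof -
  have "(LINT p|jacobi_measure. c * Q z x p + Q z y p)
      = (LINT p|jacobi_measure. c * Q z x p) + (LINT p|jacobi_measure. Q z y p)"
    by (intro Bochner_Integration.integral_add integrable_mult_right integrable_Q assms)
  then show ?thesis unfolding B_def Q_lin_right by (simp add: algebra_simps)
qed

abbreviation "orbit_span \<equiv> module.span scaleC ((\<lambda>g. U g e0) ` jacobi_group)"

lemma N_zero: "N 0 = 0"
  by (simp add: N_def coh_fun_zero)

lemma B_zero: "B 0 \<psi> = 0"
  by (simp add: B_def Q_def coh_fun_zero)

text \<open>The second argument ranges over all vectors with finite \<open>N\<close>, inside the
  span or not; \<open>B_eq_cinner\<close> pairs elements of the span with arbitrary vectors.\<close>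

lemma B_orbit_span:
  assumes "\<phi> \<in> orbit_span"
  shows "N \<phi> < \<infinity> \<and> (\<forall>\<psi>. N \<psi> < \<infinity> \<longrightarrow> B \<phi> \<psi> = cinner \<phi> \<psi>)"
  using assms
proof (induction rule: module.span_induct_alt[OF module_scaleC, consumes 1, case_names base step])
  case base
  show ?case by (simp add: N_zero B_zero)
next
  case (step c x y)
  then obtain g where g: "g \<in> jacobi_group" and x: "x = U g e0" by blast
  have Nx: "N x < \<infinity>" unfolding x Q_act_distr(1)[OF g] by (rule N_e0_finite)
  have "B (c *\<^sub>C x + y) \<psi> = cinner (c *\<^sub>C x + y) \<psi>" if "N \<psi> < \<infinity>" for \<psi>
    using step.IH that B_lin_left[OF Nx _ that] B_orbit[OF g that]
    by (simp add: x cinner_add_left cinner_scaleC_left)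
  then show ?case using N_lin[OF Nx] step.IH by blast
qed

lemma B_self:
  assumes "N \<phi> < \<infinity>"
  shows "B \<phi> \<phi> = of_real (L * enn2real (N \<phi>))"
proof -
  have "(LINT p|jacobi_measure. Q \<phi> \<phi> p) = of_real (LINT p|jacobi_measure. (cmod (coh_fun U e0 \<phi> p))\<^sup>2 * rho k p)"
    unfolding Q_self by (rule integral_complex_of_real)
  also have "(LINT p|jacobi_measure. (cmod (coh_fun U e0 \<phi> p))\<^sup>2 * rho k p) = enn2real (N \<phi>)"
    unfolding N_def
  proof (rule integral_eq_nn_integral)
    show "(\<lambda>p. (cmod (coh_fun U e0 \<phi> p))\<^sup>2 * rho k p) \<in> borel_measurable jacobi_measure"
      by (intro borel_measurable_times borel_measurable_power
        rho_measurable_jacobi measurable_compose[OF coh_fun_measurable borel_measurable_norm])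
    show "AE p in jacobi_measure. 0 \<le> (cmod (coh_fun U e0 \<phi> p))\<^sup>2 * rho k p"
      by (rule AE_I2) (simp add: space_jacobi_measure less_imp_le[OF rho_pos])
  qed
  finally show ?thesis unfolding B_def by simp
qed

lemma N_orbit_span:
  assumes "\<phi> \<in> orbit_span"
  shows "N \<phi> = ennreal ((norm \<phi>)\<^sup>2 / L)"
proof -
  have fin: "N \<phi> < \<infinity>" and B: "B \<phi> \<phi> = cinner \<phi> \<phi>" using B_orbit_span[OF assms] by blast+
  have "L * enn2real (N \<phi>) = (norm \<phi>)\<^sup>2"
    using B unfolding B_self[OF fin] cinner_self of_real_eq_iff .
  then have "enn2real (N \<phi>) = (norm \<phi>)\<^sup>2 / L" using L_pos by (simp add: field_simps)
  moreover have "ennreal (enn2real (N \<phi>)) = N \<phi>" using fin by simp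
  ultimately show ?thesis by simp
qed

lemma orbit_span_approx:
  "\<exists>s. (\<forall>n. s n \<in> orbit_span) \<and> s \<longlonglongrightarrow> \<phi>"
proof -
  have "\<phi> \<in> closure orbit_span" using e0_cyclic unfolding cyclic_vector_def by simp
  then show ?thesis unfolding closure_sequential .
qed

text \<open>The functions of approximating vectors converge pointwise, as evaluation is continuous
  in the vector. The lower limit gives an inequality only, but this already makes \<open>B\<close>
  defined and bounded everywhere.\<close>

lemma N_le: "N \<phi> \<le> ennreal ((norm \<phi>)\<^sup>2 / L)"
proof -
  obtain s where s: "\<And>n. s n \<in> orbit_span" "s \<longlonglongrightarrow> \<phi>" using orbit_span_approx[of \<phi>] by blast
  let ?f = "\<lambda>\<phi> p. ennreal ((cmod (coh_fun U e0 \<phi> p))\<^sup>2 * rho k p)"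
  have lim: "(\<lambda>n. ?f (s n) p) \<longlonglongrightarrow> ?f \<phi> p" for p
  proof -
    have "(\<lambda>n. coh_fun U e0 (s n) p) \<longlonglongrightarrow> coh_fun U e0 \<phi> p"
      unfolding coh_fun_def by (cases "p \<in> DJ") (simp_all add: bounded_linear.tendsto[OF bounded_linear_cinner_right s(2)])
    then show ?thesis by (intro tendsto_ennrealI tendsto_mult tendsto_power tendsto_norm tendsto_const)
  qed
  have "N \<phi> = (\<integral>\<^sup>+ p. liminf (\<lambda>n. ?f (s n) p) \<partial>jacobi_measure)"
    unfolding N_def by (rule nn_integral_cong) (rule lim_imp_Liminf[OF sequentially_bot lim, symmetric])
  also have "\<dots> \<le> liminf (\<lambda>n. N (s n))"
    unfolding N_def
    by (intro nn_integral_liminf measurable_compose[OF _ measurable_ennreal] borel_measurable_times borel_measurable_power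
        rho_measurable_jacobi measurable_compose[OF coh_fun_measurable borel_measurable_norm])
  also have "\<dots> = ennreal ((norm \<phi>)\<^sup>2 / L)"
    unfolding N_orbit_span[OF s(1)]
    by (rule lim_imp_Liminf[OF sequentially_bot])
      (intro tendsto_ennrealI tendsto_divide tendsto_power tendsto_norm tendsto_const s(2), use L_pos in simp)
  finally show ?thesis .
qed

lemma N_finite: "N \<phi> < \<infinity>"
  using N_le[of \<phi>] by (rule le_less_trans) simp

lemma B_add_left: "B (x + y) z = B x z + B y z" and B_scaleC_left: "B (c *\<^sub>C x) z = cnj c * B x z"
  and B_add_right: "B z (x + y) = B z x + B z y" and B_scaleC_right: "B z (c *\<^sub>C x) = c * B z x"
proof -
  show "B (x + y) z = B x z + B y z"
    using B_lin_left[OF N_finite N_finite N_finite, of 1 x y z] by simp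
  show "B z (x + y) = B z x + B z y"
    using B_lin_right[OF N_finite N_finite N_finite, of z 1 x y] by simp
  show "B (c *\<^sub>C x) z = cnj c * B x z"
    using B_lin_left[OF N_finite N_finite N_finite, of c x 0 z] by (simp add: B_zero)
  have "B z 0 = 0" by (simp add: B_def Q_def coh_fun_zero)
  then show "B z (c *\<^sub>C x) = c * B z x"
    using B_lin_right[OF N_finite N_finite N_finite, of z c x 0] by simp
qed

lemma B_commute: "B y x = cnj (B x y)"
proof -
  have "Q y x = (\<lambda>p. cnj (Q x y p))" by (simp add: fun_eq_iff Q_def mult_ac)
  then show ?thesis unfolding B_def by (simp add: integral_cnj)
qed

lemma B_self_le: "cmod (B \<phi> \<phi>) \<le> (norm \<phi>)\<^sup>2"
proof -
  have "enn2real (N \<phi>) \<le> (norm \<phi>)\<^sup>2 / L"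
    using enn2real_mono[OF N_le] L_pos by simp
  then have "L * enn2real (N \<phi>) \<le> (norm \<phi>)\<^sup>2" using L_pos by (simp add: field_simps)
  moreover have "0 \<le> L * enn2real (N \<phi>)" using L_pos by simp
  ultimately show ?thesis unfolding B_self[OF N_finite] norm_of_real by simp
qed

theorem B_eq_cinner: "B \<phi> \<psi> = cinner \<phi> \<psi>"
proof (rule sesquilinear_eq_cinner[of B])
  fix \<phi>
  obtain s where s: "\<And>n. s n \<in> orbit_span" "s \<longlonglongrightarrow> \<phi>" using orbit_span_approx[of \<phi>] by blast
  have sB: "B (s n) \<psi> = cinner (s n) \<psi>" for n \<psi> using B_orbit_span[OF s(1)] N_finite by blast
  have sB': "B \<psi> (s n) = cinner \<psi> (s n)" for n \<psi>
    by (simp add: B_commute[of \<psi>] cinner_commute[of \<psi>] sB)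
  have le: "cmod (B \<phi> \<phi> - cinner \<phi> \<phi>) \<le> 2 * (norm (\<phi> - s n))\<^sup>2" for n
  proof -
    define e where "e = \<phi> - s n"
    have \<phi>: "\<phi> = s n + e" by (simp add: e_def)
    \<comment> \<open>Every term containing s n agrees in the two forms because s n lies in the
      span. What remains is the error vector, on which both forms are bounded by the squared
      norm.\<close>
    have "B \<phi> \<phi> - cinner \<phi> \<phi> = B e e - cinner e e"
      unfolding \<phi> B_add_left B_add_right cinner_add_left cinner_add_right sB sB' by simp
    also have "cmod \<dots> \<le> cmod (B e e) + cmod (cinner e e)" by (rule norm_triangle_ineq4)
    also have "\<dots> \<le> (norm e)\<^sup>2 + (norm e)\<^sup>2"
      by (intro add_mono B_self_le) (simp add: cinner_self norm_power)
    finally show ?thesis unfolding e_def by simp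
  qed
  have lim: "(\<lambda>n. 2 * (norm (\<phi> - s n))\<^sup>2) \<longlonglongrightarrow> 2 * (norm (\<phi> - \<phi>))\<^sup>2"
    by (intro tendsto_mult tendsto_power tendsto_norm tendsto_diff tendsto_const s(2))
  have "cmod (B \<phi> \<phi> - cinner \<phi> \<phi>) \<le> 2 * (norm (\<phi> - \<phi>))\<^sup>2"
    by (rule LIMSEQ_le_const[OF lim]) (use le in blast)
  then show "B \<phi> \<phi> = cinner \<phi> \<phi>" by simp
qed (rule B_add_left B_add_right B_scaleC_left B_scaleC_right)+

section \<open>The reproducing kernel space and the explicit formulas\<close>

lemma coh_kernel_fun:
  assumes "q \<in> DJ"
  shows "(\<lambda>p. if p \<in> DJ then coh_kernel U e0 p q else 0) = coh_fun U e0 (E (conj2 q))"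
  using conj2_DJ[OF assms] by (simp add: fun_eq_iff coh_fun_def coh_kernel_def coherent_eq)

text \<open>Every clause is pulled back along the map from \<psi> to f_\<psi>, which
  \<open>ip\<close> makes isometric: completeness is that of the Hilbert space, and the kernel
  section at q is the image of \<open>E (conj2 q)\<close>.\<close>

theorem holomorphic_rkhs_coh_fun:
  assumes ip: "\<And>\<phi> \<psi>. ip (coh_fun U e0 \<phi>) (coh_fun U e0 \<psi>) = cinner \<phi> \<psi>"
  shows "holomorphic_rkhs DJ (coh_kernel U e0) (range (coh_fun U e0)) ip"
proof -
  let ?f = "coh_fun U e0"
  have add: "(\<lambda>p. ?f \<phi> p + ?f \<psi> p) = ?f (\<phi> + \<psi>)" for \<phi> \<psi> by (simp add: fun_eq_iff coh_fun_add)
  have diff: "(\<lambda>p. ?f \<phi> p - ?f \<psi> p) = ?f (\<phi> - \<psi>)" for \<phi> \<psi> by (simp add: fun_eq_iff coh_fun_diff)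
  have scale: "(\<lambda>p. c * ?f \<phi> p) = ?f (c *\<^sub>C \<phi>)" for \<phi> c by (simp add: fun_eq_iff coh_fun_scaleC)
  have zero: "(\<lambda>_. 0) = ?f 0" by (simp add: fun_eq_iff coh_fun_zero)
  have ip_self: "Re (ip (?f \<phi>) (?f \<phi>)) = (norm \<phi>)\<^sup>2" for \<phi> by (simp add: ip cinner_self)
  have complete: "\<exists>F\<in>range ?f. (\<lambda>n. Re (ip (\<lambda>p. X n p - F p) (\<lambda>p. X n p - F p))) \<longlonglongrightarrow> 0"
    if X: "\<forall>n. X n \<in> range ?f"
      and C: "\<forall>\<epsilon>>0. \<exists>N. \<forall>m\<ge>N. \<forall>n\<ge>N. Re (ip (\<lambda>p. X m p - X n p) (\<lambda>p. X m p - X n p)) < \<epsilon>" for X :: "nat \<Rightarrow> C2 \<Rightarrow> complex"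
  proof -
    have "\<forall>n. \<exists>x. X n = ?f x" using X by blast
    then obtain x where x: "\<And>n. X n = ?f (x n)" by metis
    have C': "\<forall>\<epsilon>>0. \<exists>N. \<forall>m\<ge>N. \<forall>n\<ge>N. (norm (x m - x n))\<^sup>2 < \<epsilon>"
      using C unfolding x diff ip_self .
    have "Cauchy x"
    proof (rule CauchyI)
      fix e :: real assume e: "0 < e"
      then obtain M where M: "\<forall>m\<ge>M. \<forall>n\<ge>M. (norm (x m - x n))\<^sup>2 < e\<^sup>2"
        using C'[rule_format, of "e\<^sup>2"] by auto
      have "norm (x m - x n) < e" if "m \<ge> M" "n \<ge> M" for m n
        using M that e by (intro power_less_imp_less_base[of _ 2 e]) auto
      then show "\<exists>M. \<forall>m\<ge>M. \<forall>n\<ge>M. norm (x m - x n) < e" by blast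
    qed
    then obtain l where l: "x \<longlonglongrightarrow> l" using Cauchy_convergent convergent_def by blast
    have "(\<lambda>n. (norm (x n - l))\<^sup>2) \<longlonglongrightarrow> (norm (l - l))\<^sup>2"
      by (intro tendsto_power tendsto_norm tendsto_diff tendsto_const l)
    then have "(\<lambda>n. Re (ip (\<lambda>p. X n p - ?f l p) (\<lambda>p. X n p - ?f l p))) \<longlonglongrightarrow> 0"
      unfolding x diff ip_self by simp
    then show ?thesis by blast
  qed
  have pos: "Re (ip (?f \<phi>) (?f \<phi>)) > 0" if "?f \<phi> \<noteq> (\<lambda>_. 0)" for \<phi>
  proof -
    have "\<phi> \<noteq> 0" using that zero by metis
    then show ?thesis unfolding ip_self by simp
  qed
  have ker: "(\<lambda>p. if p \<in> DJ then coh_kernel U e0 p q else 0) \<in> range ?f \<and>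
      (\<forall>F\<in>range ?f. ip (\<lambda>p. if p \<in> DJ then coh_kernel U e0 p q else 0) F = F q)" if "q \<in> DJ" for q
    unfolding coh_kernel_fun[OF that] using coh_fun_eq[OF that] ip by auto
  show ?thesis
    unfolding holomorphic_rkhs_def
  proof (intro conjI)
    show "\<forall>F\<in>range ?f. holomorphic2_on F DJ \<and> (\<forall>p. p \<notin> DJ \<longrightarrow> F p = 0)"
      using coh_fun_holomorphic2 by (auto simp: coh_fun_def)
    show "(\<lambda>_. 0) \<in> range ?f" unfolding zero by (rule rangeI)
    show "\<forall>F\<in>range ?f. \<forall>G\<in>range ?f. (\<lambda>p. F p + G p) \<in> range ?f" by (auto simp: add)
    show "\<forall>c. \<forall>F\<in>range ?f. (\<lambda>p. c * F p) \<in> range ?f" by (auto simp: scale)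
    show "\<forall>E\<in>range ?f. \<forall>F\<in>range ?f. \<forall>G\<in>range ?f. ip E (\<lambda>p. F p + G p) = ip E F + ip E G"
      by (auto simp: add ip cinner_add_right)
    show "\<forall>c. \<forall>F\<in>range ?f. \<forall>G\<in>range ?f. ip F (\<lambda>p. c * G p) = c * ip F G"
      by (auto simp: scale ip cinner_scaleC_right)
    show "\<forall>F\<in>range ?f. \<forall>G\<in>range ?f. ip F G = cnj (ip G F)"
      using cinner_commute by (auto simp: ip)
    show "\<forall>F\<in>range ?f. F \<noteq> (\<lambda>_. 0) \<longrightarrow> Re (ip F F) > 0" using pos by blast
  qed (use complete ker in blast)+
qed

text \<open>On the disc 1 - w conj w is a positive real number, so the principal branch of the power
  is the real power and the two exponentials merge into the real weight.\<close>

lemma kernel_weight: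
  assumes "cmod w < 1"
  shows "(1 - w * cnj w) powr (2 * complex_of_real k) * exp (- complex_of_real ((cmod z)\<^sup>2) / (1 - w * cnj w))
    * exp (- (z\<^sup>2 * cnj w + (cnj z)\<^sup>2 * w) / (2 * (1 - w * cnj w))) = of_real (rho k (z, w))"
proof -
  define d where "d = 1 - (cmod w)\<^sup>2"
  define r where "r = Re (z\<^sup>2 * cnj w)"
  have "(z, w) \<in> DJ" using assms by (simp add: DJ_def)
  from Re_jD_pos[OF this] have d: "d > 0" by (simp add: d_def)
  have J: "1 - w * cnj w = of_real d"
    using jD_of_real[of "(z, w)"] unfolding jD_def d_def by simp
  have "z\<^sup>2 * cnj w + (cnj z)\<^sup>2 * w = z\<^sup>2 * cnj w + cnj (z\<^sup>2 * cnj w)" by simp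
  also have "\<dots> = of_real (2 * r)" unfolding r_def by (rule complex_add_cnj)
  finally have X: "z\<^sup>2 * cnj w + (cnj z)\<^sup>2 * w = of_real (2 * r)" .
  have p: "complex_of_real d powr (2 * complex_of_real k) = of_real (d powr (2 * k))"
    using powr_of_real[of d "2 * k"] d by simp
  have "- complex_of_real ((cmod z)\<^sup>2) / of_real d + - of_real (2 * r) / (2 * of_real d)
      = of_real (- ((cmod z)\<^sup>2 + r) / d)"
    using d by (simp add: field_simps)
  then have "exp (- complex_of_real ((cmod z)\<^sup>2) / of_real d) * exp (- of_real (2 * r) / (2 * of_real d))
      = of_real (exp (- ((cmod z)\<^sup>2 + r) / d))"
    unfolding exp_add[symmetric] by (simp only: exp_of_real)
  then show ?thesis
    unfolding J X p mult.assoc rho_def by (simp add: d_def r_def)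
qed

text \<open>An equality of total functions: outside \<open>DJ\<close> both sides vanish because
  \<open>coh_fun\<close> is 0 there, whatever value the complex power takes.\<close>

lemma integrand_eq_Q:
  "(\<lambda>(z, w). cnj (coh_fun U e0 \<phi> (z, w)) * coh_fun U e0 \<psi> (z, w) * (1 - w * cnj w) powr (2 * complex_of_real k)
     * exp (- complex_of_real ((cmod z)\<^sup>2) / (1 - w * cnj w))
     * exp (- (z\<^sup>2 * cnj w + (cnj z)\<^sup>2 * w) / (2 * (1 - w * cnj w)))) = Q \<phi> \<psi>"
proof (rule ext, clarify)
  fix z w
  show "cnj (coh_fun U e0 \<phi> (z, w)) * coh_fun U e0 \<psi> (z, w) * (1 - w * cnj w) powr (2 * complex_of_real k)
     * exp (- complex_of_real ((cmod z)\<^sup>2) / (1 - w * cnj w))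
     * exp (- (z\<^sup>2 * cnj w + (cnj z)\<^sup>2 * w) / (2 * (1 - w * cnj w))) = Q \<phi> \<psi> (z, w)"
  proof (cases "cmod w < 1")
    case True
    show ?thesis unfolding Q_def kernel_weight[OF True, of z, symmetric] by (simp only: mult.assoc)
  next
    case False
    then have "(z, w) \<notin> DJ" by (simp add: DJ_def)
    then show ?thesis by (simp add: Q_def coh_fun_def)
  qed
qed

lemma kahler_potential_eq: "p \<in> DJ \<Longrightarrow> kahler_potential U e0 p = kpot k p"
  by (simp add: kahler_potential_def coh_kernel_def coherent_eq conj2_DJ cinner_E_self)

lemma kahler_potential_formula:
  assumes "cmod w < 1"
  shows "complex_of_real (kahler_potential U e0 (z, w)) =
    (2 * z * cnj z + z\<^sup>2 * cnj w + (cnj z)\<^sup>2 * w) / (2 * (1 - w * cnj w))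
    - 2 * complex_of_real k * ln (1 - w * cnj w)"
proof -
  have DJ: "(z, w) \<in> DJ" using assms by (simp add: DJ_def)
  then have d: "1 - (cmod w)\<^sup>2 > 0" using Re_jD_pos by fastforce
  have J: "jD (z, w) = 1 - w * cnj w" by (simp add: jD_def)
  have "ln (1 - w * cnj w) = of_real (ln (1 - (cmod w)\<^sup>2))"
    unfolding J[symmetric] jD_of_real snd_conv by (rule Ln_of_real[OF d])
  then show ?thesis
    unfolding kahler_potential_eq[OF DJ] kpot_eq J by simp
qed

lemma kernel_formula:
  assumes "cmod w < 1" "cmod w' < 1"
  shows "coh_kernel U e0 (z, w) (z', w') = (1 - w * cnj w') powr (- 2 * complex_of_real k)
    * exp ((2 * cnj z' * z + z\<^sup>2 * cnj w' + (cnj z')\<^sup>2 * w) / (2 * (1 - w * cnj w')))"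
proof -
  have DJ: "conj2 (z, w) \<in> DJ" "conj2 (z', w') \<in> DJ" using assms by (simp_all add: DJ_def conj2_def)
  show ?thesis
    unfolding coh_kernel_def coherent_eq cinner_E[OF DJ]
    by (simp add: conj2_def algebra_simps)
qed

lemma kahler_two_form:
  assumes "p \<in> DJ"
  shows "\<i> * del_delbar (\<lambda>q. complex_of_real (kahler_potential U e0 q)) p u v = omega k p u v"
  by (rule del_delbar_kpot[OF assms]) (simp add: kahler_potential_eq)

lemma smooth_on_kahler_potential: "smooth_on DJ (kahler_potential U e0)"
  by (rule smooth_on_cong[OF open_DJ _ smooth_on_kpot]) (simp add: kahler_potential_eq)

lemma kahler_form_on_kahler_potential:
  "kahler_form_on DJ (\<lambda>p u v. \<i> * del_delbar (\<lambda>q. complex_of_real (kahler_potential U e0 q)) p u v)"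
  by (rule kahler_form_on_cong[OF open_DJ kahler_two_form kahler_form_omega]) (use k_ge in simp_all)

end

theorem proposition2:
  fixes U :: "jacobi \<Rightarrow> 'h::complex_hilbert \<Rightarrow> 'h" and e0 :: 'h and k k' :: real
  assumes separable: "\<exists>D::'h set. countable D \<and> closure D = UNIV"
    and rep: "continuous_unitary_rep U"
    and relations: "jacobi_relations U"
    and e0_cyclic: "cyclic_vector U e0"
    and e0_smooth: "e0 \<in> smooth_vectors U"
    and e0_unit: "cinner e0 e0 = 1"
    and e0_lowest: "op_a U e0 = 0" "op_Km U e0 = 0" "op_K0 U e0 = complex_of_real k *\<^sub>C e0"
    and k: "k > 0" "\<exists>j::nat. j \<ge> 2 \<and> 2 * k = real j"
    and k': "2 * k = 2 * k' + 1 / 2"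
  shows
    \<comment> \<open>(i)\<close>
    "(let f = kahler_potential U e0;
          \<omega> = (\<lambda>p u v. \<i> * del_delbar (\<lambda>q. complex_of_real (f q)) p u v)
      in
        (\<forall>z w. cmod w < 1 \<longrightarrow>
           complex_of_real (f (z, w)) =
             (2 * z * cnj z + z\<^sup>2 * cnj w + (cnj z)\<^sup>2 * w) / (2 * (1 - w * cnj w))
             - 2 * complex_of_real k * ln (1 - w * cnj w)) \<and>
        smooth_on DJ f \<and>
        kahler_form_on DJ \<omega> \<and>
        (\<forall>g\<in>jacobi_group. \<forall>p\<in>DJ. \<forall>u v.
           \<omega> (jacobi_act g p) (frechet_derivative (jacobi_act g) (at p) u)
                              (frechet_derivative (jacobi_act g) (at p) v) = \<omega> p u v) \<and>
        (\<forall>z w u v. cmod w < 1 \<longrightarrow>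
           (let \<alpha>\<^sub>0 = (z + cnj z * w) / (1 - w * cnj w);
                A = (\<lambda>x. fst x + cnj \<alpha>\<^sub>0 * snd x)
            in - \<i> * \<omega> (z, w) u v =
                 2 * complex_of_real k / (1 - w * cnj w)\<^sup>2 * wedge snd (\<lambda>x. cnj (snd x)) u v
                 + wedge A (\<lambda>x. cnj (A x)) u v / (1 - w * cnj w))))
    \<and> \<comment> \<open>(ii)\<close>
     (\<forall>n m z w. cmod w < 1 \<longrightarrow>
        coh_fun U e0 (basis_vec U e0 k' n m) (z, w) =
          complex_of_real (sqrt (Gamma (real m + 2 * k') / (fact m * Gamma (2 * k'))))
          * w ^ m * (P_poly n z w / complex_of_real (sqrt (fact n))))
    \<and> \<comment> \<open>(iii)\<close>
     (let \<Lambda> = (4 * k - 3) / (2 * pi\<^sup>2);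
          integrand = (\<lambda>F G (z, w).
             cnj (F (z, w)) * G (z, w) * (1 - w * cnj w) powr (2 * complex_of_real k)
             * exp (- complex_of_real ((cmod z)\<^sup>2) / (1 - w * cnj w))
             * exp (- (z\<^sup>2 * cnj w + (cnj z)\<^sup>2 * w) / (2 * (1 - w * cnj w))));
          ip = (\<lambda>F G. complex_of_real \<Lambda> * (LINT p|jacobi_measure. integrand F G p))
      in
        (\<forall>z w z' w'. cmod w < 1 \<and> cmod w' < 1 \<longrightarrow>
           coh_kernel U e0 (z, w) (z', w') =
             (1 - w * cnj w') powr (- 2 * complex_of_real k)
             * exp ((2 * cnj z' * z + z\<^sup>2 * cnj w' + (cnj z')\<^sup>2 * w) / (2 * (1 - w * cnj w')))) \<and>
        (\<forall>g\<in>jacobi_group.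
           distr jacobi_measure jacobi_measure (jacobi_act g) = jacobi_measure) \<and>
        (\<forall>\<phi> \<psi>. integrable jacobi_measure (integrand (coh_fun U e0 \<phi>) (coh_fun U e0 \<psi>)) \<and>
                cinner \<phi> \<psi> = ip (coh_fun U e0 \<phi>) (coh_fun U e0 \<psi>)) \<and>
        holomorphic_rkhs DJ (coh_kernel U e0) (range (coh_fun U e0)) ip)"
proof -
  \<comment> \<open>From 2k \<ge> 2; this bound makes the weight integrable and k' positive.\<close>
  have "k \<ge> 1" using k(2) by auto
  then interpret jacobi_rep U e0 k k'
    using rep relations e0_cyclic e0_smooth e0_unit e0_lowest k' by unfold_locales
  have L: "(4 * k - 3) / (2 * pi\<^sup>2) = L" by (simp add: L_def)
  show ?thesis
    unfolding Let_def L integrand_eq_Q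
  proof (intro conjI)
    show "\<forall>z w. cmod w < 1 \<longrightarrow>
           complex_of_real (kahler_potential U e0 (z, w)) =
             (2 * z * cnj z + z\<^sup>2 * cnj w + (cnj z)\<^sup>2 * w) / (2 * (1 - w * cnj w))
             - 2 * complex_of_real k * ln (1 - w * cnj w)"
      using kahler_potential_formula by blast
    show "smooth_on DJ (kahler_potential U e0)"
      by (rule smooth_on_kahler_potential)
    show "kahler_form_on DJ (\<lambda>p u v. \<i> * del_delbar (\<lambda>q. complex_of_real (kahler_potential U e0 q)) p u v)"
      by (rule kahler_form_on_kahler_potential)
    show "\<forall>g\<in>jacobi_group. \<forall>p\<in>DJ. \<forall>u v.
           \<i> * del_delbar (\<lambda>q. complex_of_real (kahler_potential U e0 q)) (jacobi_act g p)
             (frechet_derivative (jacobi_act g) (at p) u) (frechet_derivative (jacobi_act g) (at p) v)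
           = \<i> * del_delbar (\<lambda>q. complex_of_real (kahler_potential U e0 q)) p u v"
      by (intro ballI allI) (simp only: kahler_two_form jacobi_act_DJ omega_invariant)
    show "\<forall>z w u v. cmod w < 1 \<longrightarrow>
           - \<i> * (\<i> * del_delbar (\<lambda>q. complex_of_real (kahler_potential U e0 q)) (z, w) u v) =
           2 * complex_of_real k / (1 - w * cnj w)\<^sup>2 * wedge snd (\<lambda>x. cnj (snd x)) u v
           + wedge (\<lambda>x. fst x + cnj ((z + cnj z * w) / (1 - w * cnj w)) * snd x)
               (\<lambda>x. cnj (fst x + cnj ((z + cnj z * w) / (1 - w * cnj w)) * snd x)) u v / (1 - w * cnj w)"
    proof (intro allI impI)
      fix z w u v assume "cmod w < 1"
      then have "(z, w) \<in> DJ" by (simp add: DJ_def)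
      have "- \<i> * (\<i> * x) = x" for x by (simp flip: mult.assoc)
      then show "- \<i> * (\<i> * del_delbar (\<lambda>q. complex_of_real (kahler_potential U e0 q)) (z, w) u v) =
           2 * complex_of_real k / (1 - w * cnj w)\<^sup>2 * wedge snd (\<lambda>x. cnj (snd x)) u v
           + wedge (\<lambda>x. fst x + cnj ((z + cnj z * w) / (1 - w * cnj w)) * snd x)
               (\<lambda>x. cnj (fst x + cnj ((z + cnj z * w) / (1 - w * cnj w)) * snd x)) u v / (1 - w * cnj w)"
        unfolding kahler_two_form[OF \<open>(z, w) \<in> DJ\<close>] omega_def A_form_def[abs_def] alpha0_def jD_def fst_conv snd_conv .
    qed
    show "\<forall>n m z w. cmod w < 1 \<longrightarrow>
        coh_fun U e0 (basis_vec U e0 k' n m) (z, w) =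
          complex_of_real (sqrt (Gamma (real m + 2 * k') / (fact m * Gamma (2 * k'))))
          * w ^ m * (P_poly n z w / complex_of_real (sqrt (fact n)))"
      using coh_fun_basis by blast
    show "\<forall>z w z' w'. cmod w < 1 \<and> cmod w' < 1 \<longrightarrow>
           coh_kernel U e0 (z, w) (z', w') =
             (1 - w * cnj w') powr (- 2 * complex_of_real k)
             * exp ((2 * cnj z' * z + z\<^sup>2 * cnj w' + (cnj z')\<^sup>2 * w) / (2 * (1 - w * cnj w')))"
      using kernel_formula by blast
    show "\<forall>g\<in>jacobi_group. distr jacobi_measure jacobi_measure (jacobi_act g) = jacobi_measure"
      using distr_jacobi_measure by blast
    have B: "complex_of_real L * (LINT p|jacobi_measure. Q \<phi> \<psi> p) = cinner \<phi> \<psi>" for \<phi> \<psi>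
      using B_eq_cinner[of \<phi> \<psi>] unfolding B_def .
    show "\<forall>\<phi> \<psi>. integrable jacobi_measure (Q \<phi> \<psi>)
        \<and> cinner \<phi> \<psi> = complex_of_real L * (LINT p|jacobi_measure. Q \<phi> \<psi> p)"
      unfolding B using integrable_Q[OF N_finite N_finite] by simp
    show "holomorphic_rkhs DJ (coh_kernel U e0) (range (coh_fun U e0))
      (\<lambda>F G. complex_of_real L * (LINT p|jacobi_measure. (case p of (z, w) \<Rightarrow>
             cnj (F (z, w)) * G (z, w) * (1 - w * cnj w) powr (2 * complex_of_real k)
             * exp (- complex_of_real ((cmod z)\<^sup>2) / (1 - w * cnj w))
             * exp (- (z\<^sup>2 * cnj w + (cnj z)\<^sup>2 * w) / (2 * (1 - w * cnj w))))))"
      by (rule holomorphic_rkhs_coh_fun) (simp only: fun_cong[OF integrand_eq_Q] B)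
  qed
qed

end
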